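(* There exists a generalized pentagonal geometry $\mathrm{PENT}(3,r,19)$ with deficiency graph of girth at least $5$ for every integer $r \ge 3411$ with $r \equiv 0$ or $2 \pmod 3$. There exists a generalized pentagonal geometry $\mathrm{PENT}(3,r,21)$ with deficiency graph of girth at least $5$ for every integer $r \ge 4666$ with $r \equiv 0$ or $1 \pmod 3$.
   Context: A Steiner system $S(2,k,w)$ is a pair $(W,\mathcal{B})$ where $W$ is a set of $w$ points and $\mathcal{B}$ is a set of $k$-subsets of $W$ (blocks) such that each pair of distinct points of $W$ lies in exactly one block. A generalized pentagonal geometry $\mathrm{PENT}(k,r,w)$ (with $k\ge 2$, $w\ge k$) is a (nonempty) partial linear space, i.e. a set of points together with a set of lines (sets of points) such that any two distinct points lie on at most one common line, in which every line contains exactly $k$ points, every point is on exactly $r$ lines, and for each point $x$ the set $W_x$ of points $y \ne x$ that are not collinear with $x$ (i.e. not on a common line with $x$) is the point set of a Steiner system $S(2,k,w)$ all of whose blocks are lines of the geometry. The deficiency graph of such a geometry has the points as vertices, with two distinct points adjacent precisely when they are not collinear. *)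

theory Defs
  imports "HOL-Number_Theory.Cong" "HOL-Library.Extended_Nat"
begin

definition partial_linear_space :: "'a set \<Rightarrow> 'a set set \<Rightarrow> bool" where
  "partial_linear_space P L \<longleftrightarrow>
     (\<forall>l\<in>L. l \<subseteq> P) \<and>
     (\<forall>x\<in>P. \<forall>y\<in>P. x \<noteq> y \<longrightarrow> (\<forall>l\<in>L. \<forall>m\<in>L. {x, y} \<subseteq> l \<and> {x, y} \<subseteq> m \<longrightarrow> l = m))"

definition collinear_in :: "'a set set \<Rightarrow> 'a \<Rightarrow> 'a \<Rightarrow> bool" where
  "collinear_in L x y \<longleftrightarrow> (\<exists>l\<in>L. x \<in> l \<and> y \<in> l)"

definition steiner_system2 :: "nat \<Rightarrow> nat \<Rightarrow> 'a set \<Rightarrow> 'a set set \<Rightarrow> bool" where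
  "steiner_system2 k w W B \<longleftrightarrow>
     finite W \<and> card W = w \<and>
     (\<forall>b\<in>B. b \<subseteq> W \<and> card b = k) \<and>
     (\<forall>x\<in>W. \<forall>y\<in>W. x \<noteq> y \<longrightarrow> (\<exists>!b. b \<in> B \<and> x \<in> b \<and> y \<in> b))"

definition noncollinear_points :: "'a set \<Rightarrow> 'a set set \<Rightarrow> 'a \<Rightarrow> 'a set" where
  "noncollinear_points P L x = {y \<in> P. y \<noteq> x \<and> \<not> collinear_in L x y}"

text \<open>Finiteness of the pencil of lines through a point is stated because the
  cardinality of an infinite set is 0.\<close>

definition PENT :: "nat \<Rightarrow> nat \<Rightarrow> nat \<Rightarrow> 'a set \<Rightarrow> 'a set set \<Rightarrow> bool" where
  "PENT k r w P L \<longleftrightarrow>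
     2 \<le> k \<and> k \<le> w \<and>
     P \<noteq> {} \<and> partial_linear_space P L \<and>
     (\<forall>l\<in>L. card l = k) \<and>
     (\<forall>x\<in>P. finite {l \<in> L. x \<in> l} \<and> card {l \<in> L. x \<in> l} = r) \<and>
     (\<forall>x\<in>P. \<exists>B\<subseteq>L. steiner_system2 k w (noncollinear_points P L x) B)"

text \<open>A simple graph is given by its vertex set V and its set E of edges, which are
  two-element subsets of V.\<close>

definition deficiency_edges :: "'a set \<Rightarrow> 'a set set \<Rightarrow> 'a set set" where
  "deficiency_edges P L =
     {{x, y} | x y. x \<in> P \<and> y \<in> P \<and> x \<noteq> y \<and> \<not> collinear_in L x y}"

text \<open>A cycle is given by its distinct vertices in cyclic order, the first one not
  being repeated at the end, so that its length is the length of the list.\<close>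

definition graph_cycle :: "'a set \<Rightarrow> 'a set set \<Rightarrow> 'a list \<Rightarrow> bool" where
  "graph_cycle V E c \<longleftrightarrow>
     3 \<le> length c \<and> distinct c \<and> set c \<subseteq> V \<and>
     (\<forall>i<length c. {c ! i, c ! (Suc i mod length c)} \<in> E)"

text \<open>The girth of a graph without cycles is \<open>\<infinity>\<close>, the infimum of the empty set.\<close>

definition girth :: "'a set \<Rightarrow> 'a set set \<Rightarrow> enat" where
  "girth V E = (INF c\<in>{c. graph_cycle V E c}. enat (length c))"

end

theory Submission
  imports Defs
begin

text \<open>
  Write \<open>v = 2 r + 1 + w\<close> for the number of points. Let \<open>E\<close> be a \<open>w\<close>-regular graph without 3-cycles and
  4-cycles on \<open>v\<close> vertices, and put a Steiner triple system on every neighbourhood. What is missing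
  for a geometry with deficiency graph \<open>E\<close> are triples that cover exactly once every far pair, that
  is, every non-adjacent pair without a common neighbour. There are at least \<open>v (v - 1 - w\<^sup>2)\<close>
  ordered far pairs, so it suffices that the triples cover every far pair and number at most
  \<open>v (v - 1 - w\<^sup>2) / 6\<close>.

  A Golomb ruler \<open>D\<close> with \<open>w\<close> marks gives such a graph on two copies (layers) of the integers modulo
  \<open>n\<close>: join \<open>x\<close> in the first to \<open>x + d\<close> in the second. Two layers with a computed difference family
  give a geometry with \<open>u\<close> points, which serves as a hole. It extends to \<open>6 n + u\<close> points for every
  large \<open>n\<close>: all differences inside the six layers are absorbed by triples with two points in one layer
  (Bose's construction), most of the remaining cross differences by cyclic Latin squares, and the
  bounded number of cross differences left over decompose into perfect matchings between the layers,
  one for each point of the hole.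
\<close>

section \<open>Geometries from graphs of girth five\<close>

text \<open>What the uniform construction loses does not depend on \<open>n\<close>: the
  \<open>w (w - 1) / 2\<close> positive differences of \<open>D\<close> already have common
  neighbours, so their Bose triples must be left out and \<open>w (w - 1)\<close> cross differences
  stay uncovered for each layer. Hence a hole of fixed size suffices. Six layers are chosen because
  the fifteen pairs of layers split in two compatible ways: into six pairs for Bose's triples and
  three triangles for the Latin squares, the triangles containing the pairs joined by the graph; and
  into five perfect matchings of the complete graph on the layers. The matchings demand
  \<open>5 s - w - 1 + t\<close> points of the hole, where \<open>s + t = w (w - 1)\<close>.
  Equating this with \<open>2 m\<close> gives \<open>m = (5 w (w - 1) - w - 1) / 2 - 2 t\<close>,
  which is 843 and 841 for \<open>w = 19\<close>, and 1037 and 1035 for \<open>w = 21\<close>. Since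
  \<open>r = 3 n + m - (w + 1) / 2\<close>, the values \<open>t = 1\<close> and \<open>t = 2\<close>
  yield the two residue classes of \<open>r\<close>, with \<open>n\<close> of either parity.\<close>

definition girth5_graph :: "nat \<Rightarrow> 'a set \<Rightarrow> ('a \<Rightarrow> 'a \<Rightarrow> bool) \<Rightarrow> bool" where
  "girth5_graph w V E \<longleftrightarrow> finite V \<and> (\<forall>x y. E x y \<longrightarrow> x \<in> V \<and> y \<in> V \<and> E y x) \<and>
     (\<forall>x\<in>V. card {y. E x y} = w) \<and>
     (\<forall>x y z. E x y \<longrightarrow> E y z \<longrightarrow> \<not> E z x) \<and>
     (\<forall>x y a b. x \<noteq> y \<longrightarrow> E x a \<longrightarrow> E y a \<longrightarrow> E x b \<longrightarrow> E y b \<longrightarrow> a = b)"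

definition far :: "('a \<Rightarrow> 'a \<Rightarrow> bool) \<Rightarrow> 'a \<Rightarrow> 'a \<Rightarrow> bool" where
  "far E x y \<longleftrightarrow> x \<noteq> y \<and> \<not> E x y \<and> (\<forall>z. \<not> (E x z \<and> E y z))"

text \<open>Only upper bounds on sizes are demanded, and no disjointness: a construction may repeat
  or collapse triples without any check, because counting forces exactness afterwards. The count is
  written additively to avoid truncated subtraction.\<close>

definition tight_cover :: "nat \<Rightarrow> 'a set \<Rightarrow> ('a \<Rightarrow> 'a \<Rightarrow> bool) \<Rightarrow> 'a set set \<Rightarrow> bool" where
  "tight_cover w V E T \<longleftrightarrow> girth5_graph w V E \<and> finite T \<and>
     (\<forall>t\<in>T. t \<subseteq> V \<and> card t \<le> 3) \<and>
     (\<forall>x\<in>V. \<forall>y\<in>V. far E x y \<longrightarrow> (\<exists>t\<in>T. x \<in> t \<and> y \<in> t)) \<and>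
     6 * card T + card V * (1 + w\<^sup>2) \<le> card V * card V"

lemma card_ordered_pairs: "finite t \<Longrightarrow> card {(x, y). x \<in> t \<and> y \<in> t \<and> x \<noteq> y} = card t * (card t - 1)"
proof -
  assume f: "finite t"
  have "{(x, y). x \<in> t \<and> y \<in> t \<and> x \<noteq> y} = (SIGMA x:t. t - {x})" by auto
  then show ?thesis using f by simp
qed

text \<open>A Moore-type bound: at most \<open>1 + w + w (w - 1)\<close> vertices, \<open>x\<close>
  included, lie within distance two of \<open>x\<close>.\<close>

lemma card_far:
  assumes G: "girth5_graph w V E" and x: "x \<in> V"
  shows "card V \<le> card {y \<in> V. far E x y} + (1 + w\<^sup>2)"
proof -
  have fin: "finite V" and sym: "\<And>x y. E x y \<Longrightarrow> x \<in> V \<and> y \<in> V \<and> E y x"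
    and reg: "\<And>x. x \<in> V \<Longrightarrow> card {y. E x y} = w"
    using G unfolding girth5_graph_def by blast+
  have finN: "finite {y. E z y}" for z
    by (rule finite_subset[OF _ fin]) (use sym in blast)
  let ?N2 = "\<Union>z\<in>{z. E x z}. {y. E z y} - {x}"
  have "card ?N2 \<le> (\<Sum>z\<in>{z. E x z}. card ({y. E z y} - {x}))"
    using finN by (intro card_UN_le) auto
  also have "\<dots> \<le> (\<Sum>z\<in>{z. E x z}. w - 1)"
  proof (rule sum_mono)
    fix z assume "z \<in> {z. E x z}"
    then have "x \<in> {y. E z y}" "card {y. E z y} = w" using sym reg by blast+
    then show "card ({y. E z y} - {x}) \<le> w - 1" using finN by simp
  qed
  also have "\<dots> = w * (w - 1)" using reg[OF x] by simp
  finally have c2: "card ?N2 \<le> w * (w - 1)" .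
  have "V \<subseteq> {y \<in> V. far E x y} \<union> ({x} \<union> ({y. E x y} \<union> ?N2))"
    using sym unfolding far_def by blast
  then have "card V \<le> card ({y \<in> V. far E x y} \<union> ({x} \<union> ({y. E x y} \<union> ?N2)))"
    using fin finN by (intro card_mono) auto
  also have "\<dots> \<le> card {y \<in> V. far E x y} + (card {x} + (card {y. E x y} + card ?N2))"
    by (meson add_left_mono card_Un_le le_trans)
  also have "\<dots> \<le> card {y \<in> V. far E x y} + (1 + (w + w * (w - 1)))"
    using c2 reg[OF x] by simp
  also have "w + w * (w - 1) = w\<^sup>2" by (cases w) (auto simp: power2_eq_square)
  finally show ?thesis .
qed

text \<open>Both sides of the count of ordered far pairs agree, so the covering is exact.\<close>

lemma tight_cover_exact:
  assumes T: "tight_cover w V E T"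
  shows "t \<in> T \<Longrightarrow> card t = 3"
    and "t \<in> T \<Longrightarrow> x \<in> t \<Longrightarrow> y \<in> t \<Longrightarrow> x \<noteq> y \<Longrightarrow> far E x y"
    and "t \<in> T \<Longrightarrow> t' \<in> T \<Longrightarrow> x \<in> t \<Longrightarrow> y \<in> t \<Longrightarrow> x \<in> t' \<Longrightarrow> y \<in> t' \<Longrightarrow> x \<noteq> y \<Longrightarrow> t = t'"
proof -
  have G: "girth5_graph w V E" and finT: "finite T"
    and tV: "\<And>t. t \<in> T \<Longrightarrow> t \<subseteq> V" and t3: "\<And>t. t \<in> T \<Longrightarrow> card t \<le> 3"
    and cov: "\<And>x y. x \<in> V \<Longrightarrow> y \<in> V \<Longrightarrow> far E x y \<Longrightarrow> \<exists>t\<in>T. x \<in> t \<and> y \<in> t"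
    and cnt: "6 * card T + card V * (1 + w\<^sup>2) \<le> card V * card V"
    using T unfolding tight_cover_def by blast+
  have fin: "finite V" using G unfolding girth5_graph_def by blast
  have fint: "finite t" if "t \<in> T" for t using that tV fin finite_subset by blast
  define P where "P t = {(x, y). x \<in> t \<and> y \<in> t \<and> x \<noteq> y}" for t :: "'a set"
  \<comment> \<open>\<open>S\<close> consists of the triples with an ordered pair inside. The chain
    is 6|T| <= |Q| <= |snd(S)| <= |S| <= 6|T|. Equality makes \<open>snd\<close> injective on
    \<open>S\<close>, so no pair is covered twice; makes its image equal to \<open>Q\<close>, so
    only far pairs are covered; and gives every \<open>P t\<close> six elements, so that
    \<open>card t = 3\<close>.\<close>
  define S where "S = (SIGMA t:T. P t)"
  define Q where "Q = (SIGMA x:V. {y \<in> V. far E x y})"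
  have finP: "finite (P t)" if "t \<in> T" for t
    by (rule finite_subset[of _ "t \<times> t"]) (use fint[OF that] in \<open>auto simp: P_def\<close>)
  have P6: "card (P t) \<le> 6" if "t \<in> T" for t
  proof -
    have "card t * (card t - 1) \<le> 3 * 2" using t3[OF that] by (intro mult_le_mono) auto
    then show ?thesis using card_ordered_pairs[OF fint[OF that]] by (simp add: P_def)
  qed
  have finS: "finite S" using finT finP by (auto simp: S_def)
  have cS: "card S = (\<Sum>t\<in>T. card (P t))" using finT finP by (simp add: S_def)
  also have "\<dots> \<le> (\<Sum>t\<in>T. 6)" by (rule sum_mono) (rule P6)
  finally have S_le: "card S \<le> 6 * card T" by simp
  have "card V * card V = (\<Sum>x\<in>V. card V)" by simp
  also have "\<dots> \<le> (\<Sum>x\<in>V. card {y \<in> V. far E x y} + (1 + w\<^sup>2))"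
    by (rule sum_mono) (rule card_far[OF G])
  also have "\<dots> = card Q + card V * (1 + w\<^sup>2)" unfolding sum.distrib using fin by (simp add: Q_def)
  finally have Q_ge: "6 * card T \<le> card Q" using cnt by linarith
  have QS: "Q \<subseteq> snd ` S"
  proof (clarsimp simp: Q_def)
    fix x y assume xy: "x \<in> V" "y \<in> V" "far E x y"
    from cov[OF this] obtain t where "t \<in> T" "x \<in> t" "y \<in> t" by blast
    then have "(t, x, y) \<in> S" using xy by (auto simp: S_def P_def far_def)
    then show "(x, y) \<in> snd ` S" by force
  qed
  have "card Q \<le> card (snd ` S)" using QS finS by (intro card_mono) auto
  moreover have "card (snd ` S) \<le> card S" using finS by (rule card_image_le)
  ultimately have eqs: "card Q = card (snd ` S)" "card (snd ` S) = card S" "card S = 6 * card T"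
    using S_le Q_ge by linarith+
  have "Q = snd ` S" using QS eqs(1) finS by (intro card_subset_eq) auto
  moreover have inj: "inj_on snd S" using eqs(2) finS by (simp add: eq_card_imp_inj_on)
  moreover have "card (P t) = 6" if "t \<in> T" for t
    by (rule sum_mono_inv[of "\<lambda>t. card (P t)" T "\<lambda>_. 6"]) (use eqs(3) cS P6 finT that in auto)
  ultimately have a: "Q = snd ` S" "inj_on snd S" "\<And>t. t \<in> T \<Longrightarrow> card (P t) = 6" by blast+
  show "card t = 3" if "t \<in> T"
  proof -
    have "card t * (card t - 1) = 6" using a(3)[OF that] card_ordered_pairs[OF fint[OF that]] by (simp add: P_def)
    moreover have "card t = 0 \<or> card t = 1 \<or> card t = 2 \<or> card t = 3" using t3[OF that] by linarith
    ultimately show ?thesis by auto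
  qed
  show "far E x y" if "t \<in> T" "x \<in> t" "y \<in> t" "x \<noteq> y"
  proof -
    have "(t, x, y) \<in> S" using that by (auto simp: S_def P_def)
    then have "(x, y) \<in> Q" using a(1) by force
    then show ?thesis by (auto simp: Q_def)
  qed
  show "t = t'" if "t \<in> T" "t' \<in> T" "x \<in> t" "y \<in> t" "x \<in> t'" "y \<in> t'" "x \<noteq> y"
  proof -
    have "(t, x, y) \<in> S" "(t', x, y) \<in> S" using that by (auto simp: S_def P_def)
    then show ?thesis using inj_onD[OF a(2), of "(t, x, y)" "(t', x, y)"] by simp
  qed
qed

lemma steiner_system2_bij:
  assumes S: "steiner_system2 k w W B" and b: "bij_betw f W W'"
  shows "steiner_system2 k w W' ((`) f ` B)"
proof -
  have fin: "finite W" and c: "card W = w" and bl: "\<And>b. b \<in> B \<Longrightarrow> b \<subseteq> W \<and> card b = k"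
    and ex: "\<And>x y. x \<in> W \<Longrightarrow> y \<in> W \<Longrightarrow> x \<noteq> y \<Longrightarrow> \<exists>!b. b \<in> B \<and> x \<in> b \<and> y \<in> b"
    using S unfolding steiner_system2_def by blast+
  have inj: "inj_on f W" and im: "f ` W = W'" using b by (auto simp: bij_betw_def)
  have mem: "f x \<in> f ` b \<longleftrightarrow> x \<in> b" if "b \<in> B" "x \<in> W" for b x
    using inj bl[OF that(1)] that(2) by (meson inj_on_image_mem_iff)
  have "\<exists>!b. b \<in> (`) f ` B \<and> x \<in> b \<and> y \<in> b" if xy: "x \<in> W'" "y \<in> W'" "x \<noteq> y" for x y
  proof -
    from xy im obtain u v where uv: "u \<in> W" "v \<in> W" "x = f u" "y = f v" "u \<noteq> v" by blast
    from ex[OF uv(1,2,5)] obtain b where b: "b \<in> B" "u \<in> b" "v \<in> b"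
      and u: "\<And>b'. b' \<in> B \<Longrightarrow> u \<in> b' \<Longrightarrow> v \<in> b' \<Longrightarrow> b' = b" by blast
    show ?thesis
    proof (rule ex1I)
      show "f ` b \<in> (`) f ` B \<and> x \<in> f ` b \<and> y \<in> f ` b" using b uv by simp
      fix c assume "c \<in> (`) f ` B \<and> x \<in> c \<and> y \<in> c"
      then obtain b' where b': "b' \<in> B" "c = f ` b'" "f u \<in> f ` b'" "f v \<in> f ` b'" using uv by auto
      then have "u \<in> b'" "v \<in> b'" using mem uv by blast+
      then show "c = f ` b" using u b' by blast
    qed
  qed
  moreover have "card (f ` b) = k" if "b \<in> B" for b
    using bl[OF that] inj card_image inj_on_subset by blast
  moreover have "finite W'" "card W' = w" using im fin c card_image[OF inj] by auto
  moreover have "f ` b \<subseteq> W'" if "b \<in> B" for b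
    using bl[OF that] im by blast
  ultimately show ?thesis unfolding steiner_system2_def by simp
qed

text \<open>With \<open>x\<close> removed, the lines through \<open>x\<close> partition
  \<open>U\<close> into pairs.\<close>

lemma card_pencil:
  assumes fin: "finite U" and cov: "\<And>y. y \<in> U \<Longrightarrow> \<exists>l\<in>Lx. y \<in> l"
    and l: "\<And>l. l \<in> Lx \<Longrightarrow> x \<in> l \<and> l - {x} \<subseteq> U \<and> card l = 3" and "x \<notin> U"
    and uniq: "\<And>l l' y. l \<in> Lx \<Longrightarrow> l' \<in> Lx \<Longrightarrow> y \<in> l \<Longrightarrow> y \<in> l' \<Longrightarrow> y \<noteq> x \<Longrightarrow> l = l'"
  shows "finite Lx \<and> card U = 2 * card Lx"
proof -
  have "Lx \<subseteq> Pow (insert x U)" using l by blast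
  then have finL: "finite Lx" using fin finite_subset by blast
  have "U = (\<Union>l\<in>Lx. l - {x})" using l cov \<open>x \<notin> U\<close> by blast
  also have "card \<dots> = (\<Sum>l\<in>Lx. card (l - {x}))"
  proof (rule card_UN_disjoint[OF finL])
    show "\<forall>i\<in>Lx. finite (i - {x})" using l fin finite_subset by blast
    show "\<forall>i\<in>Lx. \<forall>j\<in>Lx. i \<noteq> j \<longrightarrow> (i - {x}) \<inter> (j - {x}) = {}"
      using uniq by blast
  qed
  also have "\<dots> = (\<Sum>l\<in>Lx. 2)" by (rule sum.cong) (use l in auto)
  finally show ?thesis using finL by simp
qed

text \<open>The lines are \<open>T\<close> and the blocks on all neighbourhoods. Without 4-cycles a
  pair with a common neighbour has only one, hence lies in one block; without triangles no block
  contains an adjacent pair. So non-collinearity of distinct points is exactly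
  \<open>E\<close>.\<close>

lemma tight_cover_PENT:
  assumes T: "tight_cover w V E T" and S: "steiner_system2 3 w W0 B0" and w: "3 \<le> w"
    and ne: "V \<noteq> {}" and v: "card V = 2 * r + 1 + w"
  shows "\<exists>L. PENT 3 r w V L \<and> 5 \<le> girth V (deficiency_edges V L)"
proof -
  have G: "girth5_graph w V E" and finT: "finite T" and tV: "\<And>t. t \<in> T \<Longrightarrow> t \<subseteq> V"
    and cov: "\<And>x y. x \<in> V \<Longrightarrow> y \<in> V \<Longrightarrow> far E x y \<Longrightarrow> \<exists>t\<in>T. x \<in> t \<and> y \<in> t"
    using T unfolding tight_cover_def by blast+
  note exact = tight_cover_exact[OF T]
  have fin: "finite V" and sym: "\<And>x y. E x y \<Longrightarrow> x \<in> V \<and> y \<in> V \<and> E y x"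
    and reg: "\<And>x. x \<in> V \<Longrightarrow> card {y. E x y} = w"
    and tri: "\<And>x y z. E x y \<Longrightarrow> E y z \<Longrightarrow> \<not> E z x"
    and c4: "\<And>x y a b. x \<noteq> y \<Longrightarrow> E x a \<Longrightarrow> E y a \<Longrightarrow> E x b \<Longrightarrow> E y b \<Longrightarrow> a = b"
    using G unfolding girth5_graph_def by blast+
  have finN: "finite {y. E z y}" for z
    by (rule finite_subset[OF _ fin]) (use sym in blast)
  have "\<exists>B. steiner_system2 3 w {y. E x y} B" if x: "x \<in> V" for x
  proof -
    have "finite W0" "card W0 = w" using S unfolding steiner_system2_def by blast+
    then obtain f where "bij_betw f W0 {y. E x y}"
      using finite_same_card_bij[of W0 "{y. E x y}"] finN[of x] reg[OF x] by auto
    from steiner_system2_bij[OF S this] show ?thesis by blast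
  qed
  then obtain B where B: "\<And>x. x \<in> V \<Longrightarrow> steiner_system2 3 w {y. E x y} (B x)" by metis
  define L where "L = T \<union> (\<Union>x\<in>V. B x)"
  have bl: "b \<subseteq> {y. E z y} \<and> card b = 3" if "z \<in> V" "b \<in> B z" for z b
    using B[OF that(1)] that(2) unfolding steiner_system2_def by blast
  have bex: "\<exists>!b. b \<in> B z \<and> x \<in> b \<and> y \<in> b" if "z \<in> V" "E z x" "E z y" "x \<noteq> y" for z x y
    using B[OF that(1)] that(2-) unfolding steiner_system2_def by simp
  have LV: "l \<subseteq> V" if "l \<in> L" for l using that tV bl sym unfolding L_def by blast
  have L3: "card l = 3" if "l \<in> L" for l using that exact(1) bl unfolding L_def by blast
  have uniq: "l = m" if lm: "l \<in> L" "m \<in> L" "x \<in> l" "y \<in> l" "x \<in> m" "y \<in> m" "x \<noteq> y" for l m x y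
  proof -
    have one: "l \<in> T" if h: "l \<in> L" "far E x y" "x \<in> l" "y \<in> l" for l
      using h bl sym unfolding L_def far_def by blast
    have two: "\<exists>z. z \<in> V \<and> E z x \<and> E z y \<and> l \<in> B z" if h: "l \<in> L" "\<not> far E x y" "x \<in> l" "y \<in> l" for l
      using h bl exact(2) lm(7) unfolding L_def by blast
    show ?thesis
    proof (cases "far E x y")
      case True
      show ?thesis using exact(3)[OF one[OF lm(1) True lm(3,4)] one[OF lm(2) True lm(5,6)]] lm by blast
    next
      case False
      from two[OF lm(1) False lm(3,4)] obtain z where z: "z \<in> V" "E z x" "E z y" "l \<in> B z" by blast
      from two[OF lm(2) False lm(5,6)] obtain z' where z': "z' \<in> V" "E z' x" "E z' y" "m \<in> B z'" by blast
      have "z = z'" using c4[OF lm(7)] sym z z' by blast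
      then show ?thesis using bex[OF z(1,2,3) lm(7)] lm z z' by blast
    qed
  qed
  have col: "collinear_in L x y \<longleftrightarrow> \<not> E x y" if xy: "x \<in> V" "y \<in> V" "x \<noteq> y" for x y
  proof
    assume "collinear_in L x y"
    then obtain l where l: "l \<in> L" "x \<in> l" "y \<in> l" unfolding collinear_in_def by blast
    show "\<not> E x y"
    proof (cases "l \<in> T")
      case True then show ?thesis using exact(2)[OF True l(2,3) xy(3)] far_def by metis
    next
      case False
      then obtain z where "E z x" "E z y" using l bl unfolding L_def by blast
      then show ?thesis using tri sym by blast
    qed
  next
    assume nE: "\<not> E x y"
    show "collinear_in L x y"
    proof (cases "far E x y")
      case True then show ?thesis using cov[OF xy(1,2)] unfolding collinear_in_def L_def by blast
    next
      case False
      then obtain z where "E x z" "E y z" using nE xy unfolding far_def by blast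
      then show ?thesis using bex[of z x y] sym xy unfolding collinear_in_def L_def by blast
    qed
  qed
  have irr: "\<not> E x x" for x using tri by blast
  have nc: "noncollinear_points V L x = {y. E x y}" if "x \<in> V" for x
    using col[OF that] sym irr unfolding noncollinear_points_def by blast
  have pencil: "finite {l \<in> L. x \<in> l} \<and> card {l \<in> L. x \<in> l} = r" if x: "x \<in> V" for x
  proof -
    let ?U = "V - insert x {y. E x y}"
    have "finite {l \<in> L. x \<in> l} \<and> card ?U = 2 * card {l \<in> L. x \<in> l}"
    proof (rule card_pencil)
      show "finite ?U" using fin by simp
      show "\<exists>l\<in>{l \<in> L. x \<in> l}. y \<in> l" if "y \<in> ?U" for y
      proof -
        have "collinear_in L x y" using col[OF x, of y] that by auto
        then show ?thesis unfolding collinear_in_def by blast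
      qed
      show "x \<in> l \<and> l - {x} \<subseteq> ?U \<and> card l = 3" if "l \<in> {l \<in> L. x \<in> l}" for l
      proof -
        have l: "l \<in> L" "x \<in> l" using that by auto
        have "\<not> E x y" if "y \<in> l" "y \<noteq> x" for y
          using col[OF x, of y] LV[OF l(1)] l that unfolding collinear_in_def by blast
        then show ?thesis using l LV[OF l(1)] L3[OF l(1)] by blast
      qed
      show "l = l'" if "l \<in> {l \<in> L. x \<in> l}" "l' \<in> {l \<in> L. x \<in> l}" "y \<in> l" "y \<in> l'" "y \<noteq> x" for l l' y
        using uniq that by blast
    qed simp
    moreover have "card ?U = card V - card (insert x {y. E x y})"
      using sym x finN by (intro card_Diff_subset) auto
    moreover have "card (insert x {y. E x y}) = Suc w"
      using irr finN reg[OF x] by simp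
    ultimately show ?thesis using v by simp
  qed
  have pls: "partial_linear_space V L"
    unfolding partial_linear_space_def
  proof (intro conjI ballI impI)
    show "l \<subseteq> V" if "l \<in> L" for l using LV[OF that] .
    show "l = m" if "x \<noteq> y" "l \<in> L" "m \<in> L" "{x, y} \<subseteq> l \<and> {x, y} \<subseteq> m" for x y l m
      using uniq[OF that(2,3), of x y] that by simp
  qed
  have st: "\<exists>B\<subseteq>L. steiner_system2 3 w (noncollinear_points V L x) B" if "x \<in> V" for x
    using B[OF that] nc[OF that] that unfolding L_def by (intro exI[of _ "B x"]) auto
  have "PENT 3 r w V L" unfolding PENT_def using w ne pls L3 pencil st by auto
  moreover have "5 \<le> girth V (deficiency_edges V L)"
    unfolding girth_def
  proof (rule INF_greatest)
    fix c assume "c \<in> {c. graph_cycle V (deficiency_edges V L) c}"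
    then have c: "3 \<le> length c" "distinct c"
      and ed: "\<And>i. i < length c \<Longrightarrow> {c ! i, c ! (Suc i mod length c)} \<in> deficiency_edges V L"
      unfolding graph_cycle_def by blast+
    have E: "E (c ! i) (c ! (Suc i mod length c))" if "i < length c" for i
    proof -
      from ed[OF that] obtain x y where "{c ! i, c ! (Suc i mod length c)} = {x, y}" "x \<in> V" "y \<in> V" "E x y"
        unfolding deficiency_edges_def using col by blast
      then show ?thesis using sym by (auto simp: doubleton_eq_iff)
    qed
    have "length c \<noteq> 3"
    proof
      assume l: "length c = 3"
      have m: "Suc 0 mod length c = 1" "Suc 1 mod length c = 2" "Suc 2 mod length c = 0" using l by simp_all
      then have "E (c!0) (c!1)" "E (c!1) (c!2)" "E (c!2) (c!0)"
        using E[of 0, unfolded m] E[of 1, unfolded m] E[of 2, unfolded m] l by simp_all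
      then show False using tri by blast
    qed
    moreover have "length c \<noteq> 4"
    proof
      assume l: "length c = 4"
      have m: "Suc 0 mod length c = 1" "Suc 1 mod length c = 2" "Suc 2 mod length c = 3" "Suc 3 mod length c = 0"
        using l by simp_all
      then have "E (c!0) (c!1)" "E (c!1) (c!2)" "E (c!2) (c!3)" "E (c!3) (c!0)"
        using E[of 0, unfolded m] E[of 1, unfolded m] E[of 2, unfolded m] E[of 3, unfolded m] l by simp_all
      moreover have "c!0 \<noteq> c!2" "c!1 \<noteq> c!3" using c(2) l by (auto simp: nth_eq_iff_index_eq)
      ultimately show False using c4[of "c!0" "c!2" "c!1" "c!3"] sym by blast
    qed
    ultimately have "5 \<le> length c" using c(1) by linarith
    then show "5 \<le> enat (length c)" by (metis enat_ord_simps(1) numeral_eq_enat)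
  qed
  ultimately show ?thesis by blast
qed

text \<open>Serves to move the construction, which lives on a sum of layers, to the natural
  numbers.\<close>

lemma tight_cover_image:
  assumes T: "tight_cover w V E T" and inj: "inj f"
  shows "tight_cover w (f ` V) (\<lambda>x y. \<exists>a b. x = f a \<and> y = f b \<and> E a b) ((`) f ` T)"
proof -
  have G: "girth5_graph w V E" and finT: "finite T" and tV: "\<And>t. t \<in> T \<Longrightarrow> t \<subseteq> V \<and> card t \<le> 3"
    and cov: "\<And>x y. x \<in> V \<Longrightarrow> y \<in> V \<Longrightarrow> far E x y \<Longrightarrow> \<exists>t\<in>T. x \<in> t \<and> y \<in> t"
    and cnt: "6 * card T + card V * (1 + w\<^sup>2) \<le> card V * card V"
    using T unfolding tight_cover_def by blast+
  have fin: "finite V" and sym: "\<And>x y. E x y \<Longrightarrow> x \<in> V \<and> y \<in> V \<and> E y x"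
    and reg: "\<And>x. x \<in> V \<Longrightarrow> card {y. E x y} = w"
    and tri: "\<And>x y z. E x y \<Longrightarrow> E y z \<Longrightarrow> \<not> E z x"
    and c4: "\<And>x y a b. x \<noteq> y \<Longrightarrow> E x a \<Longrightarrow> E y a \<Longrightarrow> E x b \<Longrightarrow> E y b \<Longrightarrow> a = b"
    using G unfolding girth5_graph_def by blast+
  define E' where "E' x y \<longleftrightarrow> (\<exists>a b. x = f a \<and> y = f b \<and> E a b)" for x y
  have E'f: "E' (f a) y \<longleftrightarrow> (\<exists>b. y = f b \<and> E a b)" for a y
    using inj by (auto simp: E'_def inj_eq)
  have E'D: "E' x y \<Longrightarrow> \<exists>a b. x = f a \<and> y = f b \<and> E a b" for x y by (simp add: E'_def)
  have eq: "f a = f b \<longleftrightarrow> a = b" for a b using inj by (simp add: inj_eq)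
  have cards: "card (f ` A) = card A" for A using inj by (meson card_image inj_on_subset subset_UNIV)
  have nb: "{y. E' (f x) y} = f ` {y. E x y}" for x by (auto simp: E'f)
  have g: "girth5_graph w (f ` V) E'"
    unfolding girth5_graph_def
  proof (intro conjI allI impI ballI)
    show "finite (f ` V)" using fin by simp
    show "x \<in> f ` V" "y \<in> f ` V" "E' y x" if "E' x y" for x y
      using E'D[OF that] sym by (auto simp: E'f eq)
    show "card {y. E' x y} = w" if "x \<in> f ` V" for x using that reg by (auto simp: nb cards)
    show "\<not> E' z x" if "E' x y" "E' y z" for x y z
    proof -
      from E'D[OF that(1)] obtain x' y' where 1: "x = f x'" "y = f y'" "E x' y'" by blast
      from E'D[OF that(2)] obtain z' where 2: "z = f z'" "E y' z'" using 1 by (auto simp: eq)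
      show ?thesis using tri[OF 1(3) 2(2)] 1 2 by (simp add: E'f eq)
    qed
    show "a = b" if "x \<noteq> y" "E' x a" "E' y a" "E' x b" "E' y b" for x y a b
    proof -
      from E'D[OF that(2)] obtain x' a' where 1: "x = f x'" "a = f a'" "E x' a'" by blast
      from E'D[OF that(3)] obtain y' where 2: "y = f y'" "E y' a'" using 1 by (auto simp: eq)
      from E'D[OF that(4)] obtain b' where 3: "b = f b'" "E x' b'" using 1 by (auto simp: eq)
      have "E y' b'" using that(5) 2 3 by (simp add: E'f eq)
      then show ?thesis using c4[of x' y' a' b'] 1 2 3 that(1) by blast
    qed
  qed
  have "\<exists>t\<in>(`) f ` T. x \<in> t \<and> y \<in> t" if xy: "x \<in> f ` V" "y \<in> f ` V" "far E' x y" for x y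
  proof -
    from xy obtain a b where ab: "a \<in> V" "b \<in> V" "x = f a" "y = f b" by blast
    then have "far E a b" using xy(3) unfolding far_def by (auto simp: E'f eq)
    then obtain t where "t \<in> T" "a \<in> t" "b \<in> t" using cov ab by blast
    then show ?thesis using ab by auto
  qed
  moreover have "card ((`) f ` T) \<le> card T" using finT by (rule card_image_le)
  then have "6 * card ((`) f ` T) + card (f ` V) * (1 + w\<^sup>2) \<le> card (f ` V) * card (f ` V)"
    using cnt unfolding cards by linarith
  ultimately have "tight_cover w (f ` V) E' ((`) f ` T)"
    unfolding tight_cover_def using g finT tV by (simp add: cards image_mono)
  then show ?thesis unfolding E'_def .
qed

section \<open>Layered graphs and difference families\<close>

lemma girth5_graph_sum:
  assumes 1: "girth5_graph w V1 E1" and 2: "girth5_graph w V2 E2"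
  shows "girth5_graph w (V1 <+> V2) (rel_sum E1 E2)"
proof -
  have L: "rel_sum E1 E2 (Inl x) u \<longleftrightarrow> (\<exists>y. u = Inl y \<and> E1 x y)" for x u
    by (cases u) auto
  have R: "rel_sum E1 E2 (Inr x) u \<longleftrightarrow> (\<exists>y. u = Inr y \<and> E2 x y)" for x u
    by (cases u) auto
  have N: "{u. rel_sum E1 E2 (Inl x) u} = Inl ` {y. E1 x y}"
    "{u. rel_sum E1 E2 (Inr x') u} = Inr ` {y. E2 x' y}" for x x'
    by (auto simp: L R)
  have s1: "E1 x y \<Longrightarrow> x \<in> V1 \<and> y \<in> V1 \<and> E1 y x" for x y
    using 1 unfolding girth5_graph_def by blast
  have s2: "E2 x y \<Longrightarrow> x \<in> V2 \<and> y \<in> V2 \<and> E2 y x" for x y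
    using 2 unfolding girth5_graph_def by blast
  have t1: "E1 x y \<Longrightarrow> E1 y z \<Longrightarrow> \<not> E1 z x" for x y z
    using 1 unfolding girth5_graph_def by blast
  have t2: "E2 x y \<Longrightarrow> E2 y z \<Longrightarrow> \<not> E2 z x" for x y z
    using 2 unfolding girth5_graph_def by blast
  have c1: "x \<noteq> y \<Longrightarrow> E1 x a \<Longrightarrow> E1 y a \<Longrightarrow> E1 x b \<Longrightarrow> E1 y b \<Longrightarrow> a = b" for x y a b
    using 1 unfolding girth5_graph_def by blast
  have c2: "x \<noteq> y \<Longrightarrow> E2 x a \<Longrightarrow> E2 y a \<Longrightarrow> E2 x b \<Longrightarrow> E2 y b \<Longrightarrow> a = b" for x y a b
    using 2 unfolding girth5_graph_def by blast
  have r1: "x \<in> V1 \<Longrightarrow> card {y. E1 x y} = w" for x using 1 unfolding girth5_graph_def by blast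
  have r2: "x \<in> V2 \<Longrightarrow> card {y. E2 x y} = w" for x using 2 unfolding girth5_graph_def by blast
  have f: "finite V1" "finite V2" using 1 2 unfolding girth5_graph_def by auto
  show ?thesis
    unfolding girth5_graph_def
  proof (intro conjI allI impI ballI)
    show "finite (V1 <+> V2)" using f by simp
    show "x \<in> V1 <+> V2" "y \<in> V1 <+> V2" "rel_sum E1 E2 y x" if "rel_sum E1 E2 x y" for x y
      using that by (cases x; cases y; simp add: s1 s2 InlI InrI; use s1 s2 in blast)+
    show "card {y. rel_sum E1 E2 x y} = w" if "x \<in> V1 <+> V2" for x
      using that by (auto simp: N card_image r1 r2)
    show "\<not> rel_sum E1 E2 z x" if "rel_sum E1 E2 x y" "rel_sum E1 E2 y z" for x y z
      using that by (cases x) (auto simp: L R, (use t1 t2 in blast)+)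
    show "a = b" if h: "x \<noteq> y" "rel_sum E1 E2 x a" "rel_sum E1 E2 y a" "rel_sum E1 E2 x b" "rel_sum E1 E2 y b" for x y a b
    proof (cases x)
      case (Inl x')
      then obtain a' b' where 1: "a = Inl a'" "b = Inl b'" "E1 x' a'" "E1 x' b'" using h(2,4) by (auto simp: L)
      then obtain y' where "y = Inl y'" "E1 y' a'" "E1 y' b'" using h by (cases y) auto
      then show ?thesis using c1[of x' y' a' b'] 1 Inl h(1) by auto
    next
      case (Inr x')
      then obtain a' b' where 1: "a = Inr a'" "b = Inr b'" "E2 x' a'" "E2 x' b'" using h(2,4) by (auto simp: R)
      then obtain y' where "y = Inr y'" "E2 y' a'" "E2 y' b'" using h by (cases y) auto
      then show ?thesis using c2[of x' y' a' b'] 1 Inr h(1) by auto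
    qed
  qed
qed

section \<open>Layered graphs from Golomb rulers\<close>

definition layers :: "nat \<Rightarrow> int \<Rightarrow> (nat \<times> int) set" where
  "layers p n = {..<2 * p} \<times> {0..<n}"

definition arc :: "int set \<Rightarrow> nat \<Rightarrow> int \<Rightarrow> nat \<times> int \<Rightarrow> nat \<times> int \<Rightarrow> bool" where
  "arc D p n u v \<longleftrightarrow> u \<in> layers p n \<and> v \<in> layers p n \<and> even (fst u) \<and> fst v = Suc (fst u) \<and>
     (\<exists>d\<in>D. snd v = (snd u + d) mod n)"

definition layered :: "int set \<Rightarrow> nat \<Rightarrow> int \<Rightarrow> nat \<times> int \<Rightarrow> nat \<times> int \<Rightarrow> bool" where
  "layered D p n u v \<longleftrightarrow> arc D p n u v \<or> arc D p n v u"

definition golomb :: "int set \<Rightarrow> int \<Rightarrow> bool" where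
  "golomb D M \<longleftrightarrow> D \<subseteq> {0..M} \<and>
     (\<forall>a\<in>D. \<forall>b\<in>D. \<forall>c\<in>D. \<forall>d\<in>D. b < a \<longrightarrow> a - b = c - d \<longrightarrow> a = c)"

text \<open>Two differences of marks are at most \<open>2 M < n\<close> apart, so a congruence
  between them is an equality: the ruler stays Golomb modulo \<open>n\<close>.\<close>

lemma golomb_mod:
  assumes D: "golomb D M" and n: "2 * M < n" and abcd: "a \<in> D" "b \<in> D" "c \<in> D" "d \<in> D"
    and "a \<noteq> b" and eq: "(x + a) mod n = (y + b) mod n" "(x + c) mod n = (y + d) mod n"
  shows "a = c \<and> b = d"
proof -
  have r: "0 \<le> a" "a \<le> M" "0 \<le> b" "b \<le> M" "0 \<le> c" "c \<le> M" "0 \<le> d" "d \<le> M"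
    using D abcd unfolding golomb_def by auto
  have "n dvd (x + a) - (y + b)" "n dvd (x + c) - (y + d)" using eq by (simp_all add: mod_eq_dvd_iff)
  then have "n dvd ((x + a) - (y + b)) - ((x + c) - (y + d))" by (rule dvd_diff)
  moreover have "((x + a) - (y + b)) - ((x + c) - (y + d)) = (a - b) - (c - d)" by simp
  ultimately have dv: "n dvd (a - b) - (c - d)" by metis
  have "\<bar>(a - b) - (c - d)\<bar> < n" using r n by linarith
  then have e: "a - b = c - d" using dv dvd_imp_le_int[of "(a - b) - (c - d)" n] by force
  have "a = c"
  proof (cases "b < a")
    case True
    then show ?thesis using D abcd e unfolding golomb_def by blast
  next
    case False
    \<comment> \<open>Here \<open>a < b\<close>, and the ruler property is applied to the reversed
      differences \<open>b - a = d - c\<close>.\<close>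
    then have "b = d" using D abcd e \<open>a \<noteq> b\<close> unfolding golomb_def by (smt (verit))
    then show ?thesis using e by simp
  qed
  then show ?thesis using e by simp
qed

text \<open>All arcs lead from even to odd layers, so the graph is bipartite and has no triangle.
  Two common neighbours of two vertices amount to \<open>x + d1 = y + d2\<close> and
  \<open>x + d3 = y + d4\<close> modulo \<open>n\<close> (from an odd layer with reversed signs),
  and \<open>golomb_mod\<close> identifies them.\<close>

lemma layered_girth5:
  assumes D: "golomb D M" and n: "2 * M < n" and c: "card D = w" and fD: "finite D" and M: "0 \<le> M"
  shows "girth5_graph w (layers p n) (layered D p n)"
proof -
  have n0: "0 < n" using n M by simp
  have Dr: "0 \<le> d" "d < n" if "d \<in> D" for d using D n that unfolding golomb_def by auto
  have inj: "inj_on (\<lambda>d. (j, (x + s * d) mod n)) D" if s: "s = 1 \<or> s = -1" for j :: nat and x s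
  proof (rule inj_onI)
    fix d e assume d: "d \<in> D" "e \<in> D" "(j, (x + s * d) mod n) = (j, (x + s * e) mod n)"
    then have "n dvd s * (d - e)" by (simp add: mod_eq_dvd_iff algebra_simps)
    then have dv: "n dvd d - e" using s by (auto simp: dvd_diff_commute)
    have "\<bar>d - e\<bar> < n" using Dr[OF d(1)] Dr[OF d(2)] by linarith
    then show "d = e" using dv dvd_imp_le_int[of "d - e" n] by force
  qed
  have arc_inv: "arc D p n (i, x) v \<longleftrightarrow> i < 2 * p \<and> 0 \<le> x \<and> x < n \<and> even i \<and> (\<exists>d\<in>D. v = (Suc i, (x + d) mod n))" for i x v
    using n0 unfolding arc_def layers_def by (cases v) (auto elim!: evenE)
  have arc_inv': "arc D p n u (i, x) \<longleftrightarrow> i < 2 * p \<and> 0 \<le> x \<and> x < n \<and> odd i \<and> (\<exists>d\<in>D. u = (i - 1, (x - d) mod n))" for i x u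
  proof
    assume a: "arc D p n u (i, x)"
    obtain j y where u: "u = (j, y)" by force
    from a obtain d where d: "d \<in> D" "x = (y + d) mod n" "i = Suc j" "even j" "0 \<le> y" "y < n" "i < 2 * p"
      unfolding arc_def layers_def u by auto
    have "(x - d) mod n = y" using d by (simp add: mod_diff_left_eq)
    then show "i < 2 * p \<and> 0 \<le> x \<and> x < n \<and> odd i \<and> (\<exists>d\<in>D. u = (i - 1, (x - d) mod n))"
      using d n0 u by (auto intro!: bexI[of _ d])
  next
    assume a: "i < 2 * p \<and> 0 \<le> x \<and> x < n \<and> odd i \<and> (\<exists>d\<in>D. u = (i - 1, (x - d) mod n))"
    then obtain d where d: "d \<in> D" "u = (i - 1, (x - d) mod n)" by blast
    have "((x - d) mod n + d) mod n = x" using a by (simp add: mod_add_left_eq)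
    moreover have "Suc (i - 1) = i" using a by (auto elim: oddE)
    ultimately show "arc D p n u (i, x)" using a d n0 unfolding arc_def layers_def by force
  qed
  have par: "arc D p n u v \<Longrightarrow> even (fst u) \<and> odd (fst v)" for u v unfolding arc_def by simp
  show ?thesis
    unfolding girth5_graph_def
  proof (intro conjI allI impI ballI)
    show "finite (layers p n)" by (simp add: layers_def)
    show "x \<in> layers p n" "y \<in> layers p n" "layered D p n y x" if "layered D p n x y" for x y
      using that unfolding layered_def arc_def by blast+
    show "card {v. layered D p n u v} = w" if uV: "u \<in> layers p n" for u
    proof -
      obtain i x where u: "u = (i, x)" "i < 2 * p" "0 \<le> x" "x < n" using uV by (cases u) (auto simp: layers_def)
      show ?thesis
      proof (cases "even i")
        case True
        then have "{v. layered D p n u v} = (\<lambda>d. (Suc i, (x + 1 * d) mod n)) ` D"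
          using u by (auto simp: layered_def arc_inv arc_inv')
        then show ?thesis using card_image[OF inj[of 1]] c by simp
      next
        case False
        then have "{v. layered D p n u v} = (\<lambda>d. (i - 1, (x + (-1) * d) mod n)) ` D"
          using u by (auto simp: layered_def arc_inv arc_inv')
        then show ?thesis using card_image[OF inj[of "-1"]] c by simp
      qed
    qed
    show "\<not> layered D p n z x" if "layered D p n x y" "layered D p n y z" for x y z
      using that par unfolding layered_def by blast
    show "a = b" if h: "u \<noteq> v" "layered D p n u a" "layered D p n v a" "layered D p n u b" "layered D p n v b" for u v a b
    proof -
      obtain i x where u: "u = (i, x)" by force
      obtain j y where v: "v = (j, y)" by force
      show ?thesis
      proof (cases "even i")
        case True
        then have 1: "arc D p n u a" "arc D p n u b" using h par u unfolding layered_def by fastforce+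
        then have 2: "arc D p n v a" "arc D p n v b" using h par unfolding layered_def by blast+
        from 1 2 obtain d1 d2 d3 d4 where d: "d1 \<in> D" "d2 \<in> D" "d3 \<in> D" "d4 \<in> D"
          "a = (Suc i, (x + d1) mod n)" "b = (Suc i, (x + d3) mod n)"
          "a = (Suc j, (y + d2) mod n)" "b = (Suc j, (y + d4) mod n)"
          and r: "0 \<le> x" "x < n" "0 \<le> y" "y < n"
          unfolding u v arc_inv by blast
        have "d1 \<noteq> d2"
        proof
          assume "d1 = d2"
          then have "n dvd x - y" using d by (simp add: mod_eq_dvd_iff dvd_diff_commute)
          then have "x = y" using r dvd_imp_le_int[of "x - y" n] by force
          then show False using h u v d by simp
        qed
        then show ?thesis using golomb_mod[OF D n d(1-4), of x y] d by auto
      next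
        case False
        then have 1: "arc D p n a u" "arc D p n b u" using h par u unfolding layered_def by fastforce+
        then have 2: "arc D p n a v" "arc D p n b v" using h par unfolding layered_def by blast+
        from 1 2 obtain d1 d2 d3 d4 where d: "d1 \<in> D" "d2 \<in> D" "d3 \<in> D" "d4 \<in> D"
          "a = (i - 1, (x - d1) mod n)" "b = (i - 1, (x - d3) mod n)"
          "a = (j - 1, (y - d2) mod n)" "b = (j - 1, (y - d4) mod n)"
          and r: "0 \<le> x" "x < n" "0 \<le> y" "y < n" "odd i" "odd j"
          unfolding u v arc_inv' by blast
        have "d1 \<noteq> d2"
        proof
          assume "d1 = d2"
          then have "n dvd x - y" using d by (simp add: mod_eq_dvd_iff dvd_diff_commute)
          then have "x = y" using r dvd_imp_le_int[of "x - y" n] by force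
          moreover have "i = j" using d r by (auto elim!: oddE)
          ultimately show False using h u v by simp
        qed
        moreover have "(y + d1) mod n = (x + d2) mod n" "(y + d3) mod n = (x + d4) mod n"
          using d by (simp_all add: mod_eq_dvd_iff algebra_simps dvd_diff_commute)
        ultimately show ?thesis using golomb_mod[OF D n d(1-4), of y x] d by auto
      qed
    qed
  qed
qed

lemma layered_not_far_cross:
  assumes "d \<in> D" "(y - x) mod n = d mod n" "(i, x) \<in> layers p n" "(Suc i, y) \<in> layers p n" "even i"
  shows "\<not> far (layered D p n) (i, x) (Suc i, y)"
proof -
  have "(x + d) mod n = (x + (y - x)) mod n" using assms(2) by (metis mod_add_right_eq)
  also have "\<dots> = y" using assms(4) by (simp add: layers_def)
  finally show ?thesis using assms unfolding far_def layered_def arc_def by auto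
qed

text \<open>The common neighbour is \<open>x + b = y + a\<close> in the next layer when
  \<open>i\<close> is even, and \<open>x - a = y - b\<close> in the previous layer when
  \<open>i\<close> is odd. Thus the differences of \<open>D\<close> must not be covered again inside
  a layer.\<close>

lemma layered_not_far_pure:
  assumes "a \<in> D" "b \<in> D" "(x - y) mod n = (a - b) mod n" "(i, x) \<in> layers p n" "(i, y) \<in> layers p n"
  shows "\<not> far (layered D p n) (i, x) (i, y)"
proof -
  have n0: "0 < n" and i: "i < 2 * p" using assms(4) by (auto simp: layers_def)
  have dv: "n dvd (x - y) - (a - b)" using assms(3) by (simp add: mod_eq_dvd_iff)
  show ?thesis
  proof (cases "even i")
    case True
    have eq: "(x + b) mod n = (y + a) mod n" using dv by (simp add: mod_eq_dvd_iff algebra_simps)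
    have "Suc i < 2 * p" using True i by (auto elim!: evenE)
    then have m: "(Suc i, (x + b) mod n) \<in> layers p n" using n0 by (simp add: layers_def)
    have "arc D p n (i, x) (Suc i, (x + b) mod n)"
      using m assms(2,4) True unfolding arc_def by auto
    moreover have "arc D p n (i, y) (Suc i, (x + b) mod n)"
      using m assms(1,5) True unfolding arc_def eq by auto
    ultimately have "layered D p n (i, x) (Suc i, (x + b) mod n)" "layered D p n (i, y) (Suc i, (x + b) mod n)"
      unfolding layered_def by blast+
    then show ?thesis unfolding far_def by blast
  next
    case False
    have eq: "(x - a) mod n = (y - b) mod n" using dv by (simp add: mod_eq_dvd_iff algebra_simps)
    have xa: "((x - a) mod n + a) mod n = x" using assms(4) by (simp add: layers_def mod_add_left_eq)
    moreover have "((x - a) mod n + b) mod n = y"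
      unfolding eq using assms(5) by (simp add: layers_def mod_add_left_eq)
    ultimately have xa: "((x - a) mod n + a) mod n = x" "((x - a) mod n + b) mod n = y" by blast+
    have m: "(i - 1, (x - a) mod n) \<in> layers p n" using n0 i by (auto simp: layers_def)
    have e: "even (i - 1)" "i = Suc (i - 1)" using False by (auto elim!: oddE)
    have "arc D p n (i - 1, (x - a) mod n) (i, x)"
      using m assms(1,4) e xa(1) unfolding arc_def by (auto intro!: bexI[of _ a])
    moreover have "arc D p n (i - 1, (x - a) mod n) (i, y)"
      using m assms(2,5) e xa(2) unfolding arc_def by (auto intro!: bexI[of _ b])
    ultimately have "layered D p n (i, x) (i - 1, (x - a) mod n)" "layered D p n (i, y) (i - 1, (x - a) mod n)"
      unfolding layered_def by blast+
    then show ?thesis unfolding far_def by blast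
  qed
qed

section \<open>Orbits of base blocks and the differences they cover\<close>

definition orbit :: "int \<Rightarrow> (nat \<times> int) set \<Rightarrow> (nat \<times> int) set set" where
  "orbit n B = (\<lambda>z. (\<lambda>(i, a). (i, (z + a) mod n)) ` B) ` {0..<n}"

text \<open>The layers are ordered: \<delta> is the coordinate in layer \<open>i\<close> minus the
  one in layer \<open>j\<close>, and exchanging the layers negates it. Each pair of layers is
  therefore given one direction below.\<close>

definition dcov :: "(nat \<times> int) set set \<Rightarrow> int \<Rightarrow> nat \<Rightarrow> nat \<Rightarrow> int \<Rightarrow> bool" where
  "dcov \<B> n i j \<delta> \<longleftrightarrow> (\<exists>B\<in>\<B>. \<exists>a b. (i, a) \<in> B \<and> (j, b) \<in> B \<and> (a - b) mod n = \<delta> mod n)"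

lemma dcovI: "B \<in> \<B> \<Longrightarrow> (i, a) \<in> B \<Longrightarrow> (j, b) \<in> B \<Longrightarrow> (a - b) mod n = \<delta> mod n \<Longrightarrow> dcov \<B> n i j \<delta>"
  unfolding dcov_def by blast

text \<open>Translation by \<open>x - a\<close> moves \<open>(i, a)\<close> to
  \<open>(i, x)\<close>, and equality of the differences makes it move \<open>(j, b)\<close> to
  \<open>(j, y)\<close>.\<close>

lemma dcov_orbit:
  assumes "dcov \<B> n i j (x - y)" "0 \<le> x" "x < n" "0 \<le> y" "y < n"
  shows "\<exists>t\<in>(\<Union>B\<in>\<B>. orbit n B). (i, x) \<in> t \<and> (j, y) \<in> t"
proof -
  from assms(1) obtain B a b where B: "B \<in> \<B>" "(i, a) \<in> B" "(j, b) \<in> B" "(a - b) mod n = (x - y) mod n"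
    unfolding dcov_def by blast
  let ?z = "(x - a) mod n"
  have "(?z + a) mod n = x" using assms by (simp add: mod_add_left_eq)
  moreover have "(?z + b) mod n = y"
  proof -
    have "n dvd (a - b) - (x - y)" using B(4) by (simp add: mod_eq_dvd_iff)
    then have "(x - a + b) mod n = y mod n" by (simp add: mod_eq_dvd_iff algebra_simps dvd_diff_commute)
    then show ?thesis using assms by (simp add: mod_add_left_eq)
  qed
  moreover have "?z \<in> {0..<n}" using assms by simp
  ultimately show ?thesis using B unfolding orbit_def by force
qed

lemma orbit_props:
  assumes "t \<in> orbit n B" "card B \<le> 3" "finite B" "\<And>i a. (i, a) \<in> B \<Longrightarrow> i < k"
  shows "t \<subseteq> {..<k} \<times> {0..<n}" "card t \<le> 3"
proof -
  from assms(1) obtain z where z: "0 \<le> z" "z < n" "t = (\<lambda>(i, a). (i, (z + a) mod n)) ` B"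
    unfolding orbit_def by auto
  show "t \<subseteq> {..<k} \<times> {0..<n}" using assms(4) z by auto
  show "card t \<le> 3" using card_image_le[OF assms(3), of "\<lambda>(i, a). (i, (z + a) mod n)"] assms(2) z by simp
qed

lemma card_orbits:
  assumes "finite \<B>"
  shows "finite (\<Union>B\<in>\<B>. orbit n B)" "card (\<Union>B\<in>\<B>. orbit n B) \<le> card \<B> * nat n"
proof -
  have f: "finite (orbit n B)" for B unfolding orbit_def by simp
  then show "finite (\<Union>B\<in>\<B>. orbit n B)" using assms by simp
  have "card (\<Union>B\<in>\<B>. orbit n B) \<le> (\<Sum>B\<in>\<B>. card (orbit n B))" by (rule card_UN_le[OF assms])
  also have "\<dots> \<le> (\<Sum>B\<in>\<B>. nat n)"
  proof (rule sum_mono)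
    fix B
    have "card (orbit n B) \<le> card {0..<n}" unfolding orbit_def by (rule card_image_le) simp
    then show "card (orbit n B) \<le> nat n" by simp
  qed
  finally show "card (\<Union>B\<in>\<B>. orbit n B) \<le> card \<B> * nat n" by simp
qed

lemma mod_minus_sym:
  fixes x y n :: int
  assumes "(x - y) mod n \<noteq> 0" "0 < n"
  shows "(y - x) mod n = n - (x - y) mod n"
  using zmod_zminus1_eq_if[of "x - y" n] assms by simp

text \<open>An entry \<open>(e, a)\<close> of \<open>X l\<close> stands for the triples with two points of layer \<open>l\<close> at difference
  \<open>e\<close> whose cross differences are \<open>a\<close> and \<open>a + e\<close>; \<open>Y l\<close> lists triples inside layer \<open>l\<close>, and \<open>S\<close> the layers
  that contain the short orbit of difference \<open>m div 3\<close>.\<close>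

lemma two_layer_cover:
  fixes D :: "int set" and X Y :: "nat \<Rightarrow> (int \<times> int) list" and S :: "nat set"
  assumes D: "golomb D M" "finite D" "card D = w" "0 \<le> M" "2 * M < m" and D0: "0 \<in> D"
    and m: "m = 2 * h + 1" and S: "S \<subseteq> {0, 1}" "S \<noteq> {} \<Longrightarrow> 3 dvd m"
    and cross: "\<And>\<delta>. 1 \<le> \<delta> \<Longrightarrow> \<delta> < m \<Longrightarrow> \<delta> \<in> D \<or>
      (\<exists>l<2. \<exists>(e, a)\<in>set (X l). \<delta> = a \<or> \<delta> = (a + e) mod m)"
    and pure: "\<And>l e. l < 2 \<Longrightarrow> 1 \<le> e \<Longrightarrow> e \<le> h \<Longrightarrow> (\<exists>a\<in>D. \<exists>b\<in>D. e = a - b) \<or> e \<in> fst ` set (X l) \<or>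
      (\<exists>(a, b)\<in>set (Y l). e = a \<or> e = b \<or> e = a + b \<or> e = m - (a + b)) \<or> l \<in> S \<and> 3 * e = m"
    and count: "6 * (length (X 0) + length (X 1) + length (Y 0) + length (Y 1)) * nat m +
      2 * card S * nat m + 2 * nat m * (1 + w\<^sup>2) \<le> 2 * nat m * (2 * nat m)"
  shows "\<exists>T. tight_cover w (layers 1 m) (layered D 1 m) T"
proof -
  have m0: "0 < m" using D by simp
  define k where "k = m div 3"
  \<comment> \<open>The signs are arranged so that the coordinate in layer 1 minus the coordinate in
    layer 0 is \<open>a\<close> or \<open>a + e\<close>, whichever layer holds two of the
    points.\<close>
  define bx where "bx l = (\<lambda>(e :: int, a :: int). if l = 0 then {(0 :: nat, - a), (0, - (a + e)), (1, 0)} else {(1, a), (1, a + e), (0, 0)})" for l :: nat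
  define bt where "bt l = (\<lambda>(a :: int, b :: int). {(l, 0 :: int), (l, a), (l, a + b)})" for l :: nat
  define Bl where "Bl = map (bx 0) (X 0) @ map (bx 1) (X 1) @ map (bt 0) (Y 0) @ map (bt 1) (Y 1)"
  \<comment> \<open>The block \<open>{0, k, 2 k}\<close> is invariant under translation by
    \<open>k\<close>, so its orbit has only \<open>k\<close> triples. It is kept apart from
    \<open>Bl\<close>, where every block is charged with \<open>m\<close> triples.\<close>
  define short where "short = (\<lambda>l z. {(l :: nat, z), (l, z + k), (l, z + 2 * k)})"
  define T1 where "T1 = (\<Union>B\<in>set Bl. orbit m B)"
  define T2 where "T2 = (\<Union>l\<in>S. short l ` {0..<k})"
  have c3: "card {a, b, c} \<le> 3" for a b c :: "nat \<times> int"
    by (simp add: card_insert_if)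
  have Bl3: "card B \<le> 3 \<and> finite B \<and> (\<forall>i a. (i, a) \<in> B \<longrightarrow> i < 2 * 1)" if "B \<in> set Bl" for B
    using that by (auto simp: Bl_def bx_def bt_def c3)
  have finS: "finite S" using S(1) finite_subset by blast
  have k3: "3 * k = m" if "S \<noteq> {}" using S(2)[OF that] by (simp add: k_def)
  have T2V: "t \<subseteq> layers 1 m \<and> card t \<le> 3" if "t \<in> T2" for t
  proof -
    from that obtain l z where t: "l \<in> S" "t = {(l, z), (l, z + k), (l, z + 2 * k)}" "0 \<le> z" "z < k"
      by (auto simp: T2_def short_def)
    then have "l < 2" "3 * k = m" using S(1) k3 by auto
    then show ?thesis using t c3 by (auto simp: layers_def)
  qed
  \<comment> \<open>By symmetry one order of each pair suffices: from layer 1 to layer 0, and inside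
    a layer the order whose difference is at most \<open>h\<close>, which exists since
    \<open>m = 2 h + 1\<close>.\<close>
  have cov: "\<exists>t\<in>T1 \<union> T2. (i, x) \<in> t \<and> (j, y) \<in> t"
    if xy: "(i, x) \<in> layers 1 m" "(j, y) \<in> layers 1 m" and f: "far (layered D 1 m) (i, x) (j, y)" and ij: "i = j \<and> (x - y) mod m \<le> h \<or> j < i" for i x j y
  proof -
    have r: "0 \<le> x" "x < m" "0 \<le> y" "y < m" "i < 2" "j < 2" using xy by (auto simp: layers_def)
    let ?d = "(x - y) mod m"
    show ?thesis
    proof (cases "dcov (set Bl) m i j (x - y)")
      case True
      then show ?thesis using dcov_orbit[OF True r(1-4)] unfolding T1_def by blast
    next
      case False
      show ?thesis
      proof (cases "i = j")
        case True
        have "?d \<noteq> 0"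
        proof
          assume "?d = 0"
          then have "m dvd x - y" by auto
          then have "x = y" using r dvd_imp_le_int[of "x - y" m] by force
          then show False using f True unfolding far_def by simp
        qed
        moreover have "0 \<le> ?d" using m0 by simp
        ultimately have d: "1 \<le> ?d" "?d \<le> h" using ij True by linarith+
        have n1: "\<not> (\<exists>a\<in>D. \<exists>b\<in>D. ?d = a - b)"
          using layered_not_far_pure[of _ D _ x y m i 1] f xy True by (metis mod_mod_trivial)
        have n2: "?d \<notin> fst ` set (X i)"
        proof
          assume "?d \<in> fst ` set (X i)"
          then obtain a where a: "(?d, a) \<in> set (X i)" by force
          then have B: "bx i (?d, a) \<in> set Bl" using r(5) by (auto simp: Bl_def less_2_cases_iff)
          have "dcov (set Bl) m i i (x - y)"
          proof (cases "i = 0")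
            case True
            show ?thesis
              by (rule dcovI[OF B, of _ "- a" _ "- (a + ?d)"]) (use True in \<open>simp_all add: bx_def\<close>)
          next
            case False
            show ?thesis
              by (rule dcovI[OF B, of _ "a + ?d" _ a]) (use False r(5) in \<open>simp_all add: bx_def less_2_cases_iff\<close>)
          qed
          then show False using False \<open>i = j\<close> by simp
        qed
        have n3: "\<not> (\<exists>(a, b)\<in>set (Y i). ?d = a \<or> ?d = b \<or> ?d = a + b \<or> ?d = m - (a + b))"
        proof
          assume "\<exists>(a, b)\<in>set (Y i). ?d = a \<or> ?d = b \<or> ?d = a + b \<or> ?d = m - (a + b)"
          then obtain a b where ab: "(a, b) \<in> set (Y i)" "?d = a \<or> ?d = b \<or> ?d = a + b \<or> ?d = m - (a + b)" by blast
          then have B: "bt i (a, b) \<in> set Bl" using r(5) by (auto simp: Bl_def less_2_cases_iff)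
          have dm: "(u - v) mod m = (x - y) mod m" if "u - v = ?d" for u v
            unfolding that by (rule mod_mod_trivial)
          have dm': "(0 - (a + b)) mod m = (x - y) mod m" if "?d = m - (a + b)"
          proof -
            have "(0 - (a + b)) mod m = (m - (a + b)) mod m" by (simp add: mod_eq_dvd_iff)
            then show ?thesis using that mod_mod_trivial by metis
          qed
          have "\<exists>u v. (i, u) \<in> bt i (a, b) \<and> (i, v) \<in> bt i (a, b) \<and> (u - v) mod m = (x - y) mod m"
            using ab(2)
          proof (elim disjE)
            assume "?d = a"
            then have "(a - 0) mod m = ?d" by (intro dm) simp
            then show ?thesis unfolding bt_def by blast
          next
            assume "?d = b"
            then have "(a + b - a) mod m = ?d" by (intro dm) simp
            then show ?thesis unfolding bt_def by blast
          next
            assume "?d = a + b"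
            then have "(a + b - 0) mod m = ?d" by (intro dm) simp
            then show ?thesis unfolding bt_def by blast
          next
            assume "?d = m - (a + b)"
            from dm'[OF this] show ?thesis unfolding bt_def by blast
          qed
          then show False using False B \<open>i = j\<close> unfolding dcov_def by blast
        qed
        have s: "i \<in> S" "3 * ?d = m" using pure[OF r(5) d] n1 n2 n3 by blast+
        have k: "3 * k = m" using s(1) k3 by blast
        with s(2) have k: "?d = k" "3 * k = m" by linarith+
        \<comment> \<open>Points at difference \<open>k\<close> agree modulo \<open>k\<close>, and
          the short triple of a residue is its whole class in the layer.\<close>
        have cong: "x mod k = y mod k"
        proof -
          have "m dvd (x - y) - ?d" by (simp add: mod_eq_dvd_iff[symmetric])
          then have "k dvd (x - y) - k" using k by (metis dvd_trans dvd_triv_right)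
          then have "k dvd x - y" using dvd_add[of k "x - y - k" k] by simp
          then show ?thesis by (simp add: mod_eq_dvd_iff)
        qed
        have k0: "0 < k" using k m0 by linarith
        have mem: "(i, u) \<in> short i (u mod k)" if "0 \<le> u" "u < m" for u
        proof -
          have u: "u = u mod k + k * (u div k)" "0 \<le> u mod k" by (simp_all add: k0)
          have "0 \<le> u div k" using that k0 by (simp add: pos_imp_zdiv_nonneg_iff)
          moreover have "\<not> 3 \<le> u div k"
            using mult_left_mono[of 3 "u div k" k] k0 k u that by linarith
          ultimately have "u div k = 0 \<or> u div k = 1 \<or> u div k = 2" by linarith
          then have "u = u mod k \<or> u = u mod k + k \<or> u = u mod k + 2 * k"
          proof (elim disjE)
            assume "u div k = 0" with u(1) show ?thesis by simp
          next
            assume q: "u div k = 1" show ?thesis using u(1) unfolding q by linarith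
          next
            assume q: "u div k = 2" show ?thesis using u(1) unfolding q by linarith
          qed
          then show ?thesis unfolding short_def by blast
        qed
        have "x mod k \<in> {0..<k}" using k0 by simp
        then have "short i (x mod k) \<in> T2" using s(1) unfolding T2_def by blast
        then show ?thesis using mem[of x] mem[of y] r cong True by auto
      next
        case False
        then have ij: "i = 1" "j = 0" using ij r by auto
        have nD: "?d \<notin> D"
        proof
          assume "?d \<in> D"
          then have "\<not> far (layered D 1 m) (0, y) (Suc 0, x)"
            by (rule layered_not_far_cross) (use xy ij in auto)
          then show False using f ij unfolding far_def layered_def by auto
        qed
        moreover have "0 \<le> ?d" "?d < m" using m0 by simp_all
        moreover have "?d \<noteq> 0" using nD D0 by metis
        ultimately have "\<exists>l<2. \<exists>(e, a)\<in>set (X l). ?d = a \<or> ?d = (a + e) mod m"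
          using cross[of ?d] by force
        then obtain l e a where l: "l < 2" "(e, a) \<in> set (X l)" "?d = a \<or> ?d = (a + e) mod m" by blast
        then have B: "bx l (e, a) \<in> set Bl" by (auto simp: Bl_def less_2_cases_iff)
        have "?d = a mod m \<or> ?d = (a + e) mod m" using l(3) mod_mod_trivial by metis
        then have "dcov (set Bl) m 1 0 (x - y)"
        proof (cases "l = 0")
          case True
          assume "?d = a mod m \<or> ?d = (a + e) mod m"
          then show ?thesis
          proof
            assume "?d = a mod m"
            then show ?thesis by (intro dcovI[OF B, of _ 0 _ "- a"]) (simp_all add: bx_def True add.commute)
          next
            assume "?d = (a + e) mod m"
            then show ?thesis by (intro dcovI[OF B, of _ 0 _ "- (a + e)"]) (simp_all add: bx_def True add.commute)
          qed
        next
          case False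
          assume "?d = a mod m \<or> ?d = (a + e) mod m"
          then show ?thesis
          proof
            assume "?d = a mod m"
            then show ?thesis by (intro dcovI[OF B, of _ a _ 0]) (use False in \<open>simp_all add: bx_def\<close>)
          next
            assume "?d = (a + e) mod m"
            then show ?thesis by (intro dcovI[OF B, of _ "a + e" _ 0]) (use False in \<open>simp_all add: bx_def\<close>)
          qed
        qed
        then show ?thesis using \<open>\<not> dcov (set Bl) m i j (x - y)\<close> ij by simp
      qed
    qed
  qed
  have far_sym: "far (layered D 1 m) u v \<longleftrightarrow> far (layered D 1 m) v u" for u v
    unfolding far_def layered_def by blast
  have cov': "\<exists>t\<in>T1 \<union> T2. u \<in> t \<and> v \<in> t"
    if uv: "u \<in> layers 1 m" "v \<in> layers 1 m" "far (layered D 1 m) u v" for u v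
  proof -
    obtain i x j y where e: "u = (i, x)" "v = (j, y)" by force
    have "i = j \<and> (x - y) mod m \<le> h \<or> j < i \<or> j = i \<and> (y - x) mod m \<le> h \<or> i < j"
      using mod_minus_sym[of x y m] m0 m by (cases "(x - y) mod m = 0") auto
    then consider "i = j \<and> (x - y) mod m \<le> h \<or> j < i" | "j = i \<and> (y - x) mod m \<le> h \<or> i < j" by argo
    then show ?thesis
    proof cases
      case 1
      show ?thesis using cov[OF uv[unfolded e] 1] e by simp
    next
      case 2
      show ?thesis using cov[OF uv(2,1)[unfolded e] _ 2] far_sym uv(3) e by blast
    qed
  qed
  have "card T1 \<le> length Bl * nat m"
    using card_orbits(2)[of "set Bl" m] card_length[of Bl] unfolding T1_def
    by (meson List.finite_set le_trans mult_le_mono1)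
  moreover have "3 * card T2 \<le> card S * nat m"
  proof (cases "S = {}")
    case False
    have "card T2 \<le> (\<Sum>l\<in>S. card (short l ` {0..<k}))" unfolding T2_def by (rule card_UN_le[OF finS])
    also have "\<dots> \<le> (\<Sum>l\<in>S. nat k)"
      by (rule sum_mono) (use card_image_le[of "{0..<k}"] in force)
    finally have "card T2 \<le> card S * nat k" by simp
    moreover have "nat m = 3 * nat k" using k3[OF False] by linarith
    ultimately show ?thesis by simp
  qed (simp add: T2_def)
  moreover have "card (T1 \<union> T2) \<le> card T1 + card T2" by (rule card_Un_le)
  ultimately have "6 * card (T1 \<union> T2) \<le> 6 * (length Bl * nat m) + 2 * (card S * nat m)" by linarith
  moreover have "card (layers 1 m) = 2 * nat m" by (simp add: layers_def card_cartesian_product)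
  moreover have "length Bl = length (X 0) + length (X 1) + length (Y 0) + length (Y 1)" by (simp add: Bl_def)
  ultimately have "6 * card (T1 \<union> T2) + card (layers 1 m) * (1 + w\<^sup>2) \<le> card (layers 1 m) * card (layers 1 m)"
    using count by (simp add: algebra_simps)
  moreover have "finite (T1 \<union> T2)"
    using card_orbits(1)[of "set Bl" m] finS by (simp add: T1_def T2_def)
  moreover have "t \<subseteq> layers 1 m \<and> card t \<le> 3" if tT: "t \<in> T1 \<union> T2" for t
  proof (cases "t \<in> T2")
    case False
    then obtain B where B: "B \<in> set Bl" "t \<in> orbit m B" using tT unfolding T1_def by blast
    have "i < 2 * 1" if "(i, a) \<in> B" for i a using Bl3[OF B(1)] that by blast
    with orbit_props[OF B(2)] Bl3[OF B(1)] show ?thesis unfolding layers_def by blast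
  qed (rule T2V)
  ultimately have "tight_cover w (layers 1 m) (layered D 1 m) (T1 \<union> T2)"
    unfolding tight_cover_def using layered_girth5[OF D(1,5,3,2,4)] cov' by simp
  then show ?thesis by blast
qed

section \<open>Steiner triple systems for the neighbourhoods\<close>

lemma tight_cover_steiner:
  assumes T: "tight_cover 0 V (\<lambda>_ _. False) T"
  shows "steiner_system2 3 (card V) V T"
proof -
  note ex = tight_cover_exact[OF T]
  have fin: "finite V" and tV: "\<And>t. t \<in> T \<Longrightarrow> t \<subseteq> V"
    and cov: "\<And>x y. x \<in> V \<Longrightarrow> y \<in> V \<Longrightarrow> far (\<lambda>_ _. False) x y \<Longrightarrow> \<exists>t\<in>T. x \<in> t \<and> y \<in> t"
    using T unfolding tight_cover_def girth5_graph_def by blast+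
  have "\<exists>!b. b \<in> T \<and> x \<in> b \<and> y \<in> b" if xy: "x \<in> V" "y \<in> V" "x \<noteq> y" for x y
  proof -
    have "far (\<lambda>_ _. False) x y" using xy(3) by (simp add: far_def)
    then obtain t where t: "t \<in> T" "x \<in> t" "y \<in> t" using cov[OF xy(1,2)] by blast
    show ?thesis
    proof (rule ex1I[of _ t])
      fix b assume "b \<in> T \<and> x \<in> b \<and> y \<in> b"
      then show "b = t" using ex(3)[of b t x y] t xy(3) by simp
    qed (use t in simp)
  qed
  then show ?thesis unfolding steiner_system2_def using fin tV ex(1) by simp
qed

text \<open>A tight cover with \<open>w = 0\<close> and the empty graph is a Steiner triple system,
  because far then means distinct. So covering every difference with few enough base blocks is
  sufficient here as well.\<close>

lemma difference_family_steiner: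
  assumes \<B>: "finite \<B>" "\<And>B. B \<in> \<B> \<Longrightarrow> finite B \<and> card B \<le> 3 \<and> fst ` B \<subseteq> {..<k}" and n: "0 < n"
    and cov: "\<And>i j \<delta>. i < k \<Longrightarrow> j < k \<Longrightarrow> 0 \<le> \<delta> \<Longrightarrow> \<delta> < n \<Longrightarrow> i \<noteq> j \<or> \<delta> \<noteq> 0 \<Longrightarrow>
      \<exists>B\<in>\<B>. \<exists>p\<in>B. \<exists>q\<in>B. fst p = i \<and> fst q = j \<and> (snd p - snd q) mod n = \<delta>"
    and count: "6 * (card \<B> * nat n) + k * nat n \<le> k * nat n * (k * nat n)"
  shows "\<exists>W B. steiner_system2 3 (k * nat n) (W :: (nat \<times> int) set) B"
proof -
  let ?V = "{..<k} \<times> {0..<n}" and ?T = "\<Union>B\<in>\<B>. orbit n B"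
  have cV: "card ?V = k * nat n" by (simp add: card_cartesian_product)
  have "tight_cover 0 ?V (\<lambda>_ _. False) ?T"
    unfolding tight_cover_def
  proof (intro conjI ballI impI)
    show "girth5_graph 0 ?V (\<lambda>_ _. False)" unfolding girth5_graph_def by simp
    show "finite ?T" by (rule card_orbits(1)[OF \<B>(1)])
    show "t \<subseteq> ?V" "card t \<le> 3" if t: "t \<in> ?T" for t
    proof -
      from t obtain B where B: "B \<in> \<B>" "t \<in> orbit n B" by blast
      have "i < k" if "(i, a) \<in> B" for i a using \<B>(2)[OF B(1)] that by force
      then show "t \<subseteq> ?V" "card t \<le> 3" using orbit_props[OF B(2), of k] \<B>(2)[OF B(1)] by blast+
    qed
    show "\<exists>t\<in>?T. p \<in> t \<and> q \<in> t" if pq: "p \<in> ?V" "q \<in> ?V" "far (\<lambda>_ _. False) p q" for p q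
    proof -
      obtain i x j y where e: "p = (i, x)" "q = (j, y)" by (metis surj_pair)
      have r: "i < k" "j < k" "0 \<le> x" "x < n" "0 \<le> y" "y < n" using pq unfolding e by auto
      have "i \<noteq> j \<or> (x - y) mod n \<noteq> 0"
      proof (rule ccontr)
        assume c: "\<not> ?thesis"
        then have "x mod n = y mod n" by (simp add: mod_eq_dvd_iff mod_eq_0_iff_dvd)
        then show False using c r pq(3) unfolding e far_def by simp
      qed
      then have "\<exists>B\<in>\<B>. \<exists>p\<in>B. \<exists>q\<in>B. fst p = i \<and> fst q = j \<and> (snd p - snd q) mod n = (x - y) mod n"
        using n by (intro cov[OF r(1,2)]) auto
      then have "dcov \<B> n i j (x - y)" unfolding dcov_def by (metis prod.collapse)
      then show ?thesis using dcov_orbit[OF _ r(3-6)] unfolding e by blast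
    qed
    have "card ?T \<le> card \<B> * nat n" by (rule card_orbits(2)[OF \<B>(1)])
    then show "6 * card ?T + card ?V * (1 + 0\<^sup>2) \<le> card ?V * card ?V" using count unfolding cV by simp
  qed
  from tight_cover_steiner[OF this] show ?thesis unfolding cV by blast
qed

text \<open>A block \<open>{0, a, a + b}\<close> covers the differences \<open>a\<close>,
  \<open>b\<close>, \<open>a + b\<close> up to sign. The sums 1 + 3 = 4, 2 + 7 = 9 and 5 + 6 = 11,
  where 11 is -8 modulo 19, use each of 1, ..., 9 once.\<close>

lemma steiner_19: "\<exists>W B. steiner_system2 3 19 (W :: (nat \<times> int) set) B"
proof -
  let ?\<B> = "{{(0, 0), (0, 1), (0, 4)}, {(0, 0), (0, 2), (0, 9)}, {(0, 0), (0, 5), (0, 11)}} :: (nat \<times> int) set set"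
  have c: "card ?\<B> \<le> 3" by (simp add: card_insert_if)
  have "\<exists>W B. steiner_system2 3 (1 * nat 19) (W :: (nat \<times> int) set) B"
  proof (rule difference_family_steiner)
    fix i j :: nat and \<delta> :: int
    assume "i < 1" "j < 1" "0 \<le> \<delta>" "\<delta> < 19" "i \<noteq> j \<or> \<delta> \<noteq> 0"
    then have "i = 0" "j = 0" "\<delta> \<in> set [1..18]" by auto
    then show "\<exists>B\<in>?\<B>. \<exists>p\<in>B. \<exists>q\<in>B. fst p = i \<and> fst q = j \<and> (snd p - snd q) mod 19 = \<delta>"
      by (simp add: upto_rec_numeral upto_rec1) (elim disjE; simp)
  qed (use c in \<open>auto simp: card_insert_if\<close>)
  then show ?thesis by simp
qed

text \<open>Bose's construction over three copies of the integers modulo 7: the points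
  \<open>d\<close> and \<open>- d\<close> of one layer are joined to \<open>0\<close> in the next,
  for \<open>d = 1, 2, 3\<close>. The first block supplies the cross difference 0.\<close>

lemma steiner_21: "\<exists>W B. steiner_system2 3 21 (W :: (nat \<times> int) set) B"
proof -
  let ?\<B> = "{{(0, 0), (1, 0), (2, 0)},
    {(0, 1), (0, -1), (1, 0)}, {(0, 2), (0, -2), (1, 0)}, {(0, 3), (0, -3), (1, 0)},
    {(1, 1), (1, -1), (2, 0)}, {(1, 2), (1, -2), (2, 0)}, {(1, 3), (1, -3), (2, 0)},
    {(2, 1), (2, -1), (0, 0)}, {(2, 2), (2, -2), (0, 0)}, {(2, 3), (2, -3), (0, 0)}} :: (nat \<times> int) set set"
  have c: "card ?\<B> \<le> 10" by (intro card_insert_le_m1) simp_all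
  have "\<exists>W B. steiner_system2 3 (3 * nat 7) (W :: (nat \<times> int) set) B"
  proof (rule difference_family_steiner)
    fix i j :: nat and \<delta> :: int
    assume "i < 3" "j < 3" "0 \<le> \<delta>" "\<delta> < 7" "i \<noteq> j \<or> \<delta> \<noteq> 0"
    moreover from this have "i \<in> {0, 1, 2}" "j \<in> {0, 1, 2}" "\<delta> \<in> {0, 1, 2, 3, 4, 5, 6}" by auto
    ultimately show "\<exists>B\<in>?\<B>. \<exists>p\<in>B. \<exists>q\<in>B. fst p = i \<and> fst q = j \<and> (snd p - snd q) mod 7 = \<delta>"
      by (elim insertE emptyE; simp)
  qed (use c in \<open>auto simp: card_insert_if\<close>)
  then show ?thesis by simp
qed

section \<open>Computed difference families\<close>

text \<open>A binary trie over the constructors of \<^typ>\<open>num\<close> lets the simplifier decide that a list of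
  numerals contains \<open>1, \<dots>, k\<close> in time nearly linear in the length of the list.\<close>

datatype trie = Leaf | Node bool trie trie

fun insert_num :: "num \<Rightarrow> trie \<Rightarrow> trie" where
  "insert_num num.One Leaf = Node True Leaf Leaf"
| "insert_num num.One (Node b l r) = Node True l r"
| "insert_num (num.Bit0 k) Leaf = Node False (insert_num k Leaf) Leaf"
| "insert_num (num.Bit0 k) (Node b l r) = Node b (insert_num k l) r"
| "insert_num (num.Bit1 k) Leaf = Node False Leaf (insert_num k Leaf)"
| "insert_num (num.Bit1 k) (Node b l r) = Node b l (insert_num k r)"

fun mem_num :: "num \<Rightarrow> trie \<Rightarrow> bool" where
  "mem_num _ Leaf = False"
| "mem_num num.One (Node b l r) = b"
| "mem_num (num.Bit0 k) (Node b l r) = mem_num k l"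
| "mem_num (num.Bit1 k) (Node b l r) = mem_num k r"

text \<open>The range 1, ..., k is split by parity: halves of the even members go to the left
  subtree, and \<open>i\<close> for every odd member \<open>2 i + 1\<close> to the right one. For an
  upper end \<open>4 k\<close> the odd members stop at \<open>4 k - 1\<close>, so the right bound is
  \<open>2 k - 1 = Num.BitM k\<close>.\<close>

fun full_num :: "num \<Rightarrow> trie \<Rightarrow> bool" where
  "full_num _ Leaf = False"
| "full_num num.One (Node b l r) = b"
| "full_num (num.Bit0 num.One) (Node b l r) = (b \<and> full_num num.One l)"
| "full_num (num.Bit0 (num.Bit0 k)) (Node b l r) = (b \<and> full_num (num.Bit0 k) l \<and> full_num (Num.BitM k) r)"
| "full_num (num.Bit0 (num.Bit1 k)) (Node b l r) = (b \<and> full_num (num.Bit1 k) l \<and> full_num (num.Bit0 k) r)"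
| "full_num (num.Bit1 k) (Node b l r) = (b \<and> full_num k l \<and> full_num k r)"

text \<open>Dropping the entries that are not positive allows the lists to contain all signed
  differences of \<open>D\<close>.\<close>

definition insert_int :: "int \<Rightarrow> trie \<Rightarrow> trie" where
  "insert_int x t = (if 0 < x then insert_num (num_of_nat (nat x)) t else t)"

definition full_int :: "int \<Rightarrow> trie \<Rightarrow> bool" where
  "full_int x = full_num (num_of_nat (nat x))"

definition mem_int :: "int \<Rightarrow> trie \<Rightarrow> bool" where
  "mem_int x = mem_num (num_of_nat (nat x))"

lemma nat_numeral_num_of_nat: "0 < x \<Longrightarrow> x = numeral (num_of_nat (nat x))" for x :: int
  using numeral_num_of_nat[of "nat x"] by (metis int_nat_eq of_nat_numeral order_less_imp_le zero_less_nat_eq)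

lemma mem_int_simps [simp]: "mem_int 1 t = mem_num num.One t" "mem_int (numeral k) t = mem_num k t"
  by (simp_all add: mem_int_def)

lemma insert_int_simps [simp]:
  "insert_int 0 t = t" "insert_int 1 t = insert_num num.One t"
  "insert_int (numeral k) t = insert_num k t" "insert_int (- numeral k) t = t" "insert_int (- 1) t = t"
  by (simp_all add: insert_int_def)

lemma full_int_numeral [simp]: "full_int (numeral k) = full_num k"
  by (simp add: full_int_def)

lemma mem_insert_num: "mem_num j (insert_num k t) \<longleftrightarrow> j = k \<or> mem_num j t"
  by (induction k t arbitrary: j rule: insert_num.induct; case_tac j; simp)

lemma full_num_mem: "full_num k t \<Longrightarrow> j \<le> k \<Longrightarrow> mem_num j t"
proof (induction k t arbitrary: j rule: full_num.induct)
  case (3 b l r)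
  then show ?case by (cases j) auto
next
  case (4 k b l r)
  have i: "i \<le> Num.BitM k" if "num.Bit1 i \<le> num.Bit0 (num.Bit0 k)" for i
  proof -
    have "(numeral (num.Bit1 i) :: int) \<le> numeral (num.Bit0 (num.Bit0 k))" using that by (simp only: numeral_le_iff)
    then have "(numeral i :: int) \<le> numeral (Num.BitM k)"
      unfolding numeral_BitM numeral_Bit0 numeral_Bit1 by linarith
    then show ?thesis by (simp only: numeral_le_iff)
  qed
  show ?case
  proof (cases j)
    case (Bit1 i)
    then show ?thesis using 4 i[of i] by simp
  qed (use 4 in auto)
next
  case (5 k b l r)
  then show ?case by (cases j) (auto simp: less_eq_num_def)
qed (case_tac j; simp)+

lemma mem_fold_insert: "mem_num k (fold insert_int xs t) \<longleftrightarrow> mem_num k t \<or> numeral k \<in> set xs"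
proof (induction xs arbitrary: t)
  case (Cons x xs)
  have "mem_num k (insert_int x t) \<longleftrightarrow> x = numeral k \<or> mem_num k t"
  proof (cases "0 < x")
    case True
    then obtain j where "x = numeral j" using nat_numeral_num_of_nat by blast
    then show ?thesis by (auto simp: mem_insert_num)
  qed (auto simp: insert_int_def)
  then show ?case using Cons by auto
qed simp

lemma full_int_mem:
  assumes "full_int k (fold insert_int xs Leaf)" "1 \<le> x" "x \<le> k"
  shows "x \<in> set xs"
proof -
  have "numeral (num_of_nat (nat x)) \<le> (numeral (num_of_nat (nat k)) :: int)"
    using nat_numeral_num_of_nat[of x] nat_numeral_num_of_nat[of k] assms(2,3) by linarith
  then have "num_of_nat (nat x) \<le> num_of_nat (nat k)" by (simp only: numeral_le_iff)
  then have "mem_num (num_of_nat (nat x)) (fold insert_int xs Leaf)"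
    using full_num_mem assms(1) unfolding full_int_def by blast
  then show ?thesis using nat_numeral_num_of_nat[of x] assms(2) by (simp add: mem_fold_insert)
qed

definition cross_list where
  "cross_list m D X = D @ concat (map (\<lambda>(e :: int, a). [a, (a + e) mod m]) X)"

text \<open>The third side of a triple \<open>{0, a, a + b}\<close> may be represented by
  \<open>a + b\<close> or by its negative modulo \<open>m\<close>. Both are listed, since only the
  range up to \<open>h\<close> is tested.\<close>

definition pure_list where
  "pure_list m D X Y b = concat (map (\<lambda>a. map ((-) a) D) D) @ map fst X @
     concat (map (\<lambda>(a, b). [a, b, a + b, m - (a + b)]) Y) @ (if b then [m div 3 :: int] else [])"

fun fresh :: "int list \<Rightarrow> trie \<Rightarrow> bool" where
  "fresh [] t = True"
| "fresh (x # xs) t = (\<not> mem_int x t \<and> fresh xs (insert_int x t))"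

lemma mem_int_insert: "0 < x \<Longrightarrow> 0 < y \<Longrightarrow> mem_int x (insert_int y t) \<longleftrightarrow> x = y \<or> mem_int x t"
  unfolding mem_int_def insert_int_def
  by (auto simp: mem_insert_num) (metis nat_numeral_num_of_nat)

text \<open>Distinctness in one pass: every entry is looked up before it is inserted. This decides
  the Golomb property on the list of positive differences.\<close>

lemma fresh_distinct:
  "fresh xs t \<Longrightarrow> (\<forall>x\<in>set xs. 0 < x) \<Longrightarrow> distinct xs \<and> (\<forall>x\<in>set xs. \<not> mem_int x t)"
proof (induction xs arbitrary: t)
  case (Cons x xs)
  then have "distinct xs \<and> (\<forall>y\<in>set xs. \<not> mem_int y (insert_int x t))" by auto
  then have "distinct xs" "\<forall>y\<in>set xs. y \<noteq> x \<and> \<not> mem_int y t" using Cons.prems(2) mem_int_insert by auto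
  then show ?case using Cons.prems(1) by auto
qed simp

lemma golomb_list:
  assumes fresh: "fresh (map (\<lambda>(a, b). a - b) (filter (\<lambda>(a, b). b < a) (List.product D D))) Leaf" and "set D \<subseteq> {0..M}"
  shows "golomb (set D) M"
proof -
  have "inj_on (\<lambda>(a, b). a - b) (set (filter (\<lambda>(a, b). b < a) (List.product D D)))"
    using fresh_distinct[OF fresh] by (auto simp: distinct_map)
  then have inj: "inj_on (\<lambda>(a, b). a - b) {(a, b). a \<in> set D \<and> b \<in> set D \<and> b < a}"
    by (rule inj_on_subset) auto
  have "a = c" if "a \<in> set D" "b \<in> set D" "c \<in> set D" "d \<in> set D" "b < a" "a - b = c - d" for a b c d
    using inj_onD[OF inj, of "(a, b)" "(c, d)"] that by auto
  then show ?thesis unfolding golomb_def using assms(2) by blast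
qed

text \<open>Three executable tests remain: one for the cross differences and one for each layer. All
  of them test only that values occur; that nothing occurs twice follows from the count.\<close>

lemma two_layer_check:
  fixes D :: "int list" and S :: "nat set"
  assumes D: "golomb (set D) M" "distinct D" "0 \<le> M" "2 * M < m" "0 \<in> set D"
    and m: "m = 2 * h + 1" and S: "S \<subseteq> {0, 1}" "S \<noteq> {} \<Longrightarrow> 3 dvd m"
    and cross: "full_int (m - 1) (fold insert_int (cross_list m D (X0 @ X1)) Leaf)"
    and pure0: "full_int h (fold insert_int (pure_list m D X0 Y0 (0 \<in> S)) Leaf)"
    and pure1: "full_int h (fold insert_int (pure_list m D X1 Y1 (1 \<in> S)) Leaf)"
    and count: "6 * (length X0 + length X1 + length Y0 + length Y1) * nat m +
      2 * card S * nat m + 2 * nat m * (1 + (length D)\<^sup>2) \<le> 2 * nat m * (2 * nat m)"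
  shows "\<exists>T. tight_cover (length D) (layers 1 m) (layered (set D) 1 m) T"
proof (rule two_layer_cover[where X = "\<lambda>l. if l = 0 then X0 else X1" and Y = "\<lambda>l. if l = 0 then Y0 else Y1" and M = M and h = h and S = S])
  show "\<delta> \<in> set D \<or> (\<exists>l<2 :: nat. \<exists>(e, a)\<in>set (if l = 0 then X0 else X1). \<delta> = a \<or> \<delta> = (a + e) mod m)"
    if "1 \<le> \<delta>" "\<delta> < m" for \<delta>
  proof -
    have "\<delta> \<in> set (cross_list m D (X0 @ X1))" using full_int_mem[OF cross] that by simp
    then consider "\<delta> \<in> set D" | e a where "(e, a) \<in> set X0 \<or> (e, a) \<in> set X1" "\<delta> = a \<or> \<delta> = (a + e) mod m"
      unfolding cross_list_def by auto
    then show ?thesis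
    proof cases
      case 2
      have "\<exists>l<2 :: nat. (e, a) \<in> set (if l = 0 then X0 else X1)"
        using 2(1)
      proof
        assume "(e, a) \<in> set X0" then show ?thesis by (intro exI[of _ "0 :: nat"]) simp
      next
        assume "(e, a) \<in> set X1" then show ?thesis by (intro exI[of _ "1 :: nat"]) simp
      qed
      then show ?thesis using 2(2) by blast
    qed blast
  qed
  show "(\<exists>a\<in>set D. \<exists>b\<in>set D. e = a - b) \<or> e \<in> fst ` set (if l = 0 then X0 else X1) \<or>
      (\<exists>(a, b)\<in>set (if l = 0 then Y0 else Y1). e = a \<or> e = b \<or> e = a + b \<or> e = m - (a + b)) \<or> l \<in> S \<and> 3 * e = m"
    if l: "l < 2" and e: "1 \<le> e" "e \<le> h" for l e
  proof -
    have *: "(\<exists>a\<in>set D. \<exists>b\<in>set D. e = a - b) \<or> e \<in> fst ` set X \<or>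
      (\<exists>(a, b)\<in>set Y. e = a \<or> e = b \<or> e = a + b \<or> e = m - (a + b)) \<or> l \<in> S \<and> 3 * e = m"
      if "e \<in> set (pure_list m D X Y (l \<in> S))" for X Y l
    proof -
      have "3 * (m div 3) = m" if "l \<in> S"
        using S(2) that by (metis dvd_mult_div_cancel emptyE)
      with that show ?thesis unfolding pure_list_def by (auto split: if_splits)
    qed
    show ?thesis
      using *[OF full_int_mem[OF pure0 e]] *[OF full_int_mem[OF pure1 e]] l by (cases "l = 0") (simp_all add: less_2_cases_iff)
  qed
qed (use D m S count in \<open>simp_all add: distinct_card\<close>)

text \<open>An optimal 19-mark Golomb ruler, of length 246. Its differences include 233 - 231 = 2,
  246 - 242 = 4, 6 - 0 = 6 and 130 - 120 = 10, on which the six-layer construction relies.\<close>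

definition ruler_19 :: "int list" where
  "ruler_19 = [0, 1, 6, 25, 32, 72, 100, 108, 120, 130, 153, 169, 187, 190, 204, 231, 233, 242, 246]"

lemma golomb_ruler_19: "golomb (set ruler_19) 246"
  by (rule golomb_list) (simp_all add: ruler_19_def)

text \<open>An optimal 21-mark Golomb ruler, of length 333. Here 2 - 0 = 2, 333 - 329 = 4, 83 - 77 =
  6 and 265 - 255 = 10 are the small differences used later.\<close>

definition ruler_21 :: "int list" where
  "ruler_21 = [0, 2, 24, 56, 77, 82, 83, 95, 129, 144, 179, 186, 195, 255, 265, 285, 293, 296, 310, 329, 333]"

lemma golomb_ruler_21: "golomb (set ruler_21) 333"
  by (rule golomb_list) (simp_all add: ruler_21_def)

text \<open>A pair takes one difference of its layer and two cross differences, a triple takes three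
  differences of its layer. The 843 - 19 = 824 cross differences outside \<open>D\<close> therefore
  mean 412 pairs in both lists together. The 15 and 14 triples take what is left in the layers
  beside the 171 differences of \<open>D\<close> and the short difference 281.\<close>

definition pairs_843a :: "(int \<times> int) list" where
  "pairs_843a =
    [(50, 748), (54, 60), (65, 63), (85, 267), (86, 229), (91, 705), (92, 240), (109, 602), (110, 279),
     (117, 54), (127, 431), (135, 185), (139, 360), (140, 73), (141, 372), (143, 45), (145, 365), (148, 132),
     (149, 326), (150, 14), (156, 424), (157, 415), (164, 466), (166, 394), (171, 76), (173, 39), (175, 615),
     (177, 454), (178, 353), (180, 668), (183, 110), (185, 225), (188, 82), (191, 815), (192, 462), (193, 24),
     (194, 747), (195, 663), (196, 706), (197, 272), (200, 720), (202, 442), (205, 68), (209, 685),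
     (211, 777), (212, 814), (213, 53), (215, 824), (216, 694), (219, 3), (220, 661), (222, 189), (223, 708),
     (224, 417), (226, 193), (229, 689), (235, 99), (237, 34), (238, 671), (244, 751), (247, 58), (248, 119),
     (249, 380), (250, 715), (251, 395), (252, 486), (253, 769), (254, 669), (255, 43), (257, 733),
     (258, 655), (260, 170), (261, 684), (264, 143), (265, 180), (266, 632), (267, 69), (268, 158),
     (269, 586), (270, 131), (271, 226), (272, 563), (274, 87), (275, 665), (276, 420), (277, 31), (278, 203),
     (279, 52), (280, 707), (282, 277), (283, 780), (284, 168), (285, 291), (286, 638), (287, 635),
     (289, 679), (290, 7), (292, 74), (293, 123), (294, 542), (297, 723), (298, 89), (299, 227), (301, 134),
     (302, 41), (304, 257), (306, 116), (308, 30), (309, 725), (310, 214), (312, 691), (313, 782), (314, 650),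
     (315, 284), (316, 591), (317, 268), (319, 210), (320, 269), (321, 197), (322, 613), (323, 695),
     (324, 721), (325, 241), (326, 4), (327, 35), (328, 21), (330, 766), (331, 27), (332, 557), (333, 621),
     (334, 457), (335, 771), (336, 282), (338, 44), (339, 348), (340, 201), (342, 709), (343, 112), (344, 95),
     (345, 84), (346, 515), (347, 553), (348, 376), (350, 381), (351, 605), (352, 2), (353, 812), (354, 262),
     (355, 743), (356, 206), (357, 127), (358, 633), (360, 234), (361, 325), (363, 493), (364, 507),
     (365, 619), (367, 409), (368, 749), (369, 809), (371, 219), (372, 626), (373, 65), (374, 713),
     (375, 530), (376, 306), (377, 230), (379, 221), (380, 139), (381, 511), (382, 611), (383, 627),
     (384, 294), (385, 345), (387, 472), (388, 156), (389, 592), (390, 194), (391, 50), (393, 458),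
     (394, 341), (396, 303), (397, 106), (399, 535), (400, 578), (401, 258), (402, 463), (403, 768),
     (404, 19), (405, 674), (406, 522), (407, 83), (408, 734), (409, 392), (410, 94), (411, 474), (412, 487),
     (413, 523), (414, 154), (415, 278), (416, 96), (417, 829), (419, 741), (420, 432)]"

definition triples_843a :: "(int \<times> int) list" where
  "triples_843a =
    [(176, 318), (228, 167), (291, 296), (154, 303), (288, 337), (295, 243), (160, 421), (63, 418),
     (378, 106), (392, 300), (234, 370), (311, 259), (341, 366), (263, 182), (329, 307)]"

definition pairs_843b :: "(int \<times> int) list" where
  "pairs_843b =
    [(54, 309), (65, 71), (85, 467), (86, 570), (110, 477), (117, 680), (127, 556), (135, 673), (136, 23),
     (139, 537), (141, 700), (143, 549), (145, 369), (148, 421), (149, 428), (150, 473), (151, 550),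
     (154, 470), (156, 464), (157, 418), (160, 604), (164, 483), (166, 666), (167, 157), (173, 436),
     (176, 275), (177, 597), (178, 489), (180, 546), (182, 36), (183, 775), (185, 596), (188, 440),
     (191, 636), (192, 527), (193, 178), (194, 129), (195, 567), (196, 386), (200, 104), (202, 446),
     (205, 301), (207, 243), (209, 109), (211, 818), (215, 383), (216, 767), (218, 651), (219, 800),
     (222, 311), (226, 377), (234, 313), (235, 105), (238, 498), (239, 737), (243, 228), (244, 772),
     (247, 103), (248, 571), (249, 465), (250, 494), (251, 402), (253, 795), (254, 496), (255, 333),
     (256, 634), (257, 548), (258, 399), (259, 378), (260, 765), (261, 555), (262, 396), (263, 840),
     (264, 525), (265, 770), (266, 78), (267, 314), (268, 357), (269, 223), (270, 482), (271, 517),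
     (273, 215), (274, 565), (275, 276), (276, 427), (277, 822), (278, 254), (279, 327), (280, 181),
     (281, 224), (282, 390), (283, 449), (284, 413), (285, 405), (286, 821), (287, 756), (288, 794),
     (289, 753), (292, 142), (293, 286), (295, 710), (296, 195), (298, 238), (300, 727), (301, 292),
     (302, 476), (303, 237), (304, 356), (305, 745), (306, 316), (307, 146), (308, 287), (309, 528),
     (310, 521), (311, 209), (312, 516), (313, 295), (314, 404), (315, 397), (316, 400), (317, 385),
     (318, 11), (319, 398), (320, 825), (322, 290), (323, 211), (324, 460), (325, 799), (326, 459),
     (327, 564), (329, 554), (331, 545), (332, 601), (333, 742), (335, 485), (337, 543), (338, 670),
     (339, 468), (340, 803), (341, 10), (343, 166), (344, 617), (345, 817), (346, 149), (347, 86), (348, 478),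
     (349, 339), (350, 456), (351, 289), (352, 779), (353, 406), (354, 479), (355, 830), (356, 373),
     (357, 151), (359, 414), (360, 444), (361, 337), (362, 501), (363, 792), (364, 391), (365, 249),
     (366, 172), (368, 443), (370, 610), (371, 722), (372, 388), (373, 838), (374, 412), (375, 408),
     (376, 447), (377, 265), (378, 639), (380, 746), (381, 296), (382, 379), (383, 374), (385, 813),
     (386, 583), (387, 61), (388, 375), (390, 364), (392, 480), (393, 574), (395, 107), (396, 793),
     (397, 307), (398, 643), (399, 101), (400, 728), (401, 261), (402, 834), (403, 810), (404, 245),
     (405, 259), (407, 652), (410, 235), (411, 347), (412, 161), (413, 681), (414, 739), (415, 787),
     (416, 675), (417, 425), (418, 384), (419, 321), (420, 17), (421, 539)]"

definition triples_843b :: "(int \<times> int) list" where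
  "triples_843b =
    [(367, 140), (299, 369), (379, 212), (92, 409), (50, 358), (223, 330), (91, 106), (224, 291), (321, 228),
     (237, 272), (229, 394), (109, 297), (171, 213), (391, 389)]"

lemma cross_843: "full_int (843 - 1) (fold insert_int (cross_list 843 ruler_19 (pairs_843a @ pairs_843b)) Leaf)"
  by (simp add: cross_list_def ruler_19_def pairs_843a_def pairs_843b_def)

lemma pure_843a: "full_int 421 (fold insert_int (pure_list 843 ruler_19 pairs_843a triples_843a True) Leaf)"
  by (simp add: pure_list_def ruler_19_def pairs_843a_def triples_843a_def)

lemma pure_843b: "full_int 421 (fold insert_int (pure_list 843 ruler_19 pairs_843b triples_843b False) Leaf)"
  by (simp add: pure_list_def ruler_19_def pairs_843b_def triples_843b_def)

text \<open>The tight count reads \<open>2 m - 1 - w^2 = 3 b + card S\<close> with \<open>b\<close>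
  base blocks. Here 1324 = 3 * 441 + 1, so exactly one layer carries the short orbit.\<close>

lemma two_layers_843: "\<exists>T. tight_cover 19 (layers 1 843) (layered (set ruler_19) 1 843) T"
proof -
  have len: "length ruler_19 = 19" "distinct ruler_19" "0 \<in> set ruler_19" by (simp_all add: ruler_19_def)
  have "\<exists>T. tight_cover (length ruler_19) (layers 1 843) (layered (set ruler_19) 1 843) T"
    by (rule two_layer_check[OF golomb_ruler_19, of 843 421 "{0}" pairs_843a pairs_843b triples_843a triples_843b])
      (use cross_843 pure_843a pure_843b len in
        \<open>simp_all add: pairs_843a_def pairs_843b_def triples_843a_def triples_843b_def\<close>)
  then show ?thesis unfolding len .
qed

definition pairs_841a :: "(int \<times> int) list" where
  "pairs_841a =
    [(50, 560), (54, 441), (63, 484), (65, 185), (85, 581), (86, 835), (91, 300), (106, 52), (109, 792),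
     (110, 497), (117, 810), (127, 468), (135, 709), (139, 49), (140, 796), (141, 74), (145, 819), (148, 248),
     (149, 501), (150, 823), (154, 219), (156, 149), (157, 152), (164, 696), (166, 56), (167, 449),
     (171, 380), (173, 670), (176, 609), (177, 209), (178, 212), (182, 753), (185, 387), (188, 681),
     (191, 680), (192, 202), (193, 665), (195, 395), (196, 816), (200, 361), (207, 641), (209, 102),
     (211, 727), (213, 14), (216, 275), (219, 346), (220, 27), (222, 12), (223, 838), (224, 186), (226, 569),
     (228, 23), (229, 84), (235, 55), (237, 718), (238, 44), (239, 708), (243, 509), (247, 255), (249, 54),
     (250, 342), (252, 116), (253, 340), (254, 672), (255, 602), (256, 118), (257, 170), (258, 651),
     (260, 142), (261, 620), (262, 62), (263, 223), (264, 344), (265, 329), (266, 674), (269, 576),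
     (270, 630), (271, 82), (272, 734), (273, 702), (275, 29), (276, 570), (279, 512), (280, 65), (282, 567),
     (283, 285), (284, 444), (286, 646), (288, 662), (289, 76), (290, 46), (292, 457), (295, 658), (296, 194),
     (297, 751), (298, 21), (299, 160), (300, 584), (301, 492), (302, 600), (303, 164), (304, 601),
     (305, 691), (306, 163), (307, 818), (308, 542), (309, 113), (310, 66), (311, 522), (312, 71), (313, 228),
     (314, 42), (315, 408), (316, 359), (317, 193), (318, 790), (319, 556), (320, 146), (321, 144),
     (323, 388), (324, 10), (325, 312), (326, 415), (328, 221), (329, 147), (330, 90), (331, 287), (333, 92),
     (334, 70), (335, 210), (336, 177), (337, 748), (339, 11), (340, 131), (341, 776), (342, 550), (343, 110),
     (344, 722), (346, 192), (347, 199), (348, 15), (349, 280), (350, 619), (351, 253), (352, 627),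
     (353, 535), (355, 787), (356, 660), (357, 122), (358, 612), (359, 678), (360, 409), (361, 500),
     (362, 266), (363, 526), (364, 588), (365, 274), (367, 636), (368, 264), (369, 505), (370, 41),
     (371, 133), (372, 725), (373, 537), (374, 157), (375, 249), (376, 145), (377, 667), (378, 508),
     (379, 18), (380, 53), (381, 649), (382, 135), (383, 77), (384, 808), (386, 176), (387, 297), (390, 36),
     (391, 26), (392, 599), (393, 50), (394, 571), (395, 119), (397, 96), (398, 617), (399, 582), (400, 178),
     (401, 115), (403, 104), (404, 151), (405, 573), (406, 721), (407, 472), (408, 506), (409, 463),
     (410, 694), (411, 698), (412, 35), (414, 226), (415, 121), (416, 482), (418, 621), (419, 278),
     (420, 445)]"

definition triples_841a :: "(int \<times> int) list" where
  "triples_841a =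
    [(136, 151), (388, 194), (332, 215), (327, 354), (345, 278), (244, 417), (92, 274), (281, 293),
     (205, 234), (202, 183), (338, 212), (197, 396), (251, 322), (413, 285), (277, 389)]"

definition pairs_841b :: "(int \<times> int) list" where
  "pairs_841b =
    [(50, 642), (54, 579), (63, 623), (65, 735), (85, 603), (86, 647), (92, 385), (106, 126), (117, 403),
     (127, 707), (135, 544), (136, 407), (140, 498), (141, 473), (143, 664), (145, 283), (148, 400),
     (150, 413), (151, 22), (154, 523), (156, 279), (157, 528), (160, 527), (164, 214), (166, 272),
     (167, 598), (171, 635), (173, 289), (175, 357), (176, 653), (177, 389), (178, 419), (180, 384),
     (182, 764), (183, 557), (185, 558), (188, 809), (192, 259), (193, 731), (194, 828), (196, 524),
     (197, 434), (200, 529), (205, 401), (207, 58), (209, 757), (211, 830), (212, 236), (213, 239),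
     (215, 240), (216, 585), (218, 559), (219, 519), (220, 161), (222, 101), (223, 316), (228, 79),
     (229, 825), (234, 197), (235, 254), (237, 464), (238, 832), (239, 143), (244, 89), (247, 424),
     (248, 583), (249, 659), (252, 339), (253, 530), (254, 139), (256, 744), (257, 499), (261, 661),
     (262, 98), (263, 487), (265, 575), (266, 288), (267, 320), (268, 318), (269, 37), (270, 172), (271, 166),
     (272, 354), (274, 481), (275, 839), (276, 483), (278, 754), (281, 648), (282, 39), (283, 416),
     (284, 478), (285, 503), (286, 154), (288, 405), (289, 167), (290, 243), (291, 262), (292, 511),
     (293, 168), (294, 622), (295, 141), (296, 761), (297, 779), (298, 358), (299, 369), (300, 180),
     (302, 343), (303, 302), (305, 364), (306, 271), (307, 475), (308, 778), (309, 518), (310, 715),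
     (312, 331), (314, 63), (317, 496), (319, 625), (320, 375), (322, 148), (324, 758), (325, 412),
     (328, 812), (329, 488), (332, 770), (333, 439), (334, 218), (335, 820), (336, 706), (337, 252),
     (338, 596), (339, 107), (340, 811), (341, 341), (342, 183), (343, 270), (344, 308), (345, 372),
     (346, 821), (347, 700), (348, 398), (349, 367), (350, 474), (351, 747), (352, 485), (353, 712),
     (354, 574), (355, 418), (356, 690), (357, 714), (358, 423), (359, 296), (360, 454), (361, 179),
     (362, 406), (365, 432), (366, 657), (367, 322), (368, 295), (369, 430), (370, 414), (371, 730),
     (372, 347), (373, 337), (374, 704), (375, 798), (376, 450), (377, 238), (378, 580), (379, 136),
     (380, 742), (381, 399), (382, 794), (383, 349), (384, 379), (385, 298), (386, 338), (387, 771),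
     (388, 745), (389, 804), (390, 315), (392, 644), (393, 429), (394, 421), (395, 774), (396, 458),
     (397, 836), (398, 654), (399, 736), (400, 766), (402, 805), (403, 208), (404, 269), (405, 713),
     (406, 726), (407, 127), (409, 802), (410, 293), (411, 760), (412, 327), (414, 789), (415, 371),
     (416, 78), (417, 217), (418, 258), (419, 348), (420, 355)]"

definition triples_841b :: "(int \<times> int) list" where
  "triples_841b =
    [(149, 264), (251, 226), (331, 109), (191, 287), (273, 318), (110, 408), (301, 260), (195, 330),
     (224, 91), (321, 277), (279, 304), (391, 311), (255, 327), (313, 326)]"

lemma cross_841: "full_int (841 - 1) (fold insert_int (cross_list 841 ruler_19 (pairs_841a @ pairs_841b)) Leaf)"
  by (simp add: cross_list_def ruler_19_def pairs_841a_def pairs_841b_def)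

lemma pure_841a: "full_int 420 (fold insert_int (pure_list 841 ruler_19 pairs_841a triples_841a False) Leaf)"
  by (simp add: pure_list_def ruler_19_def pairs_841a_def triples_841a_def)

lemma pure_841b: "full_int 420 (fold insert_int (pure_list 841 ruler_19 pairs_841b triples_841b False) Leaf)"
  by (simp add: pure_list_def ruler_19_def pairs_841b_def triples_841b_def)

lemma two_layers_841: "\<exists>T. tight_cover 19 (layers 1 841) (layered (set ruler_19) 1 841) T"
proof -
  have len: "length ruler_19 = 19" "distinct ruler_19" "0 \<in> set ruler_19" by (simp_all add: ruler_19_def)
  have "\<exists>T. tight_cover (length ruler_19) (layers 1 841) (layered (set ruler_19) 1 841) T"
    by (rule two_layer_check[OF golomb_ruler_19, of 841 420 "{}" pairs_841a pairs_841b triples_841a triples_841b])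
      (use cross_841 pure_841a pure_841b len in
        \<open>simp_all add: pairs_841a_def pairs_841b_def triples_841a_def triples_841b_def\<close>)
  then show ?thesis unfolding len .
qed

definition pairs_1037a :: "(int \<times> int) list" where
  "pairs_1037a =
    [(29, 649), (43, 274), (63, 50), (72, 204), (85, 331), (89, 769), (92, 46), (94, 384), (108, 988),
     (119, 294), (122, 944), (125, 369), (132, 619), (133, 156), (135, 766), (145, 107), (146, 569),
     (151, 388), (153, 767), (157, 899), (158, 241), (161, 75), (163, 923), (168, 853), (169, 158),
     (174, 512), (175, 89), (180, 287), (187, 176), (191, 151), (192, 883), (194, 919), (196, 149),
     (197, 141), (205, 352), (207, 84), (212, 263), (218, 60), (220, 190), (221, 667), (224, 836), (225, 431),
     (226, 6), (230, 1), (232, 124), (235, 538), (236, 833), (242, 1006), (244, 96), (245, 473), (249, 882),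
     (257, 859), (258, 180), (259, 210), (260, 976), (262, 104), (266, 281), (267, 987), (268, 772),
     (270, 965), (271, 616), (275, 4), (276, 39), (278, 879), (279, 130), (284, 233), (287, 937), (288, 779),
     (289, 13), (290, 167), (292, 509), (295, 421), (297, 251), (298, 804), (299, 809), (301, 280),
     (302, 505), (303, 949), (306, 414), (307, 16), (311, 150), (312, 760), (313, 529), (314, 235),
     (315, 733), (316, 314), (317, 748), (318, 123), (319, 633), (320, 250), (321, 730), (322, 54),
     (323, 184), (325, 812), (326, 958), (328, 863), (332, 796), (334, 372), (336, 44), (337, 523),
     (338, 955), (339, 42), (340, 996), (341, 33), (342, 615), (343, 105), (344, 397), (345, 989), (347, 695),
     (348, 815), (349, 152), (350, 909), (352, 694), (355, 239), (356, 771), (357, 825), (358, 10),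
     (359, 726), (360, 483), (361, 170), (362, 915), (364, 290), (365, 125), (366, 178), (367, 173),
     (368, 111), (369, 208), (371, 78), (372, 482), (373, 157), (374, 361), (375, 734), (377, 795), (378, 87),
     (379, 865), (380, 823), (381, 36), (382, 702), (383, 454), (384, 924), (386, 782), (387, 127), (388, 55),
     (389, 885), (390, 205), (391, 763), (392, 106), (393, 905), (394, 674), (395, 739), (396, 197),
     (398, 603), (399, 249), (400, 942), (401, 132), (402, 781), (403, 308), (404, 292), (406, 651),
     (407, 246), (408, 334), (409, 762), (410, 746), (411, 852), (412, 445), (413, 736), (414, 871),
     (416, 802), (418, 846), (419, 728), (420, 789), (421, 818), (422, 391), (424, 998), (425, 665),
     (427, 101), (428, 921), (430, 34), (431, 775), (432, 727), (433, 672), (434, 640), (435, 642),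
     (436, 118), (437, 662), (438, 330), (439, 573), (440, 164), (441, 1016), (442, 537), (443, 661),
     (444, 657), (445, 1017), (446, 348), (447, 258), (448, 764), (450, 220), (451, 160), (452, 183),
     (454, 57), (455, 128), (456, 400), (457, 646), (458, 444), (460, 253), (461, 7), (462, 143), (464, 590),
     (465, 881), (466, 424), (467, 25), (468, 440), (469, 576), (470, 214), (471, 18), (472, 73), (473, 994),
     (474, 148), (475, 254), (476, 15), (477, 641), (478, 203), (479, 777), (480, 364), (481, 719),
     (482, 298), (483, 599), (484, 171), (486, 962), (487, 337), (488, 460), (490, 168), (492, 245),
     (493, 26), (494, 41), (495, 69), (496, 688), (499, 525), (500, 676), (502, 638), (503, 182), (504, 584),
     (505, 74), (506, 234), (507, 945), (508, 174), (509, 244), (511, 52), (512, 680), (513, 536), (514, 335),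
     (515, 419), (516, 717), (517, 286)]"

definition triples_1037a :: "(int \<times> int) list" where
  "triples_1037a =
    [(489, 248), (87, 453), (417, 274), (485, 415), (281, 148), (423, 449), (223, 140), (330, 354),
     (426, 405), (128, 370), (518, 239), (376, 264), (491, 222), (116, 385), (510, 351), (65, 217),
     (335, 459), (304, 159)]"

definition pairs_1037b :: "(int \<times> int) list" where
  "pairs_1037b =
    [(29, 806), (43, 930), (63, 756), (65, 559), (72, 797), (85, 386), (87, 977), (92, 114), (94, 606),
     (108, 912), (116, 754), (119, 556), (122, 800), (125, 383), (128, 867), (133, 510), (137, 542),
     (145, 521), (146, 750), (148, 691), (151, 884), (157, 393), (158, 346), (159, 980), (161, 325),
     (163, 850), (165, 212), (174, 534), (175, 723), (180, 459), (187, 328), (192, 259), (194, 319),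
     (196, 592), (197, 698), (206, 732), (207, 567), (212, 275), (217, 597), (218, 189), (220, 628),
     (221, 692), (222, 61), (223, 480), (224, 350), (225, 805), (226, 92), (230, 401), (232, 405), (235, 668),
     (236, 864), (239, 370), (242, 344), (243, 959), (245, 546), (248, 379), (249, 153), (258, 532),
     (259, 355), (260, 447), (262, 669), (266, 626), (268, 86), (274, 543), (275, 426), (276, 749),
     (278, 1002), (279, 983), (280, 845), (281, 687), (284, 652), (287, 974), (288, 886), (289, 572),
     (292, 602), (298, 136), (299, 311), (300, 452), (301, 343), (303, 623), (304, 389), (306, 601),
     (307, 485), (311, 939), (312, 810), (313, 591), (314, 320), (315, 429), (317, 115), (318, 466),
     (319, 690), (320, 650), (321, 455), (322, 553), (323, 497), (324, 288), (325, 928), (326, 571),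
     (332, 972), (335, 22), (336, 620), (338, 502), (339, 229), (340, 1018), (341, 442), (344, 585),
     (345, 493), (346, 58), (347, 365), (348, 140), (349, 561), (350, 636), (351, 946), (352, 295),
     (353, 378), (354, 704), (355, 664), (356, 872), (357, 477), (358, 722), (359, 193), (361, 353),
     (362, 578), (364, 629), (365, 632), (367, 499), (368, 116), (369, 520), (370, 991), (371, 808),
     (372, 659), (376, 500), (377, 439), (378, 387), (381, 470), (382, 847), (383, 588), (384, 1011),
     (385, 761), (386, 964), (387, 322), (388, 257), (389, 589), (390, 396), (391, 230), (393, 582),
     (394, 133), (395, 566), (396, 911), (399, 456), (401, 516), (402, 336), (403, 551), (404, 565),
     (405, 618), (406, 832), (408, 600), (409, 900), (411, 927), (412, 598), (413, 194), (414, 341),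
     (415, 617), (416, 209), (418, 587), (419, 422), (420, 373), (421, 268), (422, 503), (423, 963),
     (424, 1036), (425, 453), (426, 506), (427, 828), (428, 941), (430, 677), (431, 177), (432, 367),
     (433, 518), (434, 683), (435, 394), (437, 873), (440, 1000), (441, 558), (442, 562), (443, 560),
     (444, 877), (445, 1027), (447, 300), (448, 339), (449, 382), (450, 371), (451, 307), (453, 306),
     (454, 159), (455, 770), (456, 412), (457, 906), (458, 524), (459, 671), (460, 351), (461, 1034),
     (462, 981), (463, 472), (464, 427), (465, 990), (466, 450), (467, 359), (468, 1015), (469, 830),
     (470, 522), (471, 228), (472, 108), (473, 1026), (474, 953), (475, 282), (476, 398), (477, 98),
     (478, 555), (479, 266), (481, 304), (482, 316), (483, 242), (484, 476), (485, 673), (486, 1014),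
     (487, 541), (489, 221), (490, 984), (491, 893), (492, 822), (493, 474), (494, 918), (495, 950),
     (496, 933), (497, 99), (498, 162), (500, 362), (501, 223), (502, 161), (503, 526), (504, 481),
     (505, 238), (507, 966), (509, 269), (510, 1022), (511, 496), (512, 185), (513, 827), (514, 433),
     (515, 428), (516, 721), (517, 880), (518, 914)]"

definition triples_1037b :: "(int \<times> int) list" where
  "triples_1037b =
    [(508, 169), (328, 302), (330, 271), (89, 168), (374, 132), (264, 410), (267, 480), (452, 380),
     (342, 400), (297, 397), (334, 366), (176, 488), (417, 191), (153, 438), (140, 398), (244, 135),
     (392, 375), (439, 282)]"

lemma cross_1037: "full_int (1037 - 1) (fold insert_int (cross_list 1037 ruler_21 (pairs_1037a @ pairs_1037b)) Leaf)"
  by (simp add: cross_list_def ruler_21_def pairs_1037a_def pairs_1037b_def)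

lemma pure_1037a: "full_int 518 (fold insert_int (pure_list 1037 ruler_21 pairs_1037a triples_1037a False) Leaf)"
  by (simp add: pure_list_def ruler_21_def pairs_1037a_def triples_1037a_def)

lemma pure_1037b: "full_int 518 (fold insert_int (pure_list 1037 ruler_21 pairs_1037b triples_1037b False) Leaf)"
  by (simp add: pure_list_def ruler_21_def pairs_1037b_def triples_1037b_def)

lemma two_layers_1037: "\<exists>T. tight_cover 21 (layers 1 1037) (layered (set ruler_21) 1 1037) T"
proof -
  have len: "length ruler_21 = 21" "distinct ruler_21" "0 \<in> set ruler_21" by (simp_all add: ruler_21_def)
  have "\<exists>T. tight_cover (length ruler_21) (layers 1 1037) (layered (set ruler_21) 1 1037) T"
    by (rule two_layer_check[OF golomb_ruler_21, of 1037 518 "{}" pairs_1037a pairs_1037b triples_1037a triples_1037b])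
      (use cross_1037 pure_1037a pure_1037b len in
        \<open>simp_all add: pairs_1037a_def pairs_1037b_def triples_1037a_def triples_1037b_def\<close>)
  then show ?thesis unfolding len .
qed

definition pairs_1035a :: "(int \<times> int) list" where
  "pairs_1035a =
    [(29, 140), (43, 187), (63, 487), (72, 40), (85, 536), (87, 31), (89, 983), (92, 148), (94, 133),
     (116, 33), (119, 935), (122, 832), (125, 465), (128, 368), (132, 411), (133, 908), (135, 926),
     (137, 973), (140, 57), (145, 528), (146, 301), (148, 547), (151, 219), (157, 307), (158, 720),
     (159, 139), (161, 360), (163, 686), (165, 551), (168, 749), (169, 162), (175, 303), (176, 965),
     (187, 324), (191, 986), (192, 1004), (194, 993), (196, 844), (197, 287), (205, 406), (207, 196),
     (217, 222), (218, 270), (220, 527), (221, 316), (222, 233), (223, 642), (224, 422), (230, 89),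
     (232, 184), (235, 1013), (236, 999), (239, 166), (242, 137), (243, 943), (245, 657), (248, 193),
     (249, 243), (257, 199), (259, 59), (260, 791), (262, 784), (264, 14), (266, 883), (267, 607), (268, 531),
     (270, 1003), (271, 734), (276, 513), (278, 820), (279, 852), (280, 229), (281, 64), (287, 176),
     (288, 104), (290, 948), (292, 702), (295, 975), (297, 823), (299, 809), (300, 828), (302, 369),
     (303, 775), (306, 44), (311, 108), (312, 776), (313, 1033), (314, 927), (315, 740), (316, 580),
     (318, 752), (319, 359), (321, 774), (322, 271), (323, 458), (325, 947), (326, 880), (330, 815),
     (332, 481), (334, 984), (335, 125), (336, 79), (337, 934), (338, 946), (339, 10), (342, 54), (343, 700),
     (344, 549), (346, 723), (347, 903), (349, 239), (350, 132), (351, 504), (354, 662), (355, 306),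
     (356, 864), (357, 838), (359, 23), (361, 742), (362, 90), (364, 321), (365, 150), (366, 1009),
     (369, 912), (370, 693), (371, 705), (372, 473), (373, 738), (375, 50), (376, 707), (377, 448), (378, 58),
     (380, 444), (381, 616), (382, 506), (383, 157), (384, 745), (385, 81), (386, 103), (387, 728),
     (388, 480), (390, 1), (391, 811), (393, 173), (394, 953), (395, 672), (396, 223), (397, 806), (398, 47),
     (400, 99), (401, 649), (403, 170), (404, 920), (406, 680), (407, 533), (408, 252), (409, 675),
     (411, 256), (412, 134), (413, 131), (414, 995), (415, 111), (416, 918), (418, 755), (419, 13),
     (420, 119), (421, 768), (423, 201), (425, 78), (426, 631), (427, 735), (428, 652), (429, 810),
     (430, 727), (432, 944), (433, 785), (434, 714), (435, 782), (436, 696), (437, 884), (438, 901),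
     (439, 876), (440, 937), (441, 351), (442, 29), (443, 967), (445, 4), (446, 55), (447, 145), (448, 733),
     (449, 328), (450, 231), (451, 623), (452, 851), (453, 612), (454, 848), (455, 189), (456, 317),
     (457, 687), (458, 164), (459, 398), (461, 9), (462, 598), (463, 72), (465, 963), (466, 871), (467, 666),
     (468, 282), (469, 352), (470, 899), (471, 936), (472, 7), (473, 52), (474, 190), (475, 625), (476, 793),
     (478, 27), (479, 292), (480, 159), (481, 123), (482, 850), (483, 88), (484, 589), (486, 493), (487, 726),
     (488, 638), (489, 558), (490, 591), (491, 172), (492, 116), (493, 643), (494, 559), (495, 430),
     (496, 600), (498, 779), (499, 211), (500, 74), (501, 208), (502, 653), (503, 706), (504, 969),
     (506, 124), (507, 801), (508, 913), (509, 3), (511, 413), (512, 407), (513, 188), (514, 70), (515, 175),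
     (516, 62), (517, 633)]"

definition triples_1035a :: "(int \<times> int) list" where
  "triples_1035a =
    [(328, 367), (460, 274), (108, 422), (402, 358), (352, 320), (360, 307), (374, 417), (348, 298),
     (65, 379), (284, 341), (153, 477), (317, 180), (225, 174), (353, 258), (431, 212), (289, 464),
     (324, 485), (206, 304)]"

definition pairs_1035b :: "(int \<times> int) list" where
  "pairs_1035b =
    [(29, 985), (43, 542), (63, 654), (65, 887), (72, 894), (85, 541), (87, 442), (89, 1012), (92, 383),
     (108, 366), (116, 248), (119, 254), (128, 829), (132, 609), (133, 461), (135, 587), (137, 253),
     (140, 107), (145, 614), (151, 494), (157, 606), (158, 803), (159, 1019), (161, 404), (165, 862),
     (168, 804), (169, 552), (175, 576), (176, 347), (180, 1002), (187, 454), (191, 570), (192, 739),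
     (194, 554), (196, 760), (197, 605), (205, 658), (212, 859), (218, 648), (223, 647), (224, 595),
     (225, 569), (226, 355), (230, 668), (235, 468), (236, 284), (239, 277), (242, 764), (243, 1017),
     (244, 808), (245, 737), (248, 348), (249, 315), (257, 257), (259, 433), (260, 772), (262, 989),
     (264, 198), (266, 251), (267, 665), (268, 762), (270, 688), (274, 561), (275, 69), (276, 563),
     (278, 632), (279, 269), (280, 996), (282, 263), (287, 281), (288, 427), (290, 674), (295, 261),
     (297, 472), (298, 274), (299, 220), (300, 507), (301, 486), (302, 423), (303, 497), (304, 325),
     (306, 508), (307, 330), (311, 942), (313, 467), (314, 602), (315, 618), (316, 708), (317, 560),
     (318, 659), (319, 385), (320, 130), (321, 583), (322, 617), (324, 275), (326, 420), (328, 577),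
     (330, 453), (332, 627), (334, 377), (335, 562), (336, 395), (337, 553), (338, 346), (339, 477),
     (340, 457), (341, 960), (342, 586), (343, 356), (346, 854), (348, 365), (349, 1018), (350, 380),
     (351, 640), (353, 202), (355, 1015), (357, 677), (358, 744), (359, 670), (360, 135), (361, 295),
     (362, 524), (363, 128), (364, 402), (365, 421), (368, 822), (369, 582), (370, 736), (371, 817),
     (372, 650), (373, 1001), (374, 906), (375, 84), (377, 597), (378, 757), (380, 651), (382, 518),
     (383, 990), (384, 126), (385, 522), (386, 1025), (388, 620), (389, 378), (390, 353), (391, 451),
     (392, 362), (393, 836), (396, 259), (398, 858), (400, 437), (401, 209), (402, 483), (403, 431),
     (404, 567), (405, 788), (406, 276), (407, 534), (408, 290), (409, 601), (412, 914), (413, 922),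
     (415, 929), (416, 945), (417, 1007), (418, 827), (419, 718), (422, 212), (423, 498), (424, 697),
     (425, 790), (426, 177), (427, 962), (428, 207), (429, 327), (430, 443), (431, 691), (432, 987),
     (433, 1011), (434, 818), (435, 363), (436, 1023), (437, 410), (438, 955), (439, 357), (440, 538),
     (441, 557), (442, 853), (443, 388), (444, 250), (445, 575), (446, 770), (447, 812), (448, 264),
     (450, 843), (451, 232), (453, 305), (454, 889), (455, 980), (456, 532), (457, 719), (458, 805),
     (459, 408), (460, 42), (461, 414), (462, 117), (463, 446), (464, 676), (465, 417), (466, 892),
     (467, 262), (468, 881), (469, 1000), (470, 500), (471, 976), (472, 156), (473, 841), (475, 320),
     (476, 435), (477, 846), (478, 1026), (479, 361), (480, 399), (481, 272), (482, 950), (483, 981),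
     (484, 205), (485, 872), (487, 861), (488, 191), (489, 337), (490, 343), (491, 938), (492, 1028),
     (493, 367), (494, 121), (496, 765), (497, 418), (498, 371), (499, 830), (500, 136), (501, 778),
     (502, 428), (503, 724), (504, 1021), (506, 163), (507, 968), (508, 387), (509, 21), (510, 381),
     (512, 949), (513, 923), (514, 613), (515, 856), (516, 476), (517, 732)]"

definition triples_1035b :: "(int \<times> int) list" where
  "triples_1035b =
    [(222, 414), (207, 174), (163, 323), (292, 232), (122, 352), (289, 379), (217, 397), (366, 220),
     (387, 495), (148, 206), (410, 281), (452, 325), (347, 376), (125, 146), (94, 411), (221, 394),
     (395, 284)]"

lemma cross_1035: "full_int (1035 - 1) (fold insert_int (cross_list 1035 ruler_21 (pairs_1035a @ pairs_1035b)) Leaf)"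
  by (simp add: cross_list_def ruler_21_def pairs_1035a_def pairs_1035b_def)

lemma pure_1035a: "full_int 517 (fold insert_int (pure_list 1035 ruler_21 pairs_1035a triples_1035a True) Leaf)"
  by (simp add: pure_list_def ruler_21_def pairs_1035a_def triples_1035a_def)

lemma pure_1035b: "full_int 517 (fold insert_int (pure_list 1035 ruler_21 pairs_1035b triples_1035b True) Leaf)"
  by (simp add: pure_list_def ruler_21_def pairs_1035b_def triples_1035b_def)

text \<open>Now the count is 1628 = 3 * 542 + 2, so both layers carry the short orbit, of difference
  345.\<close>

lemma two_layers_1035: "\<exists>T. tight_cover 21 (layers 1 1035) (layered (set ruler_21) 1 1035) T"
proof -
  have len: "length ruler_21 = 21" "distinct ruler_21" "0 \<in> set ruler_21" by (simp_all add: ruler_21_def)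
  have "\<exists>T. tight_cover (length ruler_21) (layers 1 1035) (layered (set ruler_21) 1 1035) T"
    by (rule two_layer_check[OF golomb_ruler_21, of 1035 517 "{0, 1}" pairs_1035a pairs_1035b triples_1035a triples_1035b])
      (use cross_1035 pure_1035a pure_1035b len in
        \<open>simp_all add: pairs_1035a_def pairs_1035b_def triples_1035a_def triples_1035b_def\<close>)
  then show ?thesis unfolding len .
qed

section \<open>Extension by six layers\<close>

definition edges :: "int \<Rightarrow> nat \<Rightarrow> nat \<Rightarrow> int \<Rightarrow> (nat \<times> int) set set" where
  "edges n i j \<delta> = (\<lambda>x. {(i, (x + \<delta>) mod n), (j, x)}) ` {0..<n}"

lemma edgesI:
  assumes "0 \<le> x" "x < n" "0 \<le> y" "y < n" "\<delta> mod n = (x - y) mod n"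
  shows "{(i, x), (j, y)} \<in> edges n i j \<delta>"
proof -
  have "(y + \<delta>) mod n = (y + (x - y)) mod n" using assms(5) by (metis mod_add_right_eq)
  also have "\<dots> = x" using assms by simp
  finally show ?thesis using assms unfolding edges_def by force
qed

lemma card_edges: "card (edges n i j \<delta>) \<le> nat n"
  using card_image_le[of "{0..<n}"] unfolding edges_def by fastforce

text \<open>What one point of the hole needs in order to become collinear with all of
  \<open>V\<close>: a perfect matching of \<open>V\<close>, weakened to a cover by at most
  \<open>c\<close> edges. In use \<open>c\<close> is half of \<open>card V\<close>.\<close>

definition edge_cover :: "nat \<Rightarrow> 'a set \<Rightarrow> 'a set set \<Rightarrow> bool" where
  "edge_cover c V N \<longleftrightarrow> finite N \<and> card N \<le> c \<and> (\<forall>e\<in>N. e \<subseteq> V \<and> card e \<le> 2) \<and> V \<subseteq> \<Union>N"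

text \<open>An enumeration of length exactly \<open>c\<close>, padded with arbitrary values when the
  set is smaller.\<close>

lemma finite_enum:
  assumes "finite \<Lambda>" "card \<Lambda> \<le> c" "0 < c"
  shows "\<exists>f. \<Lambda> \<subseteq> f ` {..<c}"
proof -
  obtain f where f: "bij_betw f {..<card \<Lambda>} \<Lambda>" using ex_bij_betw_nat_finite[OF assms(1)] by (auto simp: atLeast0LessThan)
  have "\<Lambda> = f ` {..<card \<Lambda>}" using f by (simp add: bij_betw_def)
  also have "\<dots> \<subseteq> f ` {..<c}" using assms(2) by (intro image_mono) auto
  finally show ?thesis by blast
qed

lemma edge_cover_edges:
  assumes n: "0 < n" and ij: "{i1, j1, i2, j2, i3, j3} = {..<6}"
  shows "edge_cover (3 * nat n) (layers 3 n) (edges n i1 j1 a \<union> edges n i2 j2 b \<union> edges n i3 j3 c)"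
proof -
  have lt: "i1 < 6" "j1 < 6" "i2 < 6" "j2 < 6" "i3 < 6" "j3 < 6" using ij by blast+
  have e: "e \<subseteq> layers 3 n \<and> card e \<le> 2" if "e \<in> edges n i j \<delta>" "i < 6" "j < 6" for e i j \<delta>
    using that n by (auto simp: edges_def layers_def card_insert_if)
  have cov: "(i, x) \<in> \<Union>(edges n i j \<delta>)" "(j, x) \<in> \<Union>(edges n i j \<delta>)" if "0 \<le> x" "x < n" for i j x \<delta>
    using edgesI[of x n "(x - \<delta>) mod n" \<delta> i j] edgesI[of "(x + \<delta>) mod n" n x \<delta> i j] that n
    by (auto simp: mod_simps)
  have "card (edges n i1 j1 a \<union> edges n i2 j2 b \<union> edges n i3 j3 c) \<le> card (edges n i1 j1 a) + card (edges n i2 j2 b) + card (edges n i3 j3 c)"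
    by (meson add_le_mono card_Un_le le_refl le_trans)
  also have "\<dots> \<le> 3 * nat n" using card_edges[of n i1 j1 a] card_edges[of n i2 j2 b] card_edges[of n i3 j3 c] by linarith
  finally have c: "card (edges n i1 j1 a \<union> edges n i2 j2 b \<union> edges n i3 j3 c) \<le> 3 * nat n" .
  have "(i, x) \<in> \<Union>(edges n i1 j1 a \<union> edges n i2 j2 b \<union> edges n i3 j3 c)" if "(i, x) \<in> layers 3 n" for i x
  proof -
    have x: "0 \<le> x" "x < n" and "i \<in> {i1, j1, i2, j2, i3, j3}" using that unfolding ij by (auto simp: layers_def)
    then consider "i = i1" | "i = j1" | "i = i2" | "i = j2" | "i = i3" | "i = j3" by blast
    then show ?thesis using cov[OF x] by cases blast+
  qed
  then have "layers 3 n \<subseteq> \<Union>(edges n i1 j1 a \<union> edges n i2 j2 b \<union> edges n i3 j3 c)" by (rule subrelI)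
  moreover have "finite (edges n i j \<delta>)" for i j \<delta> by (simp add: edges_def)
  moreover have "e' \<subseteq> layers 3 n \<and> card e' \<le> 2"
    if "e' \<in> edges n i1 j1 a \<union> edges n i2 j2 b \<union> edges n i3 j3 c" for e'
    using that e[of e'] lt by (elim UnE) simp_all
  ultimately show ?thesis using c unfolding edge_cover_def by simp
qed

definition spans :: "int \<Rightarrow> (nat \<times> int) set set set \<Rightarrow> nat \<Rightarrow> nat \<Rightarrow> int set \<Rightarrow> bool" where
  "spans n \<N> i j \<Lambda> \<longleftrightarrow> (\<forall>\<mu>\<in>\<Lambda>. \<exists>N\<in>\<N>. edges n i j \<mu> \<subseteq> N)"

lemma spans_mono: "spans n \<N> i j \<Lambda> \<Longrightarrow> \<N> \<subseteq> \<N>' \<Longrightarrow> \<Lambda>' \<subseteq> \<Lambda> \<Longrightarrow> spans n \<N>' i j \<Lambda>'"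
  unfolding spans_def by blast

definition cover_family :: "int \<Rightarrow> nat \<Rightarrow> (nat \<times> int) set set set \<Rightarrow> bool" where
  "cover_family n c \<N> \<longleftrightarrow> finite \<N> \<and> card \<N> \<le> c \<and> (\<forall>N\<in>\<N>. edge_cover (3 * nat n) (layers 3 n) N)"

lemma cover_family_Un:
  "cover_family n c \<N> \<Longrightarrow> cover_family n c' \<N>' \<Longrightarrow> cover_family n (c + c') (\<N> \<union> \<N>')"
  unfolding cover_family_def by (auto intro: order_trans[OF card_Un_le add_mono])

text \<open>The covers are formed in parallel: each takes one leftover difference from each of the
  three pairs of layers, so \<open>c\<close> covers exhaust three lists of length up to
  \<open>c\<close>. This is why the leftovers on the pairs of one matching are made equally
  many.\<close>

lemma cover_family_exists:
  assumes n: "0 < n" and ij: "{i1, j1, i2, j2, i3, j3} = {..<6}" and c: "0 < c"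
    and 1: "finite \<Lambda>1 \<and> card \<Lambda>1 \<le> c" and 2: "finite \<Lambda>2 \<and> card \<Lambda>2 \<le> c" and 3: "finite \<Lambda>3 \<and> card \<Lambda>3 \<le> c"
  shows "\<exists>\<N>. cover_family n c \<N> \<and> spans n \<N> i1 j1 \<Lambda>1 \<and> spans n \<N> i2 j2 \<Lambda>2 \<and> spans n \<N> i3 j3 \<Lambda>3"
proof -
  obtain f1 f2 f3 where f: "\<Lambda>1 \<subseteq> f1 ` {..<c}" "\<Lambda>2 \<subseteq> f2 ` {..<c}" "\<Lambda>3 \<subseteq> f3 ` {..<c}"
    using finite_enum[OF _ _ c] 1 2 3 by metis
  define N where "N \<kappa> = edges n i1 j1 (f1 \<kappa>) \<union> edges n i2 j2 (f2 \<kappa>) \<union> edges n i3 j3 (f3 \<kappa>)" for \<kappa>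
  have "edge_cover (3 * nat n) (layers 3 n) (N \<kappa>)" for \<kappa>
    unfolding N_def by (rule edge_cover_edges[OF n ij])
  then have "cover_family n c (N ` {..<c})"
    using card_image_le[of "{..<c}" N] unfolding cover_family_def by simp
  moreover have "spans n (N ` {..<c}) i1 j1 \<Lambda>1" "spans n (N ` {..<c}) i2 j2 \<Lambda>2" "spans n (N ` {..<c}) i3 j3 \<Lambda>3"
    using f unfolding spans_def N_def by fastforce+
  ultimately show ?thesis by blast
qed

text \<open>Every point of the hole is joined to the edges of one of the covers in \<open>\<N>\<close>.\<close>

lemma tight_cover_extend:
  assumes hole: "tight_cover w V0 E0 T0" and G: "girth5_graph w V E" and \<N>: "finite \<N>" "\<N> \<noteq> {}" "card \<N> \<le> card V0"
    and N: "\<And>N. N \<in> \<N> \<Longrightarrow> edge_cover c V N"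
    and Tl: "finite Tl" "\<And>t. t \<in> Tl \<Longrightarrow> t \<subseteq> V \<and> card t \<le> 3"
    and cov: "\<And>x y. x \<in> V \<Longrightarrow> y \<in> V \<Longrightarrow> far E x y \<Longrightarrow> (\<exists>t\<in>Tl. x \<in> t \<and> y \<in> t) \<or> (\<exists>N\<in>\<N>. \<exists>e\<in>N. x \<in> e \<and> y \<in> e)"
    and count: "6 * card Tl + 6 * c * card V0 + card V * (1 + w\<^sup>2) \<le> card V * card V + 2 * card V0 * card V"
  shows "\<exists>T. tight_cover w (V0 <+> V) (rel_sum E0 E) T"
proof -
  have G0: "girth5_graph w V0 E0" and T0: "finite T0" "\<And>t. t \<in> T0 \<Longrightarrow> t \<subseteq> V0 \<and> card t \<le> 3"
    and cov0: "\<And>x y. x \<in> V0 \<Longrightarrow> y \<in> V0 \<Longrightarrow> far E0 x y \<Longrightarrow> \<exists>t\<in>T0. x \<in> t \<and> y \<in> t"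
    and cnt0: "6 * card T0 + card V0 * (1 + w\<^sup>2) \<le> card V0 * card V0"
    using hole unfolding tight_cover_def by blast+
  have fin: "finite V0" "finite V" using G0 G unfolding girth5_graph_def by blast+
  have ne: "V0 \<noteq> {}" using \<N> by auto
  obtain f where f: "\<N> \<subseteq> f ` V0"
  proof -
    obtain g where g: "bij_betw g V0 {..<card V0}"
      using ex_bij_betw_finite_nat[OF fin(1)] by (auto simp: atLeast0LessThan)
    have "0 < card V0" using ne fin by (simp add: card_gt_0_iff)
    then obtain h where "\<N> \<subseteq> h ` {..<card V0}" using finite_enum[OF \<N>(1,3)] by blast
    then have "\<N> \<subseteq> (h \<circ> g) ` V0" using g by (simp only: bij_betw_def image_comp[symmetric])
    then show ?thesis using that by blast
  qed
  obtain N0 where N0: "N0 \<in> \<N>" using \<N> by blast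
  \<comment> \<open>Points of the hole to which no cover has been assigned reuse \<open>N0\<close>,
    since every one of them has to be joined to all of \<open>V\<close>.\<close>
  define F where "F v = (if f v \<in> \<N> then f v else N0)" for v
  have F: "edge_cover c V (F v)" for v unfolding F_def using N N0 by simp
  have FN: "\<exists>v\<in>V0. F v = N" if "N \<in> \<N>" for N using that f unfolding F_def by force
  define TI where "TI = (\<Union>v\<in>V0. (\<lambda>e. insert (Inl v) (Inr ` e)) ` F v)"
  define T where "T = (`) Inl ` T0 \<union> (`) Inr ` Tl \<union> TI"
  have finF: "finite (F v)" and cF: "card (F v) \<le> c" and eF: "\<And>e. e \<in> F v \<Longrightarrow> e \<subseteq> V \<and> card e \<le> 2"
    and VF: "V \<subseteq> \<Union>(F v)" for v
    using F[of v] unfolding edge_cover_def by blast+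
  have finT: "finite T" unfolding T_def TI_def using T0 Tl fin finF by simp
  have TI: "x \<subseteq> V0 <+> V \<and> card x \<le> 3" if "x \<in> TI" for x
  proof -
    from that obtain v e where v: "v \<in> V0" "e \<in> F v" "x = insert (Inl v) (Inr ` e)" unfolding TI_def by blast
    have "finite e" using eF[OF v(2)] fin finite_subset by blast
    then have "card x \<le> Suc (card e)"
      using card_insert_le_m1[of "Suc (card e)" "Inr ` e" "Inl v"] v(3) by (simp add: card_image_le)
    then show ?thesis using eF[OF v(2)] v by auto
  qed
  have "card TI \<le> (\<Sum>v\<in>V0. card ((\<lambda>e. insert (Inl v) (Inr ` e)) ` F v))"
    unfolding TI_def by (rule card_UN_le[OF fin(1)])
  also have "\<dots> \<le> (\<Sum>v\<in>V0. c)"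
    by (rule sum_mono) (use card_image_le[OF finF] cF le_trans in blast)
  finally have cTI: "card TI \<le> card V0 * c" by simp
  have "card T \<le> card ((`) Inl ` T0 :: ('a + 'b) set set) + card ((`) Inr ` Tl :: ('a + 'b) set set) + card TI"
    unfolding T_def by (meson add_le_mono card_Un_le le_refl le_trans)
  also have "\<dots> \<le> card T0 + card Tl + card V0 * c"
    using card_image_le[OF T0(1), of "(`) Inl"] card_image_le[OF Tl(1), of "(`) Inr"] cTI by (meson add_le_mono)
  finally have cT: "card T \<le> card T0 + card Tl + card V0 * c" .
  have "card (V0 <+> V) = card V0 + card V" using fin by (simp add: card_Plus)
  moreover have "6 * card T + (card V0 + card V) * (1 + w\<^sup>2) \<le> (card V0 + card V) * (card V0 + card V)"
  proof -
    have "6 * card T \<le> 6 * card T0 + 6 * card Tl + 6 * c * card V0" using cT by (simp add: algebra_simps)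
    moreover have "(card V0 + card V) * (1 + w\<^sup>2) = card V0 * (1 + w\<^sup>2) + card V * (1 + w\<^sup>2)"
      by (rule add_mult_distrib)
    moreover have "(card V0 + card V) * (card V0 + card V) = card V0 * card V0 + card V * card V + 2 * card V0 * card V"
      by (simp add: algebra_simps)
    ultimately show ?thesis using cnt0 count by linarith
  qed
  moreover have "x \<subseteq> V0 <+> V \<and> card x \<le> 3" if x: "x \<in> T" for x
  proof -
    consider t where "t \<in> T0" "x = Inl ` t" | t where "t \<in> Tl" "x = Inr ` t" | "x \<in> TI"
      using x unfolding T_def by blast
    then show ?thesis
    proof cases
      case 1 then show ?thesis using T0(2)[OF 1(1)] by (auto simp: card_image)
    next
      case 2 then show ?thesis using Tl(2)[OF 2(1)] by (auto simp: card_image)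
    qed (rule TI)
  qed
  moreover have "\<exists>t\<in>T. x \<in> t \<and> y \<in> t"
    if xy: "x \<in> V0 <+> V" "y \<in> V0 <+> V" "far (rel_sum E0 E) x y" for x y
  proof -
    have mixed: "\<exists>t\<in>TI. Inl a \<in> t \<and> Inr b \<in> t" if ab: "a \<in> V0" "b \<in> V" for a b
    proof -
      obtain e where "e \<in> F a" "b \<in> e" using VF[of a] ab by blast
      then show ?thesis using ab unfolding TI_def by blast
    qed
    show ?thesis
    proof (cases x; cases y)
      fix a b assume e: "x = Inl a" "y = Inl b"
      have "far E0 a b" using xy(3) unfolding far_def e by (metis rel_sum_simps(1) sum.inject(1))
      then obtain t where "t \<in> T0" "a \<in> t" "b \<in> t" using cov0 xy e by auto
      then show ?thesis unfolding T_def e by blast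
    next
      fix a b assume e: "x = Inl a" "y = Inr b"
      then show ?thesis using mixed[of a b] xy unfolding T_def by auto
    next
      fix a b assume e: "x = Inr a" "y = Inl b"
      then show ?thesis using mixed[of b a] xy unfolding T_def by auto
    next
      fix a b assume e: "x = Inr a" "y = Inr b"
      have "far E a b" using xy(3) unfolding far_def e by (metis rel_sum_simps(4) sum.inject(2))
      then consider t where "t \<in> Tl" "a \<in> t" "b \<in> t" | N d where "N \<in> \<N>" "d \<in> N" "a \<in> d" "b \<in> d"
        using cov[of a b] xy e by auto
      then show ?thesis
      proof cases
        case 1 then show ?thesis unfolding T_def e by blast
      next
        case 2
        then obtain v where v: "v \<in> V0" "F v = N" using FN by blast
        have inT: "insert (Inl v) (Inr ` d) \<in> T" unfolding T_def TI_def
          by (rule UnI2, rule UN_I[OF v(1)], rule imageI) (use v(2) 2(2) in simp)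
        show ?thesis by (rule bexI[OF _ inT]) (use 2(3,4) e in simp)
      qed
    qed
  qed
  ultimately have "tight_cover w (V0 <+> V) (rel_sum E0 E) T"
    unfolding tight_cover_def using girth5_graph_sum[OF G0 G] finT by simp
  then show ?thesis by blast
qed

text \<open>The Latin triples leave out a window of about \<open>s\<close> residues starting at 0,
  which must contain \<open>D\<close>; hence \<open>M < int s - 1\<close>, the window being one
  shorter for even \<open>n\<close>. The sum \<open>s + t\<close> is twice the number of positive
  differences of \<open>D\<close>, and \<open>t\<close> is the number of triples in
  \<open>zblocks\<close>. The differences 2, 4, 6, 10 guarantee that the residues consumed by
  \<open>Y\<close> and \<open>Z\<close> are among the leftovers.\<close>

locale six_layers =
  fixes D :: "int set" and M n :: int and w s t :: nat
  assumes golomb: "golomb D M" and finD: "finite D" and cardD: "card D = w"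
    and M: "0 \<le> M" "M < int s - 1" and n: "2 * int s \<le> n" and st: "s + t = w * (w - 1)"
    and t12: "t = 1 \<or> t = 2" and small: "{2, 4, 6, 10} \<subseteq> {a - b | a b. a \<in> D \<and> b \<in> D}" and ws: "w + 3 \<le> s"
begin

definition F where "F = {e. 0 < e \<and> (\<exists>a\<in>D. \<exists>b\<in>D. e = a - b)}"

definition h where "h = (n - 1) div 2"

text \<open>The pairs \<open>(\<alpha> e, \<alpha> e + e)\<close> are nested around \<open>0\<close> for even \<open>e\<close> and around \<open>h + 1/2\<close>
  for odd \<open>e\<close>, so that they are disjoint modulo \<open>n\<close>.\<close>

definition \<alpha> :: "int \<Rightarrow> int" where "\<alpha> e = (if even e then - (e div 2) else h - (e - 1) div 2)"

text \<open>The differences from \<open>i\<close> to \<open>next_layer i\<close> that no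
  \<open>mixed\<close> triple covers: two for every omitted \<open>e\<close> in \<open>F\<close>,
  the centre 0, and for even \<open>n\<close> the one further residue that the nested pairs
  miss.\<close>

definition rest where
  "rest = \<alpha> ` F \<union> (\<lambda>e. \<alpha> e + e) ` F \<union> {0} \<union> (if even n then {- 1 - h div 2} else {})"

text \<open>Six of the fifteen pairs of layers, with directions: 0 to 2, 2 to 4, 4 to 0, and 1 to 4,
  3 to 0, 5 to 2. The other nine form the triangles {5, 0, 1}, {1, 2, 3}, {3, 4, 5} used by
  \<open>latin\<close>, which contain the graph pairs {0, 1}, {2, 3}, {4, 5}.\<close>

definition next_layer :: "nat \<Rightarrow> nat" where "next_layer i = (if odd i then i + 3 else i + 2) mod 6"

text \<open>The triples with the differences in \<open>Y\<close> and \<open>Z\<close> (see \<open>yblock\<close> and \<open>zblocks\<close>) are chosen so that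
  the cross differences left over are exactly as many as the \<open>5 s - w - 1 + t\<close> points of the hole require,
  for both parities of \<open>n\<close>; \<open>L1\<close>, ..., \<open>L5\<close> are these leftovers.\<close>

definition Y :: "(int \<times> int) set" where "Y = (if even n then {(2, 2), (5, 3)} else {(2, 2)})"

definition Z :: "nat \<Rightarrow> int set" where
  "Z i = (if t = 1 then {0} else if i = 0 then {1, -1} else if i = 2 then {-1, 0} else {0, 1})"

text \<open>The pairs \<open>(a, \<phi> a)\<close> form a near-complete mapping: \<open>a\<close>, \<open>\<phi> a\<close> and \<open>a + \<phi> a\<close> each run
  over distinct residues.\<close>

definition \<phi> :: "int \<Rightarrow> int" where "\<phi> a = (if even n \<and> n div 2 \<le> a then a + 1 else a)"

text \<open>A cyclic group of even order has no complete mapping, so for even \<open>n\<close> the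
  index \<open>n - 1\<close> is given up; the window is one shorter in return, and \<open>A\<close>
  has \<open>n - s\<close> elements for both parities.\<close>

definition A where "A = (if even n then {int s - 1..<n - 1} else {int s..<n})"

text \<open>For even \<open>i\<close>, modulo 6: \<open>L1\<close> belongs to the graph pair from
  \<open>i + 1\<close> to \<open>i\<close>, \<open>L2\<close> to \<open>i + 5\<close> and
  \<open>i + 1\<close>, \<open>L3\<close> to \<open>i + 5\<close> and \<open>i\<close>.
  \<open>L4\<close> belongs to the arrows \<open>next_layer\<close> out of odd layers,
  \<open>L5\<close> to those out of even layers.\<close>

definition L1 where "L1 = (if even n then insert (n - 1) {0..<int s - 1} else {0..<int s}) - D"
definition L2 where "L2 = (if even n then insert (n div 2) {0..<int s - 1} else {0..<int s})"
definition L3 where "L3 = (if even n then insert (n - 1) ((*) 2 ` {2..<int s - 1}) else (*) 2 ` {1..<int s})"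
definition L4 where "L4 = rest - fst ` Y"
definition L5 where "L5 i = rest - (snd ` Y \<union> Z i)"

definition mixed where "mixed i e = {(i, \<alpha> e), (i, \<alpha> e + e), (next_layer i, 0 :: int)}"
definition latin where "latin i a = {(i, 0 :: int), (Suc i, a), ((i + 5) mod 6, a + \<phi> a)}"
text \<open>Uses one leftover on an odd arrow and one on an even arrow with the same target, and
  covers the difference \<open>r - r'\<close> of \<open>L3\<close>'s pair: 0, and for even
  \<open>n\<close> also 2. The second one frees a place for the cover \<open>halves\<close>.\<close>

definition yblock where "yblock i = (\<lambda>(r, r'). {((i + 5) mod 6, r :: int), (i, r'), ((i + 2) mod 6 :: nat, 0 :: int)})"
text \<open>Along the directed triangle 0, 2, 4 the differences of a triple sum to zero. For
  \<open>t = 2\<close> the solutions \<open>(1, -1, 0)\<close> and \<open>(-1, 0, 1)\<close> differ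
  in every position, so \<open>t\<close> leftovers disappear from each even arrow.\<close>

definition zblocks :: "(nat \<times> int) set set" where
  "zblocks = (if t = 1 then {{(0, 0), (2, 0), (4, 0)}} else {{(0, 0), (2, -1), (4, 0)}, {(0, -1), (2, 0), (4, 0)}})"

definition \<B> where
  "\<B> = (\<Union>i\<in>{..<6}. mixed i ` ({1..h} - F)) \<union> (\<Union>i\<in>{0, 2, 4}. latin i ` A) \<union> zblocks \<union> (\<Union>i\<in>{0, 2, 4}. yblock i ` Y)"

lemma n_pos: "0 < n" "2 * M < n" "M \<le> h" "1 \<le> h"
  using M n ws unfolding h_def by linarith+

lemma n_h: "n = (if even n then 2 * h + 2 else 2 * h + 1)"
  unfolding h_def by presburger

lemma F_sub: "F \<subseteq> {1..M}"
proof
  fix e assume "e \<in> F"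
  then obtain a b where ab: "0 < e" "a \<in> D" "b \<in> D" "e = a - b" unfolding F_def by blast
  then have "a \<in> {0..M}" "b \<in> {0..M}" using golomb unfolding golomb_def by blast+
  then show "e \<in> {1..M}" using ab by auto
qed

lemma finF: "finite F" using F_sub finite_subset by blast

lemma card_F: "2 * card F = w * (w - 1)"
proof -
  let ?P = "{(a, b). a \<in> D \<and> b \<in> D \<and> b < a}"
  have fin: "finite ?P" by (rule finite_subset[of _ "D \<times> D"]) (use finD in auto)
  have "{(a, b). a \<in> D \<and> b \<in> D \<and> a \<noteq> b} = ?P \<union> prod.swap ` ?P" by force
  moreover have "card (?P \<union> prod.swap ` ?P) = card ?P + card (prod.swap ` ?P)"
    using fin by (intro card_Un_disjoint) auto
  moreover have "card (prod.swap ` ?P) = card ?P" by (rule card_image) auto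
  ultimately have 1: "w * (w - 1) = 2 * card ?P" using card_ordered_pairs[OF finD] cardD by simp
  have "F = (\<lambda>(a, b). a - b) ` ?P"
  proof (rule set_eqI)
    fix e
    have "e \<in> F \<longleftrightarrow> (\<exists>a b. a \<in> D \<and> b \<in> D \<and> b < a \<and> e = a - b)" unfolding F_def by auto
    then show "e \<in> F \<longleftrightarrow> e \<in> (\<lambda>(a, b). a - b) ` ?P" by (auto simp: image_iff)
  qed
  moreover have "inj_on (\<lambda>(a, b). a - b) ?P"
  proof (rule inj_onI)
    fix p q assume *: "p \<in> ?P" "q \<in> ?P" "(\<lambda>(a, b). a - b) p = (\<lambda>(a, b). a - b) q"
    obtain a b c d where pq: "p = (a, b)" "q = (c, d)" by (metis surj_pair)
    have g: "\<forall>a\<in>D. \<forall>b\<in>D. \<forall>c\<in>D. \<forall>d\<in>D. b < a \<longrightarrow> a - b = c - d \<longrightarrow> a = c"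
      using golomb unfolding golomb_def by (rule conjunct2)
    have "a \<in> D" "b \<in> D" "c \<in> D" "d \<in> D" "b < a" "a - b = c - d" using * unfolding pq by simp_all
    then have "a = c" using g[rule_format, of a b c d] by simp
    then show "p = q" using *(3) pq by simp
  qed
  ultimately have "card F = card ?P" by (simp add: card_image)
  then show ?thesis using 1 by simp
qed

lemma small_F: "{2, 4, 6, 10} \<subseteq> F" using small unfolding F_def by force

lemma small_rest: "0 \<in> rest" "1 \<in> rest" "-1 \<in> rest" "2 \<in> rest" "3 \<in> rest" "5 \<in> rest"
proof -
  have a: "\<alpha> e \<in> rest \<and> \<alpha> e + e \<in> rest" if "e \<in> F" for e using that unfolding rest_def by blast
  have e: "\<alpha> 2 = -1" "\<alpha> 4 = -2" "\<alpha> 6 = -3" "\<alpha> 10 = -5" by (simp_all add: \<alpha>_def)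
  show "0 \<in> rest" by (simp add: rest_def)
  show "1 \<in> rest" "-1 \<in> rest" "2 \<in> rest" "3 \<in> rest" "5 \<in> rest"
    using a[of 2] a[of 4] a[of 6] a[of 10] small_F by (simp_all add: e)
qed

lemma fin_rest: "finite rest" using finF by (simp add: rest_def)

text \<open>The pairs of \<open>F\<close> account for \<open>s + t\<close>. The nested pairs miss
  one residue for odd \<open>n\<close> and two for even \<open>n\<close>, and \<open>Y\<close> is
  given just that size.\<close>

lemma card_rest: "card rest \<le> s + t + card Y"
proof -
  have "card (\<alpha> ` F \<union> (\<lambda>e. \<alpha> e + e) ` F) \<le> card F + card F"
    using card_image_le[OF finF] card_Un_le by (meson add_le_mono le_trans)
  then have "card (\<alpha> ` F \<union> (\<lambda>e. \<alpha> e + e) ` F) \<le> s + t" using card_F st by linarith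
  moreover have "card rest \<le> card (\<alpha> ` F \<union> (\<lambda>e. \<alpha> e + e) ` F) + card {0 :: int} + card (if even n then {- 1 - h div 2} else {})"
    unfolding rest_def by (meson add_le_mono card_Un_le le_refl le_trans)
  ultimately show ?thesis by (auto simp: Y_def)
qed

lemma card_L4: "finite L4 \<and> card L4 \<le> s + t"
proof -
  have "fst ` Y \<subseteq> rest" using small_rest by (auto simp: Y_def)
  moreover have "card (fst ` Y) = card Y" by (simp add: Y_def)
  ultimately show ?thesis unfolding L4_def using card_rest fin_rest
    by (simp add: card_Diff_subset finite_subset)
qed

lemma card_L5: "finite (L5 i) \<and> card (L5 i) \<le> s"
proof -
  have "snd ` Y \<union> Z i \<subseteq> rest" using small_rest by (auto simp: Y_def Z_def)
  moreover have "card (snd ` Y \<union> Z i) = card Y + t" using t12 by (auto simp: Y_def Z_def)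
  moreover have "finite (snd ` Y \<union> Z i)" by (auto simp: Y_def Z_def)
  ultimately show ?thesis unfolding L5_def using card_rest fin_rest
    by (simp add: card_Diff_subset)
qed

text \<open>The marks of \<open>D\<close> lie in the window and are edges of the graph, which saves
  \<open>w\<close> covers.\<close>

lemma card_L1: "finite L1 \<and> card L1 \<le> s - w"
proof -
  let ?S = "if even n then insert (n - 1) {0..<int s - 1} else {0..<int s}"
  have "D \<subseteq> ?S" using golomb M unfolding golomb_def by auto
  moreover have "card ?S \<le> s" using ws by (auto simp: card_insert_if)
  ultimately show ?thesis unfolding L1_def using finD cardD by (simp add: card_Diff_subset diff_le_mono)
qed

lemma card_L2: "finite L2 \<and> card L2 \<le> s"
  using ws by (auto simp: L2_def card_insert_if)

lemma card_L3: "finite L3" "odd n \<Longrightarrow> card L3 \<le> s - 1" "even n \<Longrightarrow> card L3 \<le> s - 2"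
proof -
  show "finite L3" by (simp add: L3_def)
  have c: "card ((*) 2 ` {a..<b :: int}) \<le> nat (b - a)" for a b :: int
    using card_image_le[of "{a..<b}" "(*) 2"] by simp
  show "odd n \<Longrightarrow> card L3 \<le> s - 1" using c[of 1 "int s"] by (simp add: L3_def nat_diff_distrib)
  show "even n \<Longrightarrow> card L3 \<le> s - 2"
    using c[of 2 "int s - 1"] ws card_insert_le_m1[of "s - 2" "(*) 2 ` {2..<int s - 1}" "n - 1"]
    by (simp add: L3_def)
qed

text \<open>With \<open>l = h div 2\<close>, the pairs of even \<open>e\<close> fill the interval
  from \<open>- l\<close> to \<open>l\<close> except 0, those of odd \<open>e\<close> the interval
  from \<open>l + 1\<close> to \<open>2 h - l\<close>. These are all residues for
  \<open>n = 2 h + 1\<close>; for \<open>n = 2 h + 2\<close> the residue \<open>- 1 - l\<close> is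
  missing.\<close>

lemma zigzag:
  "(\<exists>e. 1 \<le> e \<and> e \<le> h \<and> (\<alpha> e mod n = \<delta> mod n \<or> (\<alpha> e + e) mod n = \<delta> mod n)) \<or> \<delta> mod n = 0 \<or>
   even n \<and> (- 1 - h div 2) mod n = \<delta> mod n"
proof -
  define l where "l = h div 2"
  define d where "d = (\<delta> + l) mod n - l"
  have r: "- l \<le> d" "d \<le> n - 1 - l" 
    using pos_mod_sign[OF n_pos(1), of "\<delta> + l"] pos_mod_bound[OF n_pos(1), of "\<delta> + l"] unfolding d_def by linarith+
  have dm: "d mod n = \<delta> mod n" unfolding d_def by (simp add: mod_diff_left_eq)
  have l: "2 * l \<le> h" "h \<le> 2 * l + 1" unfolding l_def by presburger+
  consider "d = 0" | "0 < d" "d \<le> l" | "d < 0" | "l < d" "d \<le> h" | "h < d" "d \<le> 2 * h - l" | "2 * h - l < d"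
    by linarith
  then show ?thesis
  proof cases
    case 1 then show ?thesis using dm by simp
  next
    case 2
    have "\<alpha> (2 * d) + (2 * d) = d" by (simp add: \<alpha>_def)
    then have "(\<alpha> (2 * d) + (2 * d)) mod n = \<delta> mod n" using dm by argo
    moreover have "1 \<le> 2 * d" "2 * d \<le> h" using 2 l by linarith+
    ultimately show ?thesis by blast
  next
    case 3
    have "\<alpha> (- 2 * d) = d" by (simp add: \<alpha>_def)
    then have "(\<alpha> (- 2 * d)) mod n = \<delta> mod n" using dm by argo
    moreover have "1 \<le> - 2 * d" "- 2 * d \<le> h" using 3 l r by linarith+
    ultimately show ?thesis by blast
  next
    case 4
    have "\<alpha> (2 * (h - d) + 1) = d" by (simp add: \<alpha>_def)
    then have "(\<alpha> (2 * (h - d) + 1)) mod n = \<delta> mod n" using dm by argo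
    moreover have "1 \<le> 2 * (h - d) + 1" "2 * (h - d) + 1 \<le> h" using 4 l by simp_all
    ultimately show ?thesis by blast
  next
    case 5
    have "\<alpha> (2 * (d - h - 1) + 1) + (2 * (d - h - 1) + 1) = d" by (simp add: \<alpha>_def)
    then have "(\<alpha> (2 * (d - h - 1) + 1) + (2 * (d - h - 1) + 1)) mod n = \<delta> mod n" using dm by argo
    moreover have "1 \<le> 2 * (d - h - 1) + 1" "2 * (d - h - 1) + 1 \<le> h" using 5 l by simp_all
    ultimately show ?thesis by blast
  next
    case 6
    then have e: "even n" "d = n + (- 1 - l)" using r n_h by (auto split: if_splits)
    then have "(- 1 - l) mod n = d mod n" by simp
    then show ?thesis using e dm unfolding l_def by simp
  qed
qed

lemma mixed_\<B>: "i < 6 \<Longrightarrow> e \<in> {1..h} - F \<Longrightarrow> mixed i e \<in> \<B>"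
  unfolding \<B>_def by (rule UnI1, rule UnI1, rule UnI1) (intro UN_I[of i] imageI, simp)

lemma cov_pure: "i < 6 \<Longrightarrow> 1 \<le> e \<Longrightarrow> e \<le> h \<Longrightarrow> e \<notin> F \<Longrightarrow> dcov \<B> n i i e"
  by (rule dcovI[OF mixed_\<B>[of i e], of _ "\<alpha> e + e" _ "\<alpha> e"]) (auto simp: mixed_def)

lemma cov_rest:
  assumes "i < 6"
  shows "dcov \<B> n i (next_layer i) \<delta> \<or> (\<exists>\<mu>\<in>rest. \<mu> mod n = \<delta> mod n)"
  using zigzag[of \<delta>]
proof (elim disjE exE conjE)
  fix e assume e: "1 \<le> e" "e \<le> h" and m: "\<alpha> e mod n = \<delta> mod n"
  show ?thesis
  proof (cases "e \<in> F")
    case True then show ?thesis using m unfolding rest_def by blast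
  next
    case False
    have "dcov \<B> n i (next_layer i) \<delta>"
      by (rule dcovI[OF mixed_\<B>[of i e], of _ "\<alpha> e" _ 0]) (use e m False assms in \<open>auto simp: mixed_def\<close>)
    then show ?thesis by blast
  qed
next
  fix e assume e: "1 \<le> e" "e \<le> h" and m: "(\<alpha> e + e) mod n = \<delta> mod n"
  show ?thesis
  proof (cases "e \<in> F")
    case True then show ?thesis using m unfolding rest_def by blast
  next
    case False
    have "dcov \<B> n i (next_layer i) \<delta>"
      by (rule dcovI[OF mixed_\<B>[of i e], of _ "\<alpha> e + e" _ 0]) (use e m False assms in \<open>auto simp: mixed_def\<close>)
    then show ?thesis by blast
  qed
next
  assume "\<delta> mod n = 0" then show ?thesis using small_rest(1) by force
next
  assume "even n" "(- 1 - h div 2) mod n = \<delta> mod n"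
  then show ?thesis unfolding rest_def by auto
qed

lemma yblock_\<B>: "i \<in> {0, 2, 4} \<Longrightarrow> p \<in> Y \<Longrightarrow> yblock i p \<in> \<B>"
  unfolding \<B>_def by (intro UnI2 UN_I[of i] imageI)

lemma cov_L4:
  assumes "i \<in> {1, 3, 5}"
  shows "dcov \<B> n i (next_layer i) \<delta> \<or> (\<exists>\<mu>\<in>L4. \<mu> mod n = \<delta> mod n)"
proof -
  have "dcov \<B> n i (next_layer i) \<delta>" if "(r, r') \<in> Y" "r mod n = \<delta> mod n" for r r'
  proof -
    \<comment> \<open>The blocks serving the odd layer \<open>i\<close> are indexed by the even
      layer after it.\<close>
    let ?j = "(i + 1) mod 6"
    have "?j \<in> {0, 2, 4}" "i = (?j + 5) mod 6" "next_layer i = (?j + 2) mod 6"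
      using assms by (auto simp: next_layer_def)
    then show ?thesis using that
      by (intro dcovI[OF yblock_\<B>[of ?j "(r, r')"], of _ r _ 0]) (simp_all add: yblock_def)
  qed
  then have "dcov \<B> n i (next_layer i) \<delta>" if "\<mu> \<in> fst ` Y" "\<mu> mod n = \<delta> mod n" for \<mu>
    using that by force
  moreover have "i < 6" using assms by auto
  ultimately show ?thesis using cov_rest[of i \<delta>] unfolding L4_def by blast
qed

lemma cov_L5:
  assumes i: "i \<in> {0, 2, 4}"
  shows "dcov \<B> n i (next_layer i) \<delta> \<or> (\<exists>\<mu>\<in>L5 i. \<mu> mod n = \<delta> mod n)"
proof -
  have "dcov \<B> n i (next_layer i) \<delta>" if "(r, r') \<in> Y" "r' mod n = \<delta> mod n" for r r'
    using that i by (intro dcovI[OF yblock_\<B>[of i "(r, r')"], of _ r' _ 0]) (auto simp: yblock_def next_layer_def)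
  then have "dcov \<B> n i (next_layer i) \<delta>" if "\<mu> \<in> snd ` Y" "\<mu> mod n = \<delta> mod n" for \<mu>
    using that by force
  moreover have "dcov \<B> n i (next_layer i) \<delta>" if m: "\<mu> \<in> Z i" "\<mu> mod n = \<delta> mod n" for \<mu>
  proof -
    have "\<exists>B\<in>zblocks. \<exists>a b. (i, a) \<in> B \<and> (next_layer i, b) \<in> B \<and> a - b = \<mu>"
      using m(1) i by (auto simp: Z_def zblocks_def next_layer_def)
    then obtain B a b where "B \<in> \<B>" "(i, a) \<in> B" "(next_layer i, b) \<in> B" "a - b = \<mu>"
      unfolding \<B>_def by blast
    then show ?thesis using m(2) by (intro dcovI[of B]) auto
  qed
  moreover have "i < 6" using i by auto
  ultimately show ?thesis using cov_rest[of i \<delta>] unfolding L5_def by blast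
qed

lemma latin_\<B>: "i \<in> {0, 2, 4} \<Longrightarrow> a \<in> A \<Longrightarrow> latin i a \<in> \<B>"
  unfolding \<B>_def by (rule UnI1, rule UnI1, rule UnI2) (intro UN_I[of i] imageI)

lemma cov_L1:
  assumes i: "i \<in> {0, 2, 4}"
  shows "dcov \<B> n (Suc i) i \<delta> \<or> (\<exists>\<mu>\<in>L1. \<mu> mod n = \<delta> mod n) \<or> (\<exists>d\<in>D. d mod n = \<delta> mod n)"
proof (cases "\<delta> mod n \<in> A")
  case True
  have "dcov \<B> n (Suc i) i \<delta>"
    by (rule dcovI[OF latin_\<B>[OF i True], of _ "\<delta> mod n" _ 0]) (auto simp: latin_def)
  then show ?thesis by blast
next
  case False
  then have "\<delta> mod n \<in> L1 \<or> \<delta> mod n \<in> D" 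
    using pos_mod_sign[OF n_pos(1), of \<delta>] pos_mod_bound[OF n_pos(1), of \<delta>]
    by (auto simp: A_def L1_def split: if_splits)
  then show ?thesis using mod_mod_trivial by blast
qed

text \<open>For even \<open>n\<close> the map \<phi> jumps over \<open>n div 2\<close>, which is
  therefore left over in addition to the window.\<close>

lemma cov_L2:
  assumes i: "i \<in> {0, 2, 4}"
  shows "dcov \<B> n ((i + 5) mod 6) (Suc i) \<delta> \<or> (\<exists>\<mu>\<in>L2. \<mu> mod n = \<delta> mod n)"
proof (cases "\<exists>a\<in>A. \<phi> a = \<delta> mod n")
  case True
  then obtain a where a: "a \<in> A" "\<phi> a = \<delta> mod n" by blast
  have "dcov \<B> n ((i + 5) mod 6) (Suc i) \<delta>"
    by (rule dcovI[OF latin_\<B>[OF i a(1)], of _ "a + \<phi> a" _ a]) (auto simp: latin_def a(2))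
  then show ?thesis by blast
next
  case False
  have r: "0 \<le> \<delta> mod n" "\<delta> mod n < n" using n_pos(1) by simp_all
  have "\<delta> mod n \<in> L2"
  proof (rule ccontr)
    assume nL: "\<delta> mod n \<notin> L2"
    have "\<exists>a\<in>A. \<phi> a = \<delta> mod n"
    proof (cases "even n \<and> n div 2 < \<delta> mod n")
      case True
      then have "\<delta> mod n - 1 \<in> A" using n r nL by (auto simp: A_def L2_def)
      moreover have "\<phi> (\<delta> mod n - 1) = \<delta> mod n" using True by (simp add: \<phi>_def)
      ultimately show ?thesis by blast
    next
      case False
      then have "\<delta> mod n \<in> A" "\<phi> (\<delta> mod n) = \<delta> mod n" using n r nL by (auto simp: A_def L2_def \<phi>_def split: if_splits)
      then show ?thesis by blast
    qed
    then show False using False by blast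
  qed
  then show ?thesis using mod_mod_trivial by blast
qed

text \<open>For odd \<open>n\<close> doubling permutes the residues, so the doubles of the window
  are missed. For even \<open>n\<close> the indices below \<open>n div 2\<close> give the even sums
  \<open>2 a\<close> and the others the odd sums \<open>2 a + 1 - n\<close>; small even residues and
  \<open>n - 1\<close> are missed. The residue 0, and for even \<open>n\<close> also 2, comes from
  \<open>yblock\<close>.\<close>

lemma cov_L3:
  assumes i: "i \<in> {0, 2, 4}"
  shows "dcov \<B> n ((i + 5) mod 6) i \<delta> \<or> (\<exists>\<mu>\<in>L3. \<mu> mod n = \<delta> mod n)"
proof -
  let ?d = "\<delta> mod n"
  have r: "0 \<le> ?d" "?d < n" using n_pos(1) by simp_all
  have lat: "dcov \<B> n ((i + 5) mod 6) i \<delta>" if "a \<in> A" "(a + \<phi> a) mod n = ?d" for a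
    by (rule dcovI[OF latin_\<B>[OF i that(1)], of _ "a + \<phi> a" _ 0]) (use that in \<open>auto simp: latin_def\<close>)
  have yb: "dcov \<B> n ((i + 5) mod 6) i \<delta>" if "(r, r') \<in> Y" "r - r' = ?d" for r r'
    by (rule dcovI[OF yblock_\<B>[OF i that(1)], of _ r _ r']) (use that in \<open>auto simp: yblock_def\<close>)
  have L: "\<exists>\<mu>\<in>L3. \<mu> mod n = \<delta> mod n" if "?d \<in> L3" using that mod_mod_trivial by blast
  show ?thesis
  proof (cases "even n")
    case True
    show ?thesis
    proof (cases "even ?d")
      case even: True
      then obtain a where a: "?d = 2 * a" by (elim evenE)
      consider "int s - 1 \<le> a" | "a = 0" | "a = 1" | "2 \<le> a" "a < int s - 1" using a r by linarith
      then show ?thesis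
      proof cases
        case 1
        have "\<phi> a = a" "a \<in> A" using 1 True a r by (auto simp: \<phi>_def A_def)
        then show ?thesis using lat[of a] a r by simp
      next
        case 2 then show ?thesis using yb[of 2 2] True a by (simp add: Y_def)
      next
        case 3 then show ?thesis using yb[of 5 3] True a by (simp add: Y_def)
      next
        case 4 then show ?thesis using L True a by (auto simp: L3_def)
      qed
    next
      case odd: False
      show ?thesis
      proof (cases "?d = n - 1")
        case True then show ?thesis using L \<open>even n\<close> by (simp add: L3_def)
      next
        case False
        obtain a where a: "?d - 1 + n = 2 * a" using odd True by (metis evenE even_add odd_even_add odd_one even_diff)
        moreover have "?d \<noteq> 0" using odd by (metis even_zero)
        moreover have "2 * (n div 2) = n" using True by simp
        ultimately have "n div 2 \<le> a" "int s - 1 \<le> a" "a < n - 1" using r n False by linarith+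
        then have "\<phi> a = a + 1" "a \<in> A" using True by (auto simp: \<phi>_def A_def)
        moreover have "(a + (a + 1)) mod n = ?d"
        proof -
          have "a + (a + 1) = ?d + n" using a by linarith
          then show ?thesis by simp
        qed
        ultimately show ?thesis using lat[of a] by simp
      qed
    qed
  next
    case False
    have \<phi>: "\<phi> a = a" for a using False by (simp add: \<phi>_def)
    show ?thesis
    proof (cases "even ?d")
      case True
      then obtain a where a: "?d = 2 * a" by (elim evenE)
      consider "int s \<le> a" | "a = 0" | "1 \<le> a" "a < int s" using a r by linarith
      then show ?thesis
      proof cases
        case 1
        have "a \<in> A" using 1 False a r by (auto simp: A_def)
        then show ?thesis using lat[of a] a r \<phi> by simp
      next
        case 2 then show ?thesis using yb[of 2 2] False a by (simp add: Y_def)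
      next
        case 3 then show ?thesis using L False a by (auto simp: L3_def)
      qed
    next
      case odd: False
      then obtain a where a: "?d + n = 2 * a" using False by (metis evenE even_add)
      have "a \<in> A" using a r n False by (auto simp: A_def)
      moreover have "(a + a) mod n = ?d"
      proof -
        have "a + a = ?d + n" using a by linarith
        then show ?thesis by simp
      qed
      ultimately show ?thesis using lat[of a] \<phi> by simp
    qed
  qed
qed

lemma card_\<B>: "finite \<B> \<and> card \<B> \<le> 6 * (nat h - card F) + 3 * (nat n - s) + t + 3 * card Y"
proof -
  have fin: "finite ({1..h} - F)" "finite A" "finite Y" "finite zblocks"
    by (auto simp: A_def Y_def zblocks_def)
  have U: "card (\<Union>i\<in>I. f i ` S) \<le> card I * card S" if "finite I" "finite S" for f :: "nat \<Rightarrow> 'b \<Rightarrow> 'c" and I S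
  proof -
    have "card (\<Union>i\<in>I. f i ` S) \<le> (\<Sum>i\<in>I. card (f i ` S))" by (rule card_UN_le[OF that(1)])
    also have "\<dots> \<le> (\<Sum>i\<in>I. card S)" by (rule sum_mono) (rule card_image_le[OF that(2)])
    finally show ?thesis by simp
  qed
  have "card ({1..h} - F) = nat h - card F"
    using F_sub n_pos(3) finF by (subst card_Diff_subset) auto
  then have 1: "card (\<Union>i\<in>{..<6}. mixed i ` ({1..h} - F)) \<le> 6 * (nat h - card F)"
    using U[of "{..<6}" "{1..h} - F" mixed] fin by simp
  have "card A = nat n - s" using ws n by (auto simp: A_def nat_diff_distrib)
  then have 2: "card (\<Union>i\<in>{0, 2, 4}. latin i ` A) \<le> 3 * (nat n - s)"
    using U[of "{0, 2, 4}" A latin] fin by simp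
  have 3: "card zblocks \<le> t" using t12 by (auto simp: zblocks_def card_insert_if)
  have 4: "card (\<Union>i\<in>{0, 2, 4}. yblock i ` Y) \<le> 3 * card Y"
    using U[of "{0, 2, 4}" Y yblock] fin by simp
  have "card \<B> \<le> card (\<Union>i\<in>{..<6}. mixed i ` ({1..h} - F)) + card (\<Union>i\<in>{0, 2, 4}. latin i ` A) + card zblocks +
      card (\<Union>i\<in>{0, 2, 4}. yblock i ` Y)"
    unfolding \<B>_def by (meson add_le_mono card_Un_le le_refl le_trans)
  moreover have "finite \<B>" using fin by (simp add: \<B>_def)
  ultimately show ?thesis using 1 2 3 4 by linarith
qed

lemma \<B>_props:
  assumes "B \<in> \<B>"
  shows "card B \<le> 3" "finite B" "(i, a) \<in> B \<Longrightarrow> i < 2 * 3"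
proof -
  have "B \<in> zblocks \<or> (\<exists>i<6. \<exists>e. B = mixed i e) \<or> (\<exists>i\<in>{0, 2, 4}. (\<exists>a. B = latin i a) \<or> (\<exists>p. B = yblock i p))"
    using assms unfolding \<B>_def by blast
  then have "finite B \<and> card B \<le> 3 \<and> (\<forall>i a. (i, a) \<in> B \<longrightarrow> i < 2 * 3)"
    by (auto simp: zblocks_def mixed_def latin_def yblock_def next_layer_def card_insert_if split: if_splits prod.splits)
  then show "card B \<le> 3" "finite B" "(i, a) \<in> B \<Longrightarrow> i < 2 * 3" by blast+
qed

text \<open>For even \<open>n\<close> the difference \<open>n div 2\<close> is its own negative and
  lies beyond \<open>h\<close>. It is a perfect matching inside every layer, so one point of the
  hole absorbs it.\<close>

definition halves where
  "halves = (\<lambda>(i, x). {(i, x), (i, x + n div 2)}) ` ({..<6 :: nat} \<times> {0..<n div 2})"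

lemma halves_cover:
  assumes "even n"
  shows "edge_cover (3 * nat n) (layers 3 n) halves"
proof -
  have n2: "n = 2 * (n div 2)" using assms by simp
  have "card halves \<le> card ({..<6 :: nat} \<times> {0..<n div 2})"
    unfolding halves_def by (rule card_image_le) simp
  also have "\<dots> = 6 * nat (n div 2)" by (simp add: card_cartesian_product)
  also have "\<dots> = 3 * nat n" using n2 by linarith
  finally have c: "card halves \<le> 3 * nat n" .
  moreover have "e \<subseteq> layers 3 n \<and> card e \<le> 2" if "e \<in> halves" for e
    using that n2 by (auto simp: halves_def layers_def card_insert_if)
  moreover have "(i, x) \<in> \<Union>halves" if "(i, x) \<in> layers 3 n" for i x
  proof (cases "x < n div 2")
    case True
    then show ?thesis using that by (force simp: halves_def layers_def)
  next
    case False
    then have "(i, x - n div 2) \<in> {..<6 :: nat} \<times> {0..<n div 2}" using that n2 by (auto simp: layers_def)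
    then have "{(i, x - n div 2), (i, x)} \<in> halves" unfolding halves_def by force
    then show ?thesis by blast
  qed
  moreover have "finite halves" by (simp add: halves_def)
  ultimately show ?thesis unfolding edge_cover_def by (auto intro: subrelI)
qed

end

lemma split_card_le:
  assumes "finite S" "card S \<le> a + b"
  shows "\<exists>S1 S2. S = S1 \<union> S2 \<and> finite S1 \<and> finite S2 \<and> card S1 \<le> a \<and> card S2 \<le> b"
proof (cases "card S \<le> a")
  case True
  then show ?thesis using assms(1) by (intro exI[of _ S] exI[of _ "{}"]) simp
next
  case False
  then obtain S1 where S1: "S1 \<subseteq> S" "card S1 = a" by (metis nat_le_linear obtain_subset_with_card_n)
  then have "card (S - S1) \<le> b" using assms by (simp add: card_Diff_subset finite_subset)
  then show ?thesis using S1 assms(1) finite_subset[OF S1(1)] by (intro exI[of _ S1] exI[of _ "S - S1"]) auto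
qed

context six_layers
begin

text \<open>The matchings \<open>perm(1)\<close>, \<open>perm(2)\<close>, \<open>perm(3)\<close>,
  \<open>perm(4)\<close> and \<open>perm(6)\<close> are a one-factorization of the complete graph on
  the six layers. The first three contribute \<open>s\<close> covers each, the graph pairs
  \<open>s - w\<close>, and the last one \<open>s - 1\<close>, where \<open>halves\<close> counts
  for even \<open>n\<close>. \<open>perm(5)\<close> repeats the three odd arrows for the surplus
  \<open>t\<close> elements of \<open>L4\<close>.\<close>

lemma cover_family_all:
  shows "\<exists>\<N>. cover_family n (5 * s - w - 1 + t) \<N> \<and> \<N> \<noteq> {} \<and>
    (\<forall>i\<in>{0, 2, 4}. spans n \<N> (Suc i) i L1 \<and> spans n \<N> ((i + 5) mod 6) (Suc i) L2 \<and>
      spans n \<N> ((i + 5) mod 6) i L3 \<and> spans n \<N> i (next_layer i) (L5 i)) \<and>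
    (\<forall>i\<in>{1, 3, 5}. spans n \<N> i (next_layer i) L4) \<and> (even n \<longrightarrow> halves \<in> \<N>)"
proof -
  have pos: "0 < s" "0 < t" "0 < s - w" "0 < s - 1" "0 < s - 2" using ws t12 by auto
  obtain S1 S2 where S: "L4 = S1 \<union> S2" "finite S1 \<and> card S1 \<le> s" "finite S2 \<and> card S2 \<le> t"
    using split_card_le[of L4 s t] card_L4 by blast
  note n0 = n_pos(1)
  have perm: "{5, 1, 3, 0, 2, 4} = {..<6 :: nat}" "{1, 3, 5, 2, 4, 0} = {..<6 :: nat}" "{3, 5, 1, 4, 0, 2} = {..<6 :: nat}"
    "{1, 0, 3, 2, 5, 4} = {..<6 :: nat}" "{3, 0, 5, 2, 1, 4} = {..<6 :: nat}" "{5, 0, 1, 2, 3, 4} = {..<6 :: nat}"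
    by auto
  note fam = cover_family_exists[OF n0]
  obtain \<A>0 where A0: "cover_family n s \<A>0" "spans n \<A>0 5 1 L2" "spans n \<A>0 3 0 S1" "spans n \<A>0 2 4 (L5 2)"
    using fam[OF perm(1) pos(1) card_L2 S(2) card_L5[of 2]] by blast
  obtain \<A>1 where A1: "cover_family n s \<A>1" "spans n \<A>1 1 3 L2" "spans n \<A>1 5 2 S1" "spans n \<A>1 4 0 (L5 4)"
    using fam[OF perm(2) pos(1) card_L2 S(2) card_L5[of 4]] by blast
  obtain \<A>2 where A2: "cover_family n s \<A>2" "spans n \<A>2 3 5 L2" "spans n \<A>2 1 4 S1" "spans n \<A>2 0 2 (L5 0)"
    using fam[OF perm(3) pos(1) card_L2 S(2) card_L5[of 0]] by blast
  obtain \<G> where G: "cover_family n (s - w) \<G>" "spans n \<G> 1 0 L1" "spans n \<G> 3 2 L1" "spans n \<G> 5 4 L1"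
    using fam[OF perm(4) pos(3) card_L1 card_L1 card_L1] by blast
  obtain \<S> where S': "cover_family n t \<S>" "spans n \<S> 3 0 S2" "spans n \<S> 5 2 S2" "spans n \<S> 1 4 S2"
    using fam[OF perm(5) pos(2) S(3) S(3) S(3)] by blast
  obtain \<P> where P: "cover_family n (s - 1) \<P>" "spans n \<P> 5 0 L3" "spans n \<P> 1 2 L3" "spans n \<P> 3 4 L3"
    "even n \<Longrightarrow> halves \<in> \<P>"
  proof (cases "even n")
    case True
    have L3: "finite L3 \<and> card L3 \<le> s - 2" using card_L3(1) card_L3(3)[OF True] by blast
    obtain \<P> where P: "cover_family n (s - 2) \<P>" "spans n \<P> 5 0 L3" "spans n \<P> 1 2 L3" "spans n \<P> 3 4 L3"
      using fam[OF perm(6) pos(5) L3 L3 L3] by blast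
    have "cover_family n 1 {halves}" unfolding cover_family_def using halves_cover[OF True] by simp
    then have "cover_family n (s - 2 + 1) (\<P> \<union> {halves})" by (rule cover_family_Un[OF P(1)])
    moreover have "s - 2 + 1 = s - 1" using pos by simp
    ultimately show ?thesis
      using that[of "\<P> \<union> {halves}"] spans_mono[OF P(2), of "\<P> \<union> {halves}"]
        spans_mono[OF P(3), of "\<P> \<union> {halves}"] spans_mono[OF P(4), of "\<P> \<union> {halves}"] by auto
  next
    case False
    have L3: "finite L3 \<and> card L3 \<le> s - 1" using card_L3(1) card_L3(2)[OF False] by blast
    show ?thesis using fam[OF perm(6) pos(4) L3 L3 L3] False that by blast
  qed
  define \<N> where "\<N> = \<A>0 \<union> (\<A>1 \<union> (\<A>2 \<union> (\<G> \<union> (\<S> \<union> \<P>))))"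
  have sub: "\<A>0 \<subseteq> \<N>" "\<A>1 \<subseteq> \<N>" "\<A>2 \<subseteq> \<N>" "\<G> \<subseteq> \<N>" "\<S> \<subseteq> \<N>" "\<P> \<subseteq> \<N>" unfolding \<N>_def by blast+
  have "cover_family n (s + (s + (s + ((s - w) + (t + (s - 1)))))) \<N>"
    unfolding \<N>_def by (intro cover_family_Un A0(1) A1(1) A2(1) G(1) S'(1) P(1))
  moreover have "s + (s + (s + ((s - w) + (t + (s - 1))))) = 5 * s - w - 1 + t" using ws by linarith
  ultimately have 1: "cover_family n (5 * s - w - 1 + t) \<N>" by (simp only:)
  have "0 \<in> L2" using pos ws by (auto simp: L2_def)
  then have 2: "\<N> \<noteq> {}" using A0(2) sub(1) unfolding spans_def by blast
  note m = spans_mono[OF _ _ subset_refl, of n _ _ _ _ \<N>]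
  have 3: "spans n \<N> 1 0 L1" "spans n \<N> 3 2 L1" "spans n \<N> 5 4 L1" "spans n \<N> 5 1 L2" "spans n \<N> 1 3 L2" "spans n \<N> 3 5 L2"
    "spans n \<N> 5 0 L3" "spans n \<N> 1 2 L3" "spans n \<N> 3 4 L3" "spans n \<N> 0 2 (L5 0)" "spans n \<N> 2 4 (L5 2)" "spans n \<N> 4 0 (L5 4)"
    by (rule m[OF G(2) sub(4)] m[OF G(3) sub(4)] m[OF G(4) sub(4)] m[OF A0(2) sub(1)] m[OF A1(2) sub(2)] m[OF A2(2) sub(3)]
      m[OF P(2) sub(6)] m[OF P(3) sub(6)] m[OF P(4) sub(6)] m[OF A2(4) sub(3)] m[OF A0(4) sub(1)] m[OF A1(4) sub(2)])+
  have un: "spans n \<N> i j L4" if "spans n \<N> i j S1" "spans n \<N> i j S2" for i j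
    using that unfolding S(1) spans_def by blast
  have 4: "spans n \<N> 3 0 L4" "spans n \<N> 5 2 L4" "spans n \<N> 1 4 L4"
    by (rule un m[OF A0(3) sub(1)] m[OF A1(3) sub(2)] m[OF A2(3) sub(3)] m[OF S'(2) sub(5)] m[OF S'(3) sub(5)] m[OF S'(4) sub(5)])+
  have "\<forall>i\<in>{0, 2, 4}. spans n \<N> (Suc i) i L1 \<and> spans n \<N> ((i + 5) mod 6) (Suc i) L2 \<and>
      spans n \<N> ((i + 5) mod 6) i L3 \<and> spans n \<N> i (next_layer i) (L5 i)"
    using 3 by (simp add: next_layer_def numeral_2_eq_2[symmetric])
  moreover have "\<forall>i\<in>{1, 3, 5}. spans n \<N> i (next_layer i) L4" using 4 by (simp add: next_layer_def)
  moreover have "even n \<longrightarrow> halves \<in> \<N>" using P(5) sub(6) by blast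
  ultimately show ?thesis using 1 2 by blast
qed

lemma extension:
  assumes hole: "tight_cover w V0 E0 T0" and u: "card V0 + w + 1 = 5 * s + t"
  shows "\<exists>T. tight_cover w (V0 <+> layers 3 n) (rel_sum E0 (layered D 3 n)) T"
proof -
  note n0 = n_pos(1)
  obtain \<N> where N: "cover_family n (5 * s - w - 1 + t) \<N>" "\<N> \<noteq> {}"
    "\<forall>i\<in>{0, 2, 4}. spans n \<N> (Suc i) i L1 \<and> spans n \<N> ((i + 5) mod 6) (Suc i) L2 \<and>
      spans n \<N> ((i + 5) mod 6) i L3 \<and> spans n \<N> i (next_layer i) (L5 i)"
    "\<forall>i\<in>{1, 3, 5}. spans n \<N> i (next_layer i) L4" "even n \<longrightarrow> halves \<in> \<N>"
    using cover_family_all by (elim exE conjE) (rule that)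
  define Tl where "Tl = (\<Union>B\<in>\<B>. orbit n B)"
  define ok where "ok p q \<longleftrightarrow> (\<exists>t\<in>Tl. p \<in> t \<and> q \<in> t) \<or> (\<exists>N\<in>\<N>. \<exists>e\<in>N. p \<in> e \<and> q \<in> e)" for p q
  have ok_sym: "ok p q \<Longrightarrow> ok q p" for p q unfolding ok_def by blast
  have ok_orbit: "ok (i, x) (j, y)" if "dcov \<B> n i j (x - y)" "0 \<le> x" "x < n" "0 \<le> y" "y < n" for i j x y
    using dcov_orbit[OF that] unfolding ok_def Tl_def by (rule disjI1)
  have ok_edges: "ok (i, x) (j, y)"
    if "dcov \<B> n i j (x - y) \<or> (\<exists>\<mu>\<in>\<Lambda>. \<mu> mod n = (x - y) mod n)" "spans n \<N> i j \<Lambda>"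
      "0 \<le> x" "x < n" "0 \<le> y" "y < n" for i j x y \<Lambda>
    using that(1)
  proof
    assume "\<exists>\<mu>\<in>\<Lambda>. \<mu> mod n = (x - y) mod n"
    then obtain \<mu> where m: "\<mu> \<in> \<Lambda>" "\<mu> mod n = (x - y) mod n" by blast
    from that(2) m(1) obtain N where N: "N \<in> \<N>" "edges n i j \<mu> \<subseteq> N" unfolding spans_def by blast
    have "{(i, x), (j, y)} \<in> N" using N(2) edgesI[OF that(3-6) m(2)] by blast
    then show ?thesis unfolding ok_def
      by (intro disjI2 bexI[OF _ N(1)] bexI[of _ "{(i, x), (j, y)}"]) simp_all
  next
    assume "dcov \<B> n i j (x - y)"
    from ok_orbit[OF this that(3-6)] show ?thesis .
  qed
  have far_sym: "far (layered D 3 n) p q \<longleftrightarrow> far (layered D 3 n) q p" for p q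
    unfolding far_def layered_def by blast
  have ok_pure: "ok (i, x) (i, y)"
    if i: "i < 6" and f: "far (layered D 3 n) (i, x) (i, y)" and r: "0 \<le> x" "x < n" "0 \<le> y" "y < n"
    for i x y
  proof -
    \<comment> \<open>One of the differences \<open>d\<close> and \<open>n - d\<close> is at most
      \<open>h\<close>, unless \<open>n\<close> is even and \<open>d = n div 2\<close>; that case is
      left to \<open>halves\<close>.\<close>
    have half: "ok (i, x) (i, y)" if "(x - y) mod n = e" "1 \<le> e" "e \<le> h" "far (layered D 3 n) (i, x) (i, y)"
        "0 \<le> x" "x < n" "0 \<le> y" "y < n" for x y e
    proof -
      have "e \<notin> F"
      proof
        assume "e \<in> F"
        then obtain a b where ab: "a \<in> D" "b \<in> D" "e = a - b" unfolding F_def by blast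
        have "(x - y) mod n = (a - b) mod n" using that(1) ab(3) by (metis mod_mod_trivial)
        then have "\<not> far (layered D 3 n) (i, x) (i, y)"
          using that i by (intro layered_not_far_pure[OF ab(1,2)]) (auto simp: layers_def)
        then show False using that by blast
      qed
      then have "dcov \<B> n i i e" by (rule cov_pure[OF i that(2,3)])
      then have "dcov \<B> n i i (x - y)" unfolding dcov_def that(1)[symmetric] by (simp only: mod_mod_trivial)
      then show ?thesis using ok_orbit that by blast
    qed
    have ne: "x \<noteq> y" using f unfolding far_def by blast
    let ?d = "(x - y) mod n"
    have d: "?d = (if y \<le> x then x - y else x - y + n)" 
    proof (cases "y \<le> x")
      case True then show ?thesis using r by (simp add: mod_pos_pos_trivial)
    next
      case False
      have "?d = (x - y + n) mod n" by simp
      also have "\<dots> = x - y + n" using r False by (intro mod_pos_pos_trivial) auto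
      finally show ?thesis using False by simp
    qed
    have d': "(y - x) mod n = n - ?d" using mod_minus_sym[of x y n] n0 ne d r by (auto split: if_splits)
    have "?d \<le> h \<or> n - ?d \<le> h \<or> even n \<and> ?d = n div 2"
    proof (cases "even n")
      case True
      then have "n = 2 * h + 2" "n div 2 = h + 1" using n_h by simp_all
      then show ?thesis using True by linarith
    next
      case False
      then have "n = 2 * h + 1" using n_h by simp
      then show ?thesis by linarith
    qed
    then consider "?d \<le> h" | "n - ?d \<le> h" | "even n" "?d = n div 2" by blast
    then show ?thesis
    proof cases
      case 1 then show ?thesis using half[OF refl _ 1 f r] d ne r by (auto split: if_splits)
    next
      case 2
      have "ok (i, y) (i, x)"
        using half[OF d' _ 2 _ r(3,4,1,2)] f far_sym d ne r by (auto split: if_splits)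
      then show ?thesis by (rule ok_sym)
    next
      case 3
      have "{(i, x), (i, y)} \<in> halves"
      proof (cases "y \<le> x")
        case True
        then have "x = y + n div 2" "y < n div 2" using 3 d r by auto
        then have "(i, y) \<in> {..<6} \<times> {0..<n div 2}" "{(i, x), (i, y)} = {(i, y), (i, y + n div 2)}" using i r by auto
        then show ?thesis unfolding halves_def by force
      next
        case False
        then have "y = x + n div 2" "x < n div 2" using 3 d r by auto
        then have "(i, x) \<in> {..<6} \<times> {0..<n div 2}" "{(i, x), (i, y)} = {(i, x), (i, x + n div 2)}" using i r by auto
        then show ?thesis unfolding halves_def by force
      qed
      then show ?thesis using N(5) 3(1) unfolding ok_def
        by (intro disjI2 bexI[of _ halves] bexI[of _ "{(i, x), (i, y)}"]) simp_all
    qed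
  qed
  \<comment> \<open>One direction for each of the fifteen pairs of layers, matching the directions
    in which the leftovers are recorded. The clauses correspond to \<open>L4\<close>,
    \<open>L5\<close>, \<open>L1\<close>, \<open>L2\<close>, \<open>L3\<close> in this
    order.\<close>
  define arrow where "arrow i j \<longleftrightarrow> i \<in> {1, 3, 5} \<and> j = next_layer i \<or> i \<in> {0, 2, 4} \<and> j = next_layer i \<or>
    j \<in> {0, 2, 4} \<and> i = Suc j \<or> (\<exists>k\<in>{0, 2, 4}. i = (k + 5) mod 6 \<and> j = Suc k) \<or>
    j \<in> {0, 2, 4} \<and> i = (j + 5) mod 6" for i j
  have cross: "ok (i, x) (j, y)"
    if ij: "arrow i j"
      and f: "far (layered D 3 n) (i, x) (j, y)" and r: "0 \<le> x" "x < n" "0 \<le> y" "y < n" for i j x y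
  proof -
    from ij consider "i \<in> {1, 3, 5}" "j = next_layer i" | "i \<in> {0, 2, 4}" "j = next_layer i"
      | "j \<in> {0, 2, 4}" "i = Suc j" | k where "k \<in> {0, 2, 4}" "i = (k + 5) mod 6" "j = Suc k"
      | "j \<in> {0, 2, 4}" "i = (j + 5) mod 6"
      unfolding arrow_def by (elim disjE bexE conjE)
    then show ?thesis
    proof cases
      case 1 then show ?thesis using ok_edges[OF cov_L4[OF 1(1)] _ r] N(4) by simp
    next
      case 2 then show ?thesis using ok_edges[OF cov_L5[OF 2(1)] _ r] N(3) by simp
    next
      case 3
      have "\<not> (\<exists>d\<in>D. d mod n = (x - y) mod n)"
      proof
        assume "\<exists>d\<in>D. d mod n = (x - y) mod n"
        then obtain d where "d \<in> D" "(x - y) mod n = d mod n" by metis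
        then have "\<not> far (layered D 3 n) (j, y) (Suc j, x)"
          using 3 r by (intro layered_not_far_cross) (auto simp: layers_def)
        then show False using f far_sym 3 by blast
      qed
      then have "dcov \<B> n i j (x - y) \<or> (\<exists>\<mu>\<in>L1. \<mu> mod n = (x - y) mod n)" using cov_L1[OF 3(1), of "x - y"] 3(2) by blast
      then show ?thesis using ok_edges[OF _ _ r, of i j L1] N(3)[rule_format, OF 3(1)] 3(2) by simp
    next
      case 4 then show ?thesis using ok_edges[OF cov_L2[OF 4(1)] _ r] N(3)[rule_format, OF 4(1)] 4 by simp
    next
      case 5 then show ?thesis using ok_edges[OF cov_L3[OF 5(1)] _ r] N(3)[rule_format, OF 5(1)] 5 by simp
    qed
  qed
  have all_pairs: "arrow i j \<or> arrow j i"
    if "i < 6" "j < 6" "i \<noteq> j" for i j :: nat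
  proof -
    have "i \<in> {0, 1, 2, 3, 4, 5}" "j \<in> {0, 1, 2, 3, 4, 5}" using that by auto
    then show ?thesis using that(3) unfolding arrow_def by (elim insertE emptyE) (simp_all add: next_layer_def)
  qed
  have cov: "ok p q" if pq: "p \<in> layers 3 n" "q \<in> layers 3 n" "far (layered D 3 n) p q" for p q
  proof -
    obtain i x j y where e: "p = (i, x)" "q = (j, y)" by (metis surj_pair)
    have r: "i < 6" "j < 6" "0 \<le> x" "x < n" "0 \<le> y" "y < n" using pq unfolding e by (auto simp: layers_def)
    show ?thesis
    proof (cases "i = j")
      case True then show ?thesis using ok_pure r pq unfolding e by blast
    next
      case False
      from all_pairs[OF r(1,2) False] show ?thesis
      proof
        assume "arrow j i"
        then have "ok q p" using cross[of j i y x] pq(3) far_sym r unfolding e by blast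
        then show ?thesis by (rule ok_sym)
      qed (use cross[of i j x y] pq(3) r e in blast)
    qed
  qed
  show ?thesis
  proof (rule tight_cover_extend[OF hole _ _ N(2)])
    show "girth5_graph w (layers 3 n) (layered D 3 n)"
      by (rule layered_girth5[OF golomb n_pos(2) cardD finD M(1)])
    show "finite \<N>" using N(1) unfolding cover_family_def by blast
    show "edge_cover (3 * nat n) (layers 3 n) N" if "N \<in> \<N>" for N
      using N(1) that unfolding cover_family_def by blast
    show "card \<N> \<le> card V0" using N(1) u ws unfolding cover_family_def by linarith
    show "finite Tl" unfolding Tl_def using card_\<B> by (intro card_orbits(1)) blast
    show "t \<subseteq> layers 3 n \<and> card t \<le> 3" if "t \<in> Tl" for t
    proof -
      from that obtain B where B: "B \<in> \<B>" "t \<in> orbit n B" unfolding Tl_def by blast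
      show ?thesis using orbit_props[OF B(2), of "2 * 3"] \<B>_props[OF B(1)] unfolding layers_def by blast
    qed
    show "(\<exists>t\<in>Tl. x \<in> t \<and> y \<in> t) \<or> (\<exists>N\<in>\<N>. \<exists>e\<in>N. x \<in> e \<and> y \<in> e)"
      if "x \<in> layers 3 n" "y \<in> layers 3 n" "far (layered D 3 n) x y" for x y
      using cov[OF that] unfolding ok_def .
    have cV: "card (layers 3 n) = 6 * nat n" by (simp add: layers_def card_cartesian_product)
    have "card Tl \<le> card \<B> * nat n" unfolding Tl_def using card_\<B> by (intro card_orbits(2)) blast
    \<comment> \<open>For both parities the bound on \<open>card \<B>\<close> equals
      \<open>6 n - 6 s - 2 t\<close>. Adding \<open>card V0 + 1 = 5 s + t - w\<close> and
      \<open>w^2 = s + t + w\<close> gives exactly \<open>6 n\<close>, so nothing is wasted.\<close>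
    moreover have b: "card \<B> + card V0 + 1 + w\<^sup>2 \<le> 6 * nat n"
    proof -
      have w2: "w\<^sup>2 = s + t + w" using st by (cases w) (auto simp: power2_eq_square)
      have F2: "2 * card F = s + t" using card_F st by simp
      have nh: "nat n = (if even n then 2 * nat h + 2 else 2 * nat h + 1)"
        using n_h n_pos(4) by (auto split: if_splits)
      have "card F \<le> nat h" using card_mono[OF _ F_sub] n_pos(3) by simp
      moreover have "s \<le> nat n" using n by linarith
      moreover have "card Y = (if even n then 2 else 1)" by (simp add: Y_def)
      ultimately show ?thesis using card_\<B> u w2 F2 nh by (auto split: if_splits)
    qed
    ultimately have "card Tl + (card V0 + 1 + w\<^sup>2) * nat n \<le> 6 * nat n * nat n"
      using mult_le_mono1[OF b, of "nat n"] by (simp add: algebra_simps)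
    then show "6 * card Tl + 6 * (3 * nat n) * card V0 + card (layers 3 n) * (1 + w\<^sup>2)
        \<le> card (layers 3 n) * card (layers 3 n) + 2 * card V0 * card (layers 3 n)"
      unfolding cV by (simp add: algebra_simps)
  qed
qed

end

lemma tight_cover_PENT_nat:
  fixes V :: "'a :: countable set"
  assumes T: "tight_cover w V E T" and S: "steiner_system2 3 w W B" and w: "3 \<le> w" and v: "card V = 2 * r + 1 + w"
  shows "\<exists>(P :: nat set) L. PENT 3 r w P L \<and> 5 \<le> girth P (deficiency_edges P L)"
proof -
  have "card (to_nat ` V) = 2 * r + 1 + w" using v by (simp add: card_image)
  moreover have "to_nat ` V \<noteq> {}" using v by auto
  ultimately show ?thesis
    using tight_cover_PENT[OF tight_cover_image[OF T inj_to_nat] S w] by blast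
qed

lemma six_layers_PENT:
  assumes six: "six_layers D M n w s t" and hole: "\<exists>T. tight_cover w (layers 1 m) (layered D 1 m) T"
    and u: "2 * nat m + w + 1 = 5 * s + t" and S: "steiner_system2 3 w W B" and w: "3 \<le> w"
    and r: "2 * nat m + 6 * nat n = 2 * r + 1 + w"
  shows "\<exists>(P :: nat set) L. PENT 3 r w P L \<and> 5 \<le> girth P (deficiency_edges P L)"
proof -
  have card: "card (layers p q) = 2 * p * nat q" for p q by (simp add: layers_def card_cartesian_product)
  from hole obtain T0 where T0: "tight_cover w (layers 1 m) (layered D 1 m) T0" by blast
  obtain T where T: "tight_cover w (layers 1 m <+> layers 3 n) (rel_sum (layered D 1 m) (layered D 3 n)) T"
    using six_layers.extension[OF six T0] u by (auto simp: card)
  have "card (layers 1 m <+> layers 3 n) = card (layers 1 m) + card (layers 3 n)"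
    by (rule card_Plus) (simp_all add: layers_def)
  then have "card (layers 1 m <+> layers 3 n) = 2 * r + 1 + w" using r by (simp add: card)
  then show ?thesis by (rule tight_cover_PENT_nat[OF T S w])
qed

lemma six_layers_ruler_19:
  assumes "s + t = 342" "t = 1 \<or> t = 2" "2 * int s \<le> n"
  shows "six_layers (set ruler_19) 246 n 19 s t"
proof
  show "card (set ruler_19) = 19" by (simp add: ruler_19_def)
  have "\<exists>a\<in>set ruler_19. \<exists>b\<in>set ruler_19. d = a - b" if "d \<in> {2, 4, 6, 10}" for d
    using that by (elim insertE emptyE; simp add: ruler_19_def)
  then show "{2, 4, 6, 10} \<subseteq> {a - b |a b. a \<in> set ruler_19 \<and> b \<in> set ruler_19}" by blast
qed (use assms golomb_ruler_19 in auto)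

lemma six_layers_ruler_21:
  assumes "s + t = 420" "t = 1 \<or> t = 2" "2 * int s \<le> n"
  shows "six_layers (set ruler_21) 333 n 21 s t"
proof
  show "card (set ruler_21) = 21" by (simp add: ruler_21_def)
  have "\<exists>a\<in>set ruler_21. \<exists>b\<in>set ruler_21. d = a - b" if "d \<in> {2, 4, 6, 10}" for d
    using that by (elim insertE emptyE; simp add: ruler_21_def)
  then show "{2, 4, 6, 10} \<subseteq> {a - b |a b. a \<in> set ruler_21 \<and> b \<in> set ruler_21}" by blast
qed (use assms golomb_ruler_21 in auto)

theorem theorem3p4:
  shows "(\<forall>r::nat. 3411 \<le> r \<and> ([r = 0] (mod 3) \<or> [r = 2] (mod 3)) \<longrightarrow>
            (\<exists>(P::nat set) (L::nat set set).
               PENT 3 r 19 P L \<and> 5 \<le> girth P (deficiency_edges P L))) \<and>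
         (\<forall>r::nat. 4666 \<le> r \<and> ([r = 0] (mod 3) \<or> [r = 1] (mod 3)) \<longrightarrow>
            (\<exists>(P::nat set) (L::nat set set).
               PENT 3 r 21 P L \<and> 5 \<le> girth P (deficiency_edges P L)))"
proof (intro conjI allI impI)
  fix r :: nat
  assume "3411 \<le> r \<and> ([r = 0] (mod 3) \<or> [r = 2] (mod 3))"
  then have r: "3411 \<le> r" "r mod 3 = 0 \<or> r mod 3 = 2" by (auto simp: cong_def)
  obtain W B where S: "steiner_system2 3 19 (W :: (nat \<times> int) set) B" using steiner_19 by blast
  from r(2) consider "r mod 3 = 0" | "r mod 3 = 2" by (elim disjE)
  then show "\<exists>(P::nat set) (L::nat set set). PENT 3 r 19 P L \<and> 5 \<le> girth P (deficiency_edges P L)"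
  proof cases
    case 1
    \<comment> \<open>The offset is \<open>m - (w + 1) / 2 = 841 - 10\<close>, and 843 - 10 in the
      other case; the quotient by 3 is \<open>n\<close>, and the lower bound on \<open>r\<close>
      ensures \<open>2 s <= n\<close>. The parameters satisfy 340 + 2 = 19 * 18 and 2 * 841 + 20 = 5
      * 340 + 2.\<close>
    then have n: "r = 3 * ((r - 831) div 3) + 831" using r(1) by presburger
    show ?thesis
      by (rule six_layers_PENT[OF six_layers_ruler_19[of 340 2 "int ((r - 831) div 3)"] two_layers_841 _ S])
        (use n r in simp_all)
  next
    case 2
    then have n: "r = 3 * ((r - 833) div 3) + 833" using r(1) by presburger
    show ?thesis
      by (rule six_layers_PENT[OF six_layers_ruler_19[of 341 1 "int ((r - 833) div 3)"] two_layers_843 _ S])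
        (use n r in simp_all)
  qed
next
  fix r :: nat
  assume "4666 \<le> r \<and> ([r = 0] (mod 3) \<or> [r = 1] (mod 3))"
  then have r: "4666 \<le> r" "r mod 3 = 0 \<or> r mod 3 = 1" by (auto simp: cong_def)
  obtain W B where S: "steiner_system2 3 21 (W :: (nat \<times> int) set) B" using steiner_21 by blast
  from r(2) consider "r mod 3 = 0" | "r mod 3 = 1" by (elim disjE)
  then show "\<exists>(P::nat set) (L::nat set set). PENT 3 r 21 P L \<and> 5 \<le> girth P (deficiency_edges P L)"
  proof cases
    case 1
    \<comment> \<open>Likewise the offsets are 1037 - 11 and 1035 - 11, with 419 + 1 = 418 + 2 = 21
      * 20.\<close>
    then have n: "r = 3 * ((r - 1026) div 3) + 1026" using r(1) by presburger
    show ?thesis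
      by (rule six_layers_PENT[OF six_layers_ruler_21[of 419 1 "int ((r - 1026) div 3)"] two_layers_1037 _ S])
        (use n r in simp_all)
  next
    case 2
    then have n: "r = 3 * ((r - 1024) div 3) + 1024" using r(1) by presburger
    show ?thesis
      by (rule six_layers_PENT[OF six_layers_ruler_21[of 418 2 "int ((r - 1024) div 3)"] two_layers_1035 _ S])
        (use n r in simp_all)
  qed
qed

end
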